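(* Let $K\in\mathbb{N}$, $K\ge 1$, let $\Omega\subset\mathbb{R}^d$ be a bounded polyhedral domain with regular triangulation $\mathcal{T}$, and let $C=\sum_{i\in\mathcal{N}}\varphi_i C_i\colon L^2(\Omega)\to\mathcal{L}^1_K(\mathcal{T})$ and $\delta$ be the operator and the nodal distance on $\mathcal{T}$ defined in the context. Then: (i) $C$ is linear and self-adjoint with respect to the $L^2$-inner product $\langle\cdot,\cdot\rangle$; (ii) the restriction $C|_{\mathcal{L}^1_K(\mathcal{T})}$ is $L^2$-elliptic with condition number $\operatorname{cond}_2(C|_{\mathcal{L}^1_K(\mathcal{T})})=\frac{\lambda_{\max}(C|_{\mathcal{L}^1_K(\mathcal{T})})}{\lambda_{\min}(C|_{\mathcal{L}^1_K(\mathcal{T})})}\le\frac{2K+d}{K}$; (iii) $\delta$ is a geodesic distance function (an integer-valued metric) on $\mathcal{T}$ induced by the vertex-based notion of neighbors; (iv) if $v\in L^2(\Omega)$ is supported on the collection $L\subset\mathcal{T}$ of simplices, then the support of $Cv$ is at most one layer of simplices larger, i.e., if $T'\in\mathcal{T}$ satisfies $T'\subset\operatorname{supp}(Cv)$, then $\min_{T\in L}\delta(T',T)\le 1$; (v) $C$ is the identity on $\mathcal{L}^1_{K-1}(\mathcal{T})$.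
   Context: Let $d\in\mathbb{N}$, $\Omega\subset\mathbb{R}^d$ a bounded polyhedral (connected) domain, $\mathcal{T}$ a regular (conforming) triangulation of $\Omega$ into closed simplices, and $\mathcal{N}$ the set of its vertices. For $i\in\mathcal{N}$ the patch $\omega_i$ is the collection (and also the union) of all $T\in\mathcal{T}$ with $i\in T$. For $k\in\mathbb{N}_0$, $\mathcal{L}_k(T)$ is the space of polynomials of degree at most $k$ on $T$; $\mathcal{L}^1_k(\mathcal{T})=\{v\in W^{1,\infty}(\Omega): v|_T\in\mathcal{L}_k(T)\ \forall T\in\mathcal{T}\}$ is the space of continuous piecewise polynomials, and $\mathcal{L}^1_k(\omega_i)$ is the analogous space on $\omega_i$. The functions $(\varphi_i)_{i\in\mathcal{N}}$ are the Lagrange basis of $\mathcal{L}^1_1(\mathcal{T})$, $\varphi_i(j)=\delta_{ij}$ for $i,j\in\mathcal{N}$ (so $\sum_i\varphi_i=1$). $\langle\cdot,\cdot\rangle$ is the inner product of $L^2(\Omega)$ and $\langle u,v\rangle_{\varphi_i}:=\langle\varphi_i u,v\rangle$. For $i\in\mathcal{N}$, $C_i\colon L^2(\Omega)\to\mathcal{L}^1_{K-1}(\omega_i)$ maps $u$ to the $\langle\cdot,\cdot\rangle_{\varphi_i}$-orthogonal projection of $u|_{\omega_i}$ onto $\mathcal{L}^1_{K-1}(\omega_i)$, i.e. $\langle C_iu,v\rangle_{\varphi_i}=\langle u,v\rangle_{\varphi_i}$ for all $v\in\mathcal{L}^1_{K-1}(\omega_i)$. The operator $C$ is $Cu=\sum_{i\in\mathcal{N}}\varphi_iC_iu$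 (with $\varphi_iC_iu$ extended by zero outside $\omega_i$). $\lambda_{\max},\lambda_{\min}$ denote largest and smallest eigenvalues; $L^2$-elliptic means that $\lambda_{\min}>0$. Distance: simplices $T\ne T'$ in $\mathcal{T}$ are (nodal) neighbors if they share a vertex, equivalently $T\cap T'\neq\emptyset$. $\delta(T,T')$ is the smallest $N\in\mathbb{N}_0$ for which there are $T_0=T,T_1,\dots,T_N=T'$ in $\mathcal{T}$ with $T_{j-1},T_j$ neighbors for all $j=1,\dots,N$. *)

theory Defs
  imports "HOL-Analysis.Analysis"
begin

section \<open>Domains and triangulations\<close>

text \<open>The domain has no slits: it is the interior of a finite union of polytopes. Being a domain, it
  is open, connected and nonempty; openness and boundedness are automatic here.\<close>

definition bounded_polyhedral_domain :: "'a::euclidean_space set \<Rightarrow> bool" where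
  "bounded_polyhedral_domain \<Omega> \<longleftrightarrow>
     \<Omega> \<noteq> {} \<and> connected \<Omega> \<and>
     (\<exists>\<P>. finite \<P> \<and> (\<forall>P\<in>\<P>. polytope P) \<and> \<Omega> = interior (\<Union>\<P>))"

definition regular_triangulation :: "'a::euclidean_space set \<Rightarrow> 'a set set \<Rightarrow> bool" where
  "regular_triangulation \<Omega> \<T> \<longleftrightarrow>
     triangulation \<T> \<and> (\<forall>T\<in>\<T>. int DIM('a) simplex T) \<and> \<Union>\<T> = closure \<Omega>"

definition vertices :: "'a::euclidean_space set \<Rightarrow> 'a set" where
  "vertices T = {x. x extreme_point_of T}"

definition nodes :: "'a::euclidean_space set set \<Rightarrow> 'a set" where
  "nodes \<T> = (\<Union>T\<in>\<T>. vertices T)"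

definition patch :: "'a set set \<Rightarrow> 'a \<Rightarrow> 'a set set" where
  "patch \<T> i = {T \<in> \<T>. i \<in> T}"

definition neighbors :: "'a::euclidean_space set \<Rightarrow> 'a set \<Rightarrow> bool" where
  "neighbors T T' \<longleftrightarrow> T \<noteq> T' \<and> vertices T \<inter> vertices T' \<noteq> {}"

definition nodal_path :: "'a::euclidean_space set set \<Rightarrow> nat \<Rightarrow> 'a set \<Rightarrow> 'a set \<Rightarrow> bool" where
  "nodal_path \<T> N T T' \<longleftrightarrow>
     (\<exists>t :: nat \<Rightarrow> 'a set. t 0 = T \<and> t N = T' \<and> (\<forall>j\<le>N. t j \<in> \<T>) \<and>
        (\<forall>j<N. neighbors (t j) (t (Suc j))))"

definition nodal_dist :: "'a::euclidean_space set set \<Rightarrow> 'a set \<Rightarrow> 'a set \<Rightarrow> nat" where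
  "nodal_dist \<T> T T' = (LEAST N. nodal_path \<T> N T T')"

section \<open>Function spaces\<close>

text \<open>Polynomials of total degree at most \<open>k\<close>, as linear combinations of monomials whose exponents
  are indexed by the standard basis.\<close>

definition multi_indices :: "nat \<Rightarrow> ('a::euclidean_space \<Rightarrow> nat) set" where
  "multi_indices k = {\<alpha>. (\<forall>b. b \<notin> Basis \<longrightarrow> \<alpha> b = 0) \<and> (\<Sum>b\<in>Basis. \<alpha> b) \<le> k}"

definition polynomials :: "nat \<Rightarrow> ('a::euclidean_space \<Rightarrow> real) set" where
  "polynomials k =
     {p. \<exists>c. p = (\<lambda>x. \<Sum>\<alpha>\<in>multi_indices k. c \<alpha> * (\<Prod>b\<in>Basis. (x \<bullet> b) ^ \<alpha> b))}"

text \<open>Continuous piecewise polynomials on a collection \<open>\<S>\<close> of simplices (the whole triangulation or a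
  patch). A function on the closed set \<open>\<Union>\<S>\<close> is encoded by its extension by zero, so that
  distinct elements of the space are distinct functions on \<open>\<Union>\<S>\<close>.\<close>

definition pw_polynomials :: "nat \<Rightarrow> 'a::euclidean_space set set \<Rightarrow> ('a \<Rightarrow> real) set" where
  "pw_polynomials k \<S> =
     {v. continuous_on (\<Union>\<S>) v \<and> (\<forall>x. x \<notin> \<Union>\<S> \<longrightarrow> v x = 0) \<and>
         (\<forall>T\<in>\<S>. \<exists>p\<in>polynomials k. \<forall>x\<in>T. v x = p x)}"

text \<open>Elements of \<open>L2 \<Omega>\<close> are representatives, not equivalence classes.\<close>

definition L2 :: "'a::euclidean_space set \<Rightarrow> ('a \<Rightarrow> real) set" where
  "L2 \<Omega> = {u \<in> borel_measurable (lebesgue_on \<Omega>). integrable (lebesgue_on \<Omega>) (\<lambda>x. (u x)\<^sup>2)}"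

definition L2_inner :: "'a::euclidean_space set \<Rightarrow> ('a \<Rightarrow> real) \<Rightarrow> ('a \<Rightarrow> real) \<Rightarrow> real" where
  "L2_inner \<Omega> u v = (\<integral>x. u x * v x \<partial>lebesgue_on \<Omega>)"

text \<open>The support of an \<open>L\<^sup>2\<close> function: the complement of the largest open set on which it
  vanishes almost everywhere. It is contained in the closure of \<open>\<Omega>\<close>.\<close>

definition L2_support :: "'a::euclidean_space set \<Rightarrow> ('a \<Rightarrow> real) \<Rightarrow> 'a set" where
  "L2_support \<Omega> u =
     - \<Union>{U. open U \<and> (AE y in lebesgue_on \<Omega>. y \<in> U \<longrightarrow> u y = 0)}"

section \<open>The operator\<close>

definition hat :: "'a::euclidean_space set set \<Rightarrow> 'a \<Rightarrow> 'a \<Rightarrow> real" where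
  "hat \<T> i = (THE \<phi>. \<phi> \<in> pw_polynomials 1 \<T> \<and> (\<forall>j\<in>nodes \<T>. \<phi> j = (if i = j then 1 else 0)))"

definition weighted_inner ::
    "'a::euclidean_space set \<Rightarrow> 'a set set \<Rightarrow> 'a \<Rightarrow> ('a \<Rightarrow> real) \<Rightarrow> ('a \<Rightarrow> real) \<Rightarrow> real" where
  "weighted_inner \<Omega> \<T> i u v = L2_inner \<Omega> (\<lambda>x. hat \<T> i x * u x) v"

definition local_projection ::
    "'a::euclidean_space set \<Rightarrow> 'a set set \<Rightarrow> nat \<Rightarrow> 'a \<Rightarrow> ('a \<Rightarrow> real) \<Rightarrow> 'a \<Rightarrow> real" where
  "local_projection \<Omega> \<T> k i u =
     (THE w. w \<in> pw_polynomials k (patch \<T> i) \<and>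
        (\<forall>v\<in>pw_polynomials k (patch \<T> i).
           weighted_inner \<Omega> \<T> i w v = weighted_inner \<Omega> \<T> i u v))"

definition C_op ::
    "'a::euclidean_space set \<Rightarrow> 'a set set \<Rightarrow> nat \<Rightarrow> ('a \<Rightarrow> real) \<Rightarrow> 'a \<Rightarrow> real" where
  "C_op \<Omega> \<T> K u = (\<lambda>x. \<Sum>i\<in>nodes \<T>. hat \<T> i x * local_projection \<Omega> \<T> (K - 1) i u x)"

section \<open>Spectrum of an operator on a space of functions\<close>

definition eigenvalues_on ::
    "('a \<Rightarrow> real) set \<Rightarrow> (('a \<Rightarrow> real) \<Rightarrow> 'a \<Rightarrow> real) \<Rightarrow> real set" where
  "eigenvalues_on V A = {l. \<exists>v\<in>V. v \<noteq> (\<lambda>x. 0) \<and> A v = (\<lambda>x. l * v x)}"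

text \<open>\<open>Max\<close> and \<open>Min\<close> are meaningful only for a finite nonempty set of eigenvalues.\<close>

definition lambda_max :: "('a \<Rightarrow> real) set \<Rightarrow> (('a \<Rightarrow> real) \<Rightarrow> 'a \<Rightarrow> real) \<Rightarrow> real" where
  "lambda_max V A = Max (eigenvalues_on V A)"

definition lambda_min :: "('a \<Rightarrow> real) set \<Rightarrow> (('a \<Rightarrow> real) \<Rightarrow> 'a \<Rightarrow> real) \<Rightarrow> real" where
  "lambda_min V A = Min (eigenvalues_on V A)"

definition L2_elliptic_on :: "('a \<Rightarrow> real) set \<Rightarrow> (('a \<Rightarrow> real) \<Rightarrow> 'a \<Rightarrow> real) \<Rightarrow> bool" where
  "L2_elliptic_on V A \<longleftrightarrow>
     finite (eigenvalues_on V A) \<and> eigenvalues_on V A \<noteq> {} \<and> lambda_min V A > 0"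

definition cond2 :: "('a \<Rightarrow> real) set \<Rightarrow> (('a \<Rightarrow> real) \<Rightarrow> 'a \<Rightarrow> real) \<Rightarrow> real" where
  "cond2 V A = lambda_max V A / lambda_min V A"

end

theory Submission
  imports Defs "HOL-Library.Function_Algebras"
begin

text \<open>Write \<open>\<langle>u, v\<rangle>\<^sub>i = \<langle>\<phi>\<^sub>i u, v\<rangle>\<close>. Then
  \<open>\<langle>C u, v\<rangle> = \<Sum>\<^sub>i \<langle>C\<^sub>i u, C\<^sub>i v\<rangle>\<^sub>i\<close>, which gives self-adjointness and, since the
  \<open>C\<^sub>i\<close> are contractions and \<open>\<Sum>\<^sub>i \<phi>\<^sub>i = 1\<close>, the upper bound \<open>1\<close> for the eigenvalues.

  For the lower bound, write \<open>u\<close> on each simplex as a homogeneous polynomial of degree \<open>K\<close> in the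
  barycentric coordinates and let \<open>w\<^sub>i = \<partial>\<^sub>i u / K\<close>. By Euler's identity
  \<open>\<Sum>\<^sub>i \<phi>\<^sub>i w\<^sub>i = u\<close>, so \<open>\<langle>u, u\<rangle> = \<Sum>\<^sub>i \<langle>w\<^sub>i, C\<^sub>i u\<rangle>\<^sub>i\<close>, and by Cauchy-Schwarz it
  suffices that \<open>\<Sum>\<^sub>i \<langle>w\<^sub>i, w\<^sub>i\<rangle>\<^sub>i \<le> (2 K + d) / K * \<langle>u, u\<rangle>\<close>. This is local to each
  simplex. Dirichlet's formula \<open>\<integral> \<lambda>\<^sup>\<beta> = const * \<beta>! / (\<bar>\<beta>\<bar> + d)!\<close> turns it into the statement that
  the Laguerre operator, whose eigenvalues on polynomials of degree at most \<open>K\<close> are \<open>0, \<dots>, K\<close>, is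
  bounded by \<open>K\<close>; the diagonalization is Vandermonde's identity.\<close>

text \<open>The local constant can be read off from Gamma integrals. Up to a common factor,
  Dirichlet's formula replaces the integral of a form over the simplex by its integral over the
  orthant with weight \<open>exp (- \<Sum>t)\<close>, at the price of a factorial of its degree. For
  this weight the Laguerre operator has the Dirichlet form \<open>\<Sum>\<^sub>i \<integral>
  t\<^sub>i (\<partial>\<^sub>i p)\<^sup>2\<close>, which is the energy of the
  \<open>w\<^sub>i\<close>. The energy has degree 2 K - 1 and the square of a form has degree 2 K,
  so the factorials differ by 2 K + d; the eigenvalue bound contributes K and the normalization of
  \<open>w\<^sub>i\<close> contributes 1 / K^2. Together this is (2 K + d) / K. No orthant integral
  is formed: only its moments \<open>\<beta>!\<close> enter, through binomial identities.

  The delicate point about \<open>w\<^sub>i\<close> is that it must be a test function for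
  \<open>C\<^sub>i\<close>, hence continuous on the patch. Derivatives in a fixed direction jump
  between simplices; the direction towards the node stays inside every face that contains
  it.\<close>

section \<open>Spaces of real-valued functions: spans, products, gradings\<close>

global_interpretation fun_vs: vector_space "\<lambda>(c::real) f x. c * f x :: real"
  defines fun_span = fun_vs.span and fun_subspace = fun_vs.subspace
  by unfold_locales (auto simp: fun_eq_iff algebra_simps)

lemma fun_subspaceI:
  assumes "(\<lambda>x. 0) \<in> V"
    and "\<And>f g. f \<in> V \<Longrightarrow> g \<in> V \<Longrightarrow> (\<lambda>x. f x + g x) \<in> V"
    and "\<And>c f. f \<in> V \<Longrightarrow> (\<lambda>x. c * f x) \<in> V"
  shows "fun_subspace V"
  using assms unfolding fun_vs.subspace_def by (auto simp: zero_fun_def plus_fun_def)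

lemma fun_subspaceD:
  assumes "fun_subspace V"
  shows "(\<lambda>x. 0) \<in> V"
    and "\<And>f g. f \<in> V \<Longrightarrow> g \<in> V \<Longrightarrow> (\<lambda>x. f x + g x) \<in> V"
    and "\<And>c f. f \<in> V \<Longrightarrow> (\<lambda>x. c * f x) \<in> V"
    and "\<And>f g. f \<in> V \<Longrightarrow> g \<in> V \<Longrightarrow> (\<lambda>x. f x - g x) \<in> V"
  using assms fun_vs.subspace_diff[OF assms] unfolding fun_vs.subspace_def
  by (auto simp: zero_fun_def plus_fun_def fun_diff_def)

lemma fun_subspace_sum:
  assumes "fun_subspace V" "\<And>i. i \<in> I \<Longrightarrow> f i \<in> V"
  shows "(\<lambda>x. \<Sum>i\<in>I. f i x) \<in> V"
proof (cases "finite I")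
  case True
  then show ?thesis using assms(2)
    by (induction I) (auto intro: fun_subspaceD[OF assms(1)])
qed (simp add: fun_subspaceD[OF assms(1)])

lemma fun_subspace_span: "fun_subspace (fun_span B)"
  by (rule fun_vs.subspace_span)

text \<open>Turns the explicit linear combinations in \<open>polynomials\<close> into a span, so
  that inclusions and products need only be checked on monomials.\<close>

lemma range_sum_eq_fun_span:
  assumes "finite I"
  shows "{f. \<exists>c. f = (\<lambda>x. \<Sum>i\<in>I. c i * g i x)} = fun_span (g ` I)"
proof (intro equalityI subsetI)
  fix f assume "f \<in> {f. \<exists>c. f = (\<lambda>x. \<Sum>i\<in>I. c i * g i x)}"
  then obtain c where f: "f = (\<lambda>x. \<Sum>i\<in>I. c i * g i x)" by blast
  show "f \<in> fun_span (g ` I)"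
    unfolding f
    by (intro fun_subspace_sum fun_subspaceD(3) fun_subspace_span fun_vs.span_base imageI)
next
  let ?W = "{f. \<exists>c. f = (\<lambda>x. \<Sum>i\<in>I. c i * g i x)}"
  have sub: "fun_subspace ?W"
  proof (rule fun_subspaceI)
    show "(\<lambda>x. 0) \<in> ?W" by (auto intro!: exI[of _ "\<lambda>_. 0"])
  next
    fix f h assume "f \<in> ?W" "h \<in> ?W"
    then obtain c d where "f = (\<lambda>x. \<Sum>i\<in>I. c i * g i x)" "h = (\<lambda>x. \<Sum>i\<in>I. d i * g i x)" by blast
    then show "(\<lambda>x. f x + h x) \<in> ?W"
      by (auto intro!: exI[of _ "\<lambda>i. c i + d i"] simp: sum.distrib algebra_simps)
  next
    fix a f assume "f \<in> ?W"
    then obtain c where "f = (\<lambda>x. \<Sum>i\<in>I. c i * g i x)" by blast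
    then show "(\<lambda>x. a * f x) \<in> ?W"
      by (auto intro!: exI[of _ "\<lambda>i. a * c i"] simp: sum_distrib_left algebra_simps)
  qed
  have "g ` I \<subseteq> ?W"
  proof
    fix f assume "f \<in> g ` I"
    then obtain j where j: "j \<in> I" "f = g j" by blast
    have "f = (\<lambda>x. \<Sum>i\<in>I. (if i = j then 1 else 0) * g i x)"
      using j assms by (simp add: if_distrib[of "\<lambda>t. t * _"] cong: if_cong)
    then show "f \<in> ?W" by auto
  qed
  then show "f \<in> ?W" if "f \<in> fun_span (g ` I)" for f
    using fun_vs.span_minimal[OF _ sub] that by blast
qed

text \<open>The factors whose product with a fixed function lies in \<open>W\<close> form a
  subspace. Using this once in each variable reduces the claim to products of generators.\<close>

lemma fun_span_mult:
  assumes "f \<in> fun_span B" "g \<in> fun_span B'"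
    and "\<And>b b'. b \<in> B \<Longrightarrow> b' \<in> B' \<Longrightarrow> (\<lambda>x. b x * b' x) \<in> W" "fun_subspace W"
  shows "(\<lambda>x. f x * g x) \<in> W"
proof -
  note W = fun_subspaceD[OF assms(4)]
  have 1: "(\<lambda>x. b x * g x) \<in> W" if "b \<in> B" for b
  proof -
    have "fun_subspace {g. (\<lambda>x. b x * g x) \<in> W}"
      using W by (intro fun_subspaceI) (auto simp: algebra_simps)
    then have "fun_span B' \<subseteq> {g. (\<lambda>x. b x * g x) \<in> W}"
      using assms(3) that by (intro fun_vs.span_minimal) auto
    then show ?thesis using assms(2) by blast
  qed
  have "fun_subspace {f. (\<lambda>x. f x * g x) \<in> W}"
    using W by (intro fun_subspaceI) (auto simp: algebra_simps)
  then have "fun_span B \<subseteq> {f. (\<lambda>x. f x * g x) \<in> W}"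
    using 1 by (intro fun_vs.span_minimal) auto
  then show ?thesis using assms(1) by blast
qed

text \<open>Stated for an abstract grading because it is applied both to \<open>polynomials\<close>
  and to \<open>bernstein\<close>.\<close>

lemma graded_prod:
  assumes one: "(\<lambda>x. 1) \<in> W 0"
    and mult: "\<And>j k f g. f \<in> W j \<Longrightarrow> g \<in> W k \<Longrightarrow> (\<lambda>x. f x * g x :: real) \<in> W (j + k)"
    and f: "\<And>i. i \<in> I \<Longrightarrow> f i \<in> W (1::nat)"
  shows "(\<lambda>x. \<Prod>i\<in>I. f i x ^ \<alpha> i) \<in> W (\<Sum>i\<in>I. \<alpha> i)"
proof -
  have pow: "(\<lambda>x. f i x ^ n) \<in> W n" if "i \<in> I" for i n
    using mult[OF f[OF that]] by (induction n) (auto simp: one)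
  show ?thesis
  proof (cases "finite I")
    case True
    then show ?thesis using pow by (induction I) (auto simp: one intro: mult)
  qed (simp add: one)
qed

section \<open>Linear algebra with a bilinear form on a finite-dimensional function space\<close>

text \<open>Gram-Schmidt along a finite generating set: a new generator is made orthogonal to the
  old span, after which the representing vector needs only one more coefficient. The functional is
  arbitrary in the induction because the orthogonalization itself is an instance of the
  claim.\<close>

lemma finite_dim_riesz:
  fixes ip :: "('a \<Rightarrow> real) \<Rightarrow> ('a \<Rightarrow> real) \<Rightarrow> real"
  assumes V: "fun_subspace V" "V \<subseteq> fun_span B" "finite B"
    and add: "\<And>u v w. u \<in> V \<Longrightarrow> v \<in> V \<Longrightarrow> w \<in> V \<Longrightarrow> ip (\<lambda>x. u x + v x) w = ip u w + ip v w"
    and scale: "\<And>c u w. u \<in> V \<Longrightarrow> w \<in> V \<Longrightarrow> ip (\<lambda>x. c * u x) w = c * ip u w"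
    and sym: "\<And>u v. u \<in> V \<Longrightarrow> v \<in> V \<Longrightarrow> ip u v = ip v u"
    and pos: "\<And>u. u \<in> V \<Longrightarrow> ip u u = 0 \<Longrightarrow> u = (\<lambda>x. 0)"
    and ladd: "\<And>u v. u \<in> V \<Longrightarrow> v \<in> V \<Longrightarrow> l (\<lambda>x. u x + v x) = l u + l v"
    and lscale: "\<And>c u. u \<in> V \<Longrightarrow> l (\<lambda>x. c * u x) = c * l u"
  shows "\<exists>w\<in>V. \<forall>v\<in>V. ip w v = l v"
proof -
  note VD = fun_subspaceD[OF V(1)]
  obtain S where S: "S \<subseteq> V" "fun_vs.independent S" "V \<subseteq> fun_span S"
    using fun_vs.maximal_independent_subset[of V] by blast
  then have fin: "finite S"
    using fun_vs.independent_span_bound[OF V(3) S(2)] V(2) by blast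
  have spanV: "fun_span R \<subseteq> V" if "R \<subseteq> V" for R
    using that V(1) by (rule fun_vs.span_minimal)
  define lin where "lin l \<longleftrightarrow> (\<forall>u\<in>V. \<forall>v\<in>V. l (\<lambda>x. u x + v x) = l u + l v) \<and>
      (\<forall>c. \<forall>u\<in>V. l (\<lambda>x. c * u x) = c * l u)" for l :: "('a \<Rightarrow> real) \<Rightarrow> real"
  have "\<exists>w\<in>fun_span R. \<forall>v\<in>fun_span R. ip w v = l v"
    if "finite R" "R \<subseteq> V" "lin l" for R l
    using that
  proof (induction R arbitrary: l rule: finite_induct)
    case empty
    have "\<forall>c. \<forall>u\<in>V. l (\<lambda>x. c * u x) = c * l u"
      using empty.prems(2) unfolding lin_def by blast
    from this[rule_format, OF VD(1), of 0] have "l (\<lambda>x. 0) = 0" by simp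
    moreover have "ip (\<lambda>x. 0) (\<lambda>x. 0) = 0" using scale[OF VD(1) VD(1), of 0] by simp
    ultimately show ?case by (simp add: zero_fun_def)
  next
    case (insert b R)
    let ?D = "fun_span R"
    have RV: "R \<subseteq> V" and bV: "b \<in> V" using insert.prems(1) by auto
    have ladd: "\<And>u v. u \<in> V \<Longrightarrow> v \<in> V \<Longrightarrow> l (\<lambda>x. u x + v x) = l u + l v"
      and lscale: "\<And>c u. u \<in> V \<Longrightarrow> l (\<lambda>x. c * u x) = c * l u"
      using insert.prems(2) unfolding lin_def by blast+
    note sub = fun_subspaceD[OF fun_subspace_span[of R]]
    note inV = spanV[OF RV, THEN subsetD]
    obtain w where w: "w \<in> ?D" "\<And>v. v \<in> ?D \<Longrightarrow> ip w v = l v"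
      using insert.IH[OF RV insert.prems(2)] by blast
    \<comment> \<open>The same hypothesis, now for the functional \<open>ip b\<close>, yields the
      orthogonal projection of \<open>b\<close> onto the old span.\<close>
    have "\<exists>p\<in>?D. \<forall>v\<in>?D. ip p v = ip b v"
    proof (rule insert.IH[OF RV])
      show "lin (ip b)"
        unfolding lin_def using bV by (simp add: sym[OF bV] VD(2,3) add scale)
    qed
    then obtain p where p: "p \<in> ?D" "\<And>v. v \<in> ?D \<Longrightarrow> ip p v = ip b v" by blast
    define q where "q = (\<lambda>x. b x - p x)"
    have qV: "q \<in> V" unfolding q_def by (rule VD(4)[OF bV inV[OF p(1)]])
    have orth: "ip q v = 0" if "v \<in> ?D" for v
    proof -
      have "ip (\<lambda>x. q x + p x) v = ip q v + ip p v"
        using qV inV p(1) that by (intro add) auto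
      then show ?thesis using p(2)[OF that] by (simp add: q_def)
    qed
    have split: "\<exists>r\<in>?D. \<exists>k. v = (\<lambda>x. r x + k * q x)" if v: "v \<in> fun_span (insert b R)" for v
    proof -
      obtain k where k: "(\<lambda>x. v x - k * b x) \<in> ?D"
        using v unfolding fun_vs.span_insert by (auto simp: fun_diff_def)
      have "(\<lambda>x. (v x - k * b x) + k * p x) \<in> ?D"
        by (rule sub(2)[OF k sub(3)[OF p(1)]])
      moreover have "v = (\<lambda>x. ((v x - k * b x) + k * p x) + k * q x)"
        by (simp add: q_def algebra_simps)
      ultimately show ?thesis
        by (intro bexI[where x = "\<lambda>x. (v x - k * b x) + k * p x"] exI[of _ k])
    qed
    have q_in: "q \<in> fun_span (insert b R)"
      unfolding q_def
    proof (rule fun_subspaceD(4)[OF fun_subspace_span])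
      show "b \<in> fun_span (insert b R)" by (rule fun_vs.span_base) simp
      show "p \<in> fun_span (insert b R)" using p(1) fun_vs.span_mono[of R "insert b R"] by auto
    qed
    define t where "t = l q / ip q q"
    \<comment> \<open>Division by zero is harmless: if \<open>ip q q = 0\<close>, definiteness makes
      \<open>q\<close> the zero function, so \<open>l q = 0\<close> as well.\<close>
    have t: "t * ip q q = l q"
    proof (cases "ip q q = 0")
      case True
      then have "q = (\<lambda>x. 0)" using pos qV by blast
      then have "l q = 0" using lscale[OF VD(1), of 0] by simp
      then show ?thesis using True by simp
    qed (simp add: t_def)
    show ?case
    proof (intro bexI ballI)
      show "(\<lambda>x. w x + t * q x) \<in> fun_span (insert b R)"
      proof (rule fun_subspaceD(2)[OF fun_subspace_span])
        show "w \<in> fun_span (insert b R)" using w(1) fun_vs.span_mono[of R "insert b R"] by auto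
        show "(\<lambda>x. t * q x) \<in> fun_span (insert b R)"
          by (rule fun_subspaceD(3)[OF fun_subspace_span q_in])
      qed
      fix v assume "v \<in> fun_span (insert b R)"
      then obtain r k where v: "v = (\<lambda>x. r x + k * q x)" and r: "r \<in> ?D" using split by blast
      have rV: "r \<in> V" and wV: "w \<in> V" using r w(1) inV by auto
      have vV: "v \<in> V" unfolding v by (rule VD(2)[OF rV VD(3)[OF qV]])
      have "ip v q = ip r q + k * ip q q"
        using qV rV by (simp add: v VD add scale)
      then have "ip q v = ip r q + k * ip q q" using sym[OF qV vV] by simp
      also have "ip r q = 0" using orth[OF r] sym[OF rV qV] by simp
      finally have 1: "ip q v = k * ip q q" by simp
      have "ip v w = ip r w + k * ip q w"
        using qV rV wV by (simp add: v VD add scale)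
      then have "ip w v = ip r w + k * ip q w" using sym[OF wV vV] by simp
      also have "\<dots> = l r" using orth[OF w(1)] w(2)[OF r] sym[OF rV wV] by simp
      finally have 2: "ip w v = l r" .
      have "ip (\<lambda>x. w x + t * q x) v = l r + k * (t * ip q q)"
        using wV qV vV by (simp add: add scale VD 1 2)
      also have "\<dots> = l v"
        using rV qV by (simp add: t v ladd lscale VD)
      finally show "ip (\<lambda>x. w x + t * q x) v = l v" .
    qed
  qed
  then have "\<exists>w\<in>fun_span S. \<forall>v\<in>fun_span S. ip w v = l v"
    using fin S(1) ladd lscale by (simp add: lin_def)
  moreover have "fun_span S = V" using S(3) spanV[OF S(1)] by blast
  ultimately show ?thesis by simp
qed

text \<open>Pairwise orthogonal vectors that are not orthogonal to themselves are independent: if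
  \<open>e m\<close> were a combination of the others, it would lie in the kernel of
  \<open>\<lambda>f. ip f (e m)\<close>. The size of \<open>B\<close> then bounds their number.
  Applied to eigenvectors.\<close>

lemma finite_orthogonal_family:
  fixes ip :: "('a \<Rightarrow> real) \<Rightarrow> ('a \<Rightarrow> real) \<Rightarrow> real"
  assumes V: "fun_subspace V" "V \<subseteq> fun_span B" "finite B"
    and e: "\<And>l. l \<in> E \<Longrightarrow> e l \<in> V" "\<And>l. l \<in> E \<Longrightarrow> ip (e l) (e l) \<noteq> 0"
    and add: "\<And>u v w. u \<in> V \<Longrightarrow> v \<in> V \<Longrightarrow> w \<in> V \<Longrightarrow> ip (\<lambda>x. u x + v x) w = ip u w + ip v w"
    and scale: "\<And>c u w. u \<in> V \<Longrightarrow> w \<in> V \<Longrightarrow> ip (\<lambda>x. c * u x) w = c * ip u w"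
    and orth: "\<And>l m. l \<in> E \<Longrightarrow> m \<in> E \<Longrightarrow> l \<noteq> m \<Longrightarrow> ip (e l) (e m) = 0"
  shows "finite E"
proof -
  note VD = fun_subspaceD[OF V(1)]
  have inj: "inj_on e E"
    using e(2) orth by (metis inj_onI)
  have "fun_vs.independent (e ` E)"
    unfolding fun_vs.dependent_def
  proof
    assume "\<exists>a\<in>e ` E. a \<in> fun_vs.span (e ` E - {a})"
    then obtain m where m: "m \<in> E" "e m \<in> fun_span (e ` E - {e m})" by auto
    let ?Z = "{f \<in> V. ip f (e m) = 0}"
    have "ip (\<lambda>x. 0) (e m) = 0" using scale[OF VD(1) e(1)[OF m(1)], of 0] by simp
    then have "fun_subspace ?Z"
      using VD m(1) e(1) add scale by (intro fun_subspaceI) auto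
    moreover have "e ` E - {e m} \<subseteq> ?Z" using e(1) orth m(1) by auto
    ultimately have "fun_span (e ` E - {e m}) \<subseteq> ?Z" by (intro fun_vs.span_minimal)
    then show False using m e(2) by auto
  qed
  moreover have "e ` E \<subseteq> fun_span B" using e(1) V(2) by auto
  ultimately have "finite (e ` E)" using fun_vs.independent_span_bound V(3) by blast
  then show ?thesis using inj by (simp add: finite_image_iff)
qed

section \<open>Multi-indices and polynomials\<close>

definition exponents :: "'i set \<Rightarrow> nat \<Rightarrow> ('i \<Rightarrow> nat) set" where
  "exponents I k = {\<alpha>. (\<forall>i. i \<notin> I \<longrightarrow> \<alpha> i = 0) \<and> (\<Sum>i\<in>I. \<alpha> i) = k}"

lemma exponents_le:
  assumes "finite I" "\<alpha> \<in> exponents I k" "i \<in> I"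
  shows "\<alpha> i \<le> k"
  using assms member_le_sum[of i I \<alpha>] by (auto simp: exponents_def)

lemma finite_bounded_exponents:
  assumes "finite I"
  shows "finite {\<alpha>. (\<forall>i. i \<notin> I \<longrightarrow> \<alpha> i = 0) \<and> (\<Sum>i\<in>I. \<alpha> i) \<le> (k::nat)}"
proof (rule finite_subset[OF _ finite_set_of_finite_funs[OF assms, of "{..k}" 0]])
  show "{\<alpha>. (\<forall>i. i \<notin> I \<longrightarrow> \<alpha> i = 0) \<and> (\<Sum>i\<in>I. \<alpha> i) \<le> k}
      \<subseteq> {f. \<forall>x. (x \<in> I \<longrightarrow> f x \<in> {..k}) \<and> (x \<notin> I \<longrightarrow> f x = 0)}"
    using member_le_sum[of _ I] assms by (auto intro: order_trans)
qed simp

lemma finite_exponents: "finite I \<Longrightarrow> finite (exponents I k)"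
  by (rule finite_subset[OF _ finite_bounded_exponents[of I k]]) (auto simp: exponents_def)

lemma finite_multi_indices: "finite (multi_indices k)"
  unfolding multi_indices_def by (rule finite_bounded_exponents) simp

lemma polynomials_eq_span:
  "polynomials k = fun_span ((\<lambda>\<alpha> x. \<Prod>b\<in>Basis. (x \<bullet> b) ^ \<alpha> b) ` multi_indices k)"
  unfolding polynomials_def by (rule range_sum_eq_fun_span[OF finite_multi_indices])

lemma subspace_polynomials: "fun_subspace (polynomials k)"
  unfolding polynomials_eq_span by (rule fun_subspace_span)

lemma polynomials_mono: "j \<le> k \<Longrightarrow> polynomials j \<subseteq> polynomials k"
  unfolding polynomials_eq_span by (intro fun_vs.span_mono image_mono) (auto simp: multi_indices_def)

lemma polynomials_mult:
  assumes "f \<in> polynomials j" "g \<in> polynomials k"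
  shows "(\<lambda>x. f x * g x) \<in> polynomials (j + k)"
proof (rule fun_span_mult[OF assms[unfolded polynomials_eq_span] _ subspace_polynomials])
  fix f g :: "'a \<Rightarrow> real"
  assume "f \<in> (\<lambda>\<alpha> x. \<Prod>b\<in>Basis. (x \<bullet> b) ^ \<alpha> b) ` multi_indices j"
    and "g \<in> (\<lambda>\<alpha> x. \<Prod>b\<in>Basis. (x \<bullet> b) ^ \<alpha> b) ` multi_indices k"
  then obtain \<alpha> \<beta> :: "'a \<Rightarrow> nat" where "\<alpha> \<in> multi_indices j" "\<beta> \<in> multi_indices k"
    and "f = (\<lambda>x. \<Prod>b\<in>Basis. (x \<bullet> b) ^ \<alpha> b)" "g = (\<lambda>x. \<Prod>b\<in>Basis. (x \<bullet> b) ^ \<beta> b)" by blast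
  then show "(\<lambda>x. f x * g x) \<in> polynomials (j + k)"
    unfolding polynomials_eq_span
    by (intro fun_vs.span_base image_eqI[of _ _ "\<lambda>b. \<alpha> b + \<beta> b"])
      (auto simp: power_add prod.distrib multi_indices_def sum.distrib)
qed

lemma const_polynomials: "(\<lambda>x. c) \<in> polynomials k"
proof -
  have "(\<lambda>x. 1) \<in> polynomials k"
    unfolding polynomials_eq_span
    by (intro fun_vs.span_base image_eqI[of _ _ "\<lambda>_. 0"]) (auto simp: multi_indices_def)
  from fun_subspaceD(3)[OF subspace_polynomials this, of c] show ?thesis by simp
qed

lemma affine_polynomials: "(\<lambda>x. a \<bullet> x + c) \<in> polynomials 1"
proof -
  have b: "(\<lambda>x. x \<bullet> b) \<in> polynomials 1" if "b \<in> Basis" for b :: 'a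
    unfolding polynomials_eq_span using that
    by (intro fun_vs.span_base image_eqI[of _ _ "\<lambda>i. if i = b then 1 else 0"])
      (auto simp: multi_indices_def if_distrib[of "\<lambda>t. _ ^ t"] cong: if_cong)
  have "(\<lambda>x. (\<Sum>b\<in>Basis. (a \<bullet> b) * (x \<bullet> b)) + c) \<in> polynomials 1"
    by (intro fun_subspaceD(2,3)[OF subspace_polynomials] fun_subspace_sum[OF subspace_polynomials]
        const_polynomials b)
  then show ?thesis by (subst euclidean_inner)
qed

lemma continuous_on_polynomials:
  assumes "p \<in> polynomials k"
  shows "continuous_on S p"
proof -
  from assms obtain c where "p = (\<lambda>x. \<Sum>\<alpha>\<in>multi_indices k. c \<alpha> * (\<Prod>b\<in>Basis. (x \<bullet> b) ^ \<alpha> b))"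
    unfolding polynomials_def by blast
  then show ?thesis by (auto intro!: continuous_intros)
qed

section \<open>Barycentric coordinates\<close>

text \<open>An affine function on the whole space, not just the weights of points of the hull, so
  that it is a polynomial of degree one and can be evaluated at translates that leave the simplex.
  The choice is made meaningful by \<open>bary_exists\<close>.\<close>

definition bary :: "'a::euclidean_space set \<Rightarrow> 'a \<Rightarrow> 'a \<Rightarrow> real" where
  "bary C v = (SOME l. (\<exists>a b. l = (\<lambda>x. a \<bullet> x + b)) \<and> (\<forall>w\<in>C. l w = (if w = v then 1 else 0)))"

locale affine_basis =
  fixes C :: "'a::euclidean_space set"
  assumes indep: "\<not> affine_dependent C" and card_C: "card C = DIM('a) + 1"
begin

lemma finite_C: "finite C" and C_nonempty: "C \<noteq> {}"
  using card_C by (auto intro: card_ge_0_finite)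

text \<open>The vertices other than \<open>v\<close> span a hyperplane
  \<open>a \<bullet> x = b\<close> that misses \<open>v\<close>; rescaling
  \<open>a \<bullet> x - b\<close> to be 1 at \<open>v\<close> gives the coordinate.\<close>

lemma bary_exists:
  assumes "v \<in> C"
  shows "\<exists>l. (\<exists>a b. l = (\<lambda>x. a \<bullet> x + b)) \<and> (\<forall>w\<in>C. l w = (if w = v then (1::real) else 0))"
proof -
  have "\<not> affine_dependent (C - {v})" using indep affine_independent_Diff by blast
  then have "aff_dim (C - {v}) = DIM('a) - 1"
    using card_C assms aff_dim_affine_independent[of "C - {v}"] finite_C by simp
  then obtain a b where ab: "a \<noteq> 0" "affine hull (C - {v}) = {x. a \<bullet> x = b}"
    unfolding aff_dim_eq_hyperplane by blast
  have "v \<notin> affine hull (C - {v})"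
    using indep assms unfolding affine_dependent_def by blast
  then have n: "a \<bullet> v - b \<noteq> 0" using ab by simp
  have z: "a \<bullet> w = b" if "w \<in> C" "w \<noteq> v" for w
    using hull_inc[of w "C - {v}" affine] that ab by auto
  let ?l = "\<lambda>x. (a /\<^sub>R (a \<bullet> v - b)) \<bullet> x + (- b / (a \<bullet> v - b))"
  have "?l x = (a \<bullet> x - b) / (a \<bullet> v - b)" for x
    by (simp add: divide_inverse algebra_simps)
  then have "\<forall>w\<in>C. ?l w = (if w = v then 1 else 0)"
    using n z by simp
  then show ?thesis by (intro exI[of _ ?l]) blast
qed

lemma
  assumes "v \<in> C"
  shows bary_affine: "\<exists>a b. bary C v = (\<lambda>x. a \<bullet> x + b)"
    and bary_vertex: "w \<in> C \<Longrightarrow> bary C v w = (if w = v then 1 else 0)"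
  using someI_ex[OF bary_exists[OF assms]] unfolding bary_def[symmetric] by blast+

lemma bary_combination:
  assumes v: "v \<in> C" and "finite A" "sum u A = 1"
  shows "bary C v (\<Sum>w\<in>A. u w *\<^sub>R f w) = (\<Sum>w\<in>A. u w * bary C v (f w))"
proof -
  obtain a b where ab: "bary C v = (\<lambda>x. a \<bullet> x + b)" using bary_affine[OF v] by blast
  have "(\<Sum>w\<in>A. u w * bary C v (f w)) = (\<Sum>w\<in>A. u w * (a \<bullet> f w)) + sum u A * b"
    by (simp add: ab algebra_simps sum.distrib sum_distrib_left)
  then show ?thesis using assms by (simp add: ab inner_sum_right)
qed

lemma bary_segment:
  assumes "v \<in> C"
  shows "bary C v (x + t *\<^sub>R (y - x)) = (1 - t) * bary C v x + t * bary C v y"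
proof -
  obtain a b where "bary C v = (\<lambda>x. a \<bullet> x + b)" using bary_affine[OF assms] by blast
  then show ?thesis by (simp add: algebra_simps)
qed

lemma bary_unique:
  assumes "sum u C = 1" "v \<in> C"
  shows "bary C v (\<Sum>w\<in>C. u w *\<^sub>R w) = u v"
  using bary_combination[OF assms(2) finite_C assms(1), of "\<lambda>w. w"] assms(2)
  by (simp add: bary_vertex finite_C if_distrib[of "\<lambda>t. _ * t"] cong: if_cong)

text \<open>As many affinely independent points as the dimension allows span the whole space, so
  both identities hold off the simplex as well.\<close>

lemma
  shows sum_bary: "(\<Sum>v\<in>C. bary C v x) = 1"
    and bary_decomp: "(\<Sum>v\<in>C. bary C v x *\<^sub>R v) = x"
proof -
  have "x \<in> affine hull C" using affine_independent_span_eq[OF indep] card_C by simp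
  then obtain u where u: "sum u C = 1" "(\<Sum>v\<in>C. u v *\<^sub>R v) = x"
    unfolding affine_hull_finite[OF finite_C] by auto
  then have "bary C v x = u v" if "v \<in> C" for v using bary_unique[OF u(1) that] by simp
  then show "(\<Sum>v\<in>C. bary C v x) = 1" "(\<Sum>v\<in>C. bary C v x *\<^sub>R v) = x" using u by auto
qed

lemma bary_polynomials: "v \<in> C \<Longrightarrow> bary C v \<in> polynomials 1"
  using bary_affine affine_polynomials by metis

lemma continuous_on_bary: "v \<in> C \<Longrightarrow> continuous_on S (bary C v)"
  using bary_polynomials continuous_on_polynomials by blast

lemma convex_hull_bary: "convex hull C = {x. \<forall>v\<in>C. 0 \<le> bary C v x}"
proof (intro equalityI subsetI)
  fix x assume "x \<in> convex hull C"
  then obtain u where "\<forall>v\<in>C. 0 \<le> u v" "sum u C = 1" "(\<Sum>v\<in>C. u v *\<^sub>R v) = x"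
    unfolding convex_hull_finite[OF finite_C] by auto
  then show "x \<in> {x. \<forall>v\<in>C. 0 \<le> bary C v x}" using bary_unique[of u] by auto
next
  fix x assume "x \<in> {x. \<forall>v\<in>C. 0 \<le> bary C v x}"
  then show "x \<in> convex hull C"
    unfolding convex_hull_finite[OF finite_C]
    by (intro CollectI exI[of _ "\<lambda>v. bary C v x"]) (simp add: sum_bary bary_decomp)
qed

lemma interior_convex_hull_bary: "interior (convex hull C) = {x. \<forall>v\<in>C. 0 < bary C v x}"
proof (intro equalityI subsetI)
  note int = interior_convex_hull_explicit_minimal[OF indep, unfolded card_C, simplified]
  fix x assume "x \<in> interior (convex hull C)"
  then obtain u where "\<forall>v\<in>C. 0 < u v" "sum u C = 1" "(\<Sum>v\<in>C. u v *\<^sub>R v) = x"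
    unfolding int by auto
  then show "x \<in> {x. \<forall>v\<in>C. 0 < bary C v x}" using bary_unique[of u] by auto
next
  note int = interior_convex_hull_explicit_minimal[OF indep, unfolded card_C, simplified]
  fix x assume "x \<in> {x. \<forall>v\<in>C. 0 < bary C v x}"
  then show "x \<in> interior (convex hull C)"
    unfolding int
    by (intro CollectI exI[of _ "\<lambda>v. bary C v x"]) (simp add: sum_bary bary_decomp)
qed

lemma bary_le_1:
  assumes "x \<in> convex hull C" "v \<in> C"
  shows "bary C v x \<le> 1"
  using assms sum_bary[of x] member_le_sum[of v C "\<lambda>v. bary C v x"] finite_C
  by (auto simp: convex_hull_bary)

text \<open>Homogeneous forms in the barycentric coordinates. Since these sum to 1, homogeneity
  costs nothing: every polynomial of degree at most \<open>k\<close> is such a form, see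
  \<open>polynomials_bernstein\<close>.\<close>

definition bernstein :: "nat \<Rightarrow> ('a \<Rightarrow> real) set" where
  "bernstein k = fun_span ((\<lambda>\<beta> x. \<Prod>v\<in>C. bary C v x ^ \<beta> v) ` exponents C k)"

lemma subspace_bernstein: "fun_subspace (bernstein k)"
  unfolding bernstein_def by (rule fun_subspace_span)

lemma bernstein_mult:
  assumes "f \<in> bernstein j" "g \<in> bernstein k"
  shows "(\<lambda>x. f x * g x) \<in> bernstein (j + k)"
proof (rule fun_span_mult[OF assms[unfolded bernstein_def] _ subspace_bernstein])
  fix f g :: "'a \<Rightarrow> real"
  assume "f \<in> (\<lambda>\<beta> x. \<Prod>v\<in>C. bary C v x ^ \<beta> v) ` exponents C j"
    and "g \<in> (\<lambda>\<beta> x. \<Prod>v\<in>C. bary C v x ^ \<beta> v) ` exponents C k"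
  then obtain \<alpha> \<beta> :: "'a \<Rightarrow> nat" where "\<alpha> \<in> exponents C j" "\<beta> \<in> exponents C k"
    and "f = (\<lambda>x. \<Prod>v\<in>C. bary C v x ^ \<alpha> v)" "g = (\<lambda>x. \<Prod>v\<in>C. bary C v x ^ \<beta> v)" by blast
  then show "(\<lambda>x. f x * g x) \<in> bernstein (j + k)"
    unfolding bernstein_def
    by (intro fun_vs.span_base image_eqI[of _ _ "\<lambda>b. \<alpha> b + \<beta> b"])
      (auto simp: power_add prod.distrib exponents_def sum.distrib)
qed

lemma bary_bernstein: "v \<in> C \<Longrightarrow> bary C v \<in> bernstein 1"
  unfolding bernstein_def
  by (intro fun_vs.span_base image_eqI[of _ _ "\<lambda>i. if i = v then 1 else 0"])
    (auto simp: exponents_def finite_C if_distrib[of "\<lambda>t. _ ^ t"] cong: if_cong)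

text \<open>Degree raising: multiplying by \<open>\<Sum>v\<in>C. bary C v x = 1\<close> adds one to
  the degree of a form and leaves the function unchanged.\<close>

lemma one_bernstein: "(\<lambda>x. 1) \<in> bernstein k"
proof (induction k)
  case 0
  show ?case unfolding bernstein_def
    by (intro fun_vs.span_base image_eqI[of _ _ "\<lambda>_. 0"]) (auto simp: exponents_def)
next
  case (Suc k)
  have "(\<lambda>x. \<Sum>v\<in>C. bary C v x) \<in> bernstein 1"
    by (intro fun_subspace_sum[OF subspace_bernstein] bary_bernstein)
  then show ?case using bernstein_mult[OF _ Suc, of _ 1] by (fastforce simp: sum_bary)
qed

lemma coordinate_bernstein: "(\<lambda>x. x \<bullet> b) \<in> bernstein 1"
proof -
  have "(\<lambda>x. \<Sum>v\<in>C. (v \<bullet> b) * bary C v x) \<in> bernstein 1"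
    by (intro fun_subspace_sum[OF subspace_bernstein] fun_subspaceD(3)[OF subspace_bernstein]
        bary_bernstein)
  moreover have "(\<Sum>v\<in>C. (v \<bullet> b) * bary C v x) = x \<bullet> b" for x
    by (subst (2) bary_decomp[of x, symmetric]) (simp add: inner_sum_left mult.commute)
  ultimately show ?thesis by simp
qed

lemma polynomials_bernstein: "polynomials k \<subseteq> bernstein k"
  unfolding polynomials_eq_span
proof (rule fun_vs.span_minimal[OF _ subspace_bernstein], rule image_subsetI)
  fix \<alpha> :: "'a \<Rightarrow> nat" assume \<alpha>: "\<alpha> \<in> multi_indices k"
  have "(\<lambda>x. \<Prod>b\<in>Basis. (x \<bullet> b) ^ \<alpha> b) \<in> bernstein (sum \<alpha> Basis)"
    by (rule graded_prod[of bernstein, OF one_bernstein bernstein_mult])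
      (auto intro: coordinate_bernstein[simplified])
  \<comment> \<open>The missing degree is supplied by the constant 1, viewed as a form of degree
    \<open>k - sum \<alpha> Basis\<close>.\<close>
  then show "(\<lambda>x. \<Prod>b\<in>Basis. (x \<bullet> b) ^ \<alpha> b) \<in> bernstein k"
    using bernstein_mult[OF _ one_bernstein[of "k - sum \<alpha> Basis"]] \<alpha>
    by (fastforce simp: multi_indices_def)
qed

lemma polynomial_bernstein_coeffs:
  assumes "p \<in> polynomials k"
  obtains c where "p = (\<lambda>x. \<Sum>\<beta>\<in>exponents C k. c \<beta> * (\<Prod>v\<in>C. bary C v x ^ \<beta> v))"
  using assms polynomials_bernstein[of k]
    range_sum_eq_fun_span[OF finite_exponents[OF finite_C, of k], of "\<lambda>\<beta> x. \<Prod>v\<in>C. bary C v x ^ \<beta> v"]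
  unfolding bernstein_def by blast

lemma bary_monomial_polynomials: "(\<lambda>x. \<Prod>v\<in>C. bary C v x ^ \<beta> v) \<in> polynomials (sum \<beta> C)"
  by (rule graded_prod[of polynomials, OF const_polynomials polynomials_mult])
    (auto intro: bary_polynomials[simplified])

end

section \<open>Integrals of monomials over a simplex\<close>

context affine_basis
begin

lemma bary_translate:
  assumes "v \<in> C" "i \<in> C" "j \<in> C"
  shows "bary C v (x + s *\<^sub>R (i - j)) = bary C v x + s * (of_bool (v = i) - of_bool (v = j))"
proof -
  obtain a b where ab: "bary C v = (\<lambda>x. a \<bullet> x + b)" using bary_affine[OF assms(1)] by blast
  have "bary C v (x + s *\<^sub>R (i - j)) = bary C v x + s * (bary C v i - bary C v j)"
    by (simp add: ab algebra_simps)
  then show ?thesis using assms by (auto simp: bary_vertex)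
qed

definition bary_monomial :: "('a \<Rightarrow> nat) \<Rightarrow> 'a \<Rightarrow> real" where
  "bary_monomial \<beta> x = (\<Prod>v\<in>C. bary C v x ^ \<beta> v)"

definition simplex_moment :: "('a \<Rightarrow> nat) \<Rightarrow> real" where
  "simplex_moment \<beta> = (\<integral>x. indicator (convex hull C) x * bary_monomial \<beta> x \<partial>lborel)"

lemma bary_monomial_mult: "bary_monomial \<beta> x * bary_monomial \<gamma> x = bary_monomial (\<lambda>v. \<beta> v + \<gamma> v) x"
  by (simp add: bary_monomial_def power_add prod.distrib)

lemma bary_monomial_Suc:
  assumes "i \<in> C"
  shows "bary_monomial (\<beta>(i := Suc (\<beta> i))) x = bary C i x * bary_monomial \<beta> x"
  using assms by (simp add: bary_monomial_def prod.remove[OF finite_C assms])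

lemma continuous_on_bary_monomial: "continuous_on S (bary_monomial \<beta>)"
  unfolding bary_monomial_def by (intro continuous_intros continuous_on_bary)

lemma compact_hull: "compact (convex hull C)"
  using finite_C by (simp add: compact_convex_hull finite_imp_compact)

lemma integrable_hull:
  assumes "continuous_on UNIV f"
  shows "integrable lborel (\<lambda>x. indicator (convex hull C) x * f x :: real)"
  using borel_integrable_compact[OF compact_hull, of f] continuous_on_subset[OF assms]
  by (simp add: indicator_def if_distrib[of "\<lambda>t. t * _"] cong: if_cong)

text \<open>Multiply the integrand by the sum of the barycentric coordinates, which is 1.\<close>

lemma sum_simplex_moment: "(\<Sum>i\<in>C. simplex_moment (\<beta>(i := Suc (\<beta> i)))) = simplex_moment \<beta>"
proof -
  have "(\<Sum>i\<in>C. simplex_moment (\<beta>(i := Suc (\<beta> i)))) =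
      (\<integral>x. (\<Sum>i\<in>C. indicator (convex hull C) x * bary_monomial (\<beta>(i := Suc (\<beta> i))) x) \<partial>lborel)"
    unfolding simplex_moment_def
    by (rule Bochner_Integration.integral_sum[symmetric])
      (intro integrable_hull continuous_on_bary_monomial)
  also have "(\<lambda>x. \<Sum>i\<in>C. indicator (convex hull C) x * bary_monomial (\<beta>(i := Suc (\<beta> i))) x) =
      (\<lambda>x. indicator (convex hull C) x * bary_monomial \<beta> x)"
    by (simp add: fun_eq_iff bary_monomial_Suc sum_bary flip: sum_distrib_left sum_distrib_right)
  finally show ?thesis by (simp add: simplex_moment_def fun_upd_def)
qed

text \<open>The moments of \<open>\<beta> + e\<^sub>i\<close> and \<open>\<beta> + e\<^sub>j\<close> are compared by differentiating the monomial
  \<open>\<beta> + e\<^sub>i + e\<^sub>j\<close>, extended by zero, in the direction \<open>i - j\<close>: by translation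
  invariance the derivative integrates to zero.\<close>

lemma simplex_moment_exchange:
  assumes ij: "i \<in> C" "j \<in> C" "i \<noteq> j"
  shows "real (Suc (\<beta> i)) * simplex_moment (\<beta>(j := Suc (\<beta> j))) =
    real (Suc (\<beta> j)) * simplex_moment (\<beta>(i := Suc (\<beta> i)))"
proof -
  let ?T = "convex hull C"
  define m n where "m = \<beta> i" and "n = \<beta> j"
  define q where "q x = (\<Prod>v\<in>C - {i, j}. bary C v x ^ \<beta> v)" for x
  have C_eq: "C = insert i (insert j (C - {i, j}))" using ij by blast
  have mono: "bary_monomial (\<beta>(i := k, j := l)) x = bary C i x ^ k * bary C j x ^ l * q x" for k l x
  proof -
    have "bary_monomial (\<beta>(i := k, j := l)) x =
        bary C i x ^ k * (bary C j x ^ l * (\<Prod>v\<in>C - {i, j}. bary C v x ^ (\<beta>(i := k, j := l)) v))"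
      unfolding bary_monomial_def using ij finite_C by (subst C_eq) simp
    also have "(\<Prod>v\<in>C - {i, j}. bary C v x ^ (\<beta>(i := k, j := l)) v) = q x"
      unfolding q_def by (intro prod.cong) auto
    finally show ?thesis by (simp add: mult.assoc fun_upd_def)
  qed
  define h where "h = bary_monomial (\<beta>(i := Suc m, j := Suc n))"
  \<comment> \<open>The derivative of \<open>h\<close> in the direction \<open>i - j\<close>, along
    which the coordinate of \<open>i\<close> grows and that of \<open>j\<close> decreases at unit
    speed while all others stay fixed.\<close>
  define D where "D x = (real (Suc m) * bary C i x ^ m * bary C j x ^ Suc n -
      real (Suc n) * bary C i x ^ Suc m * bary C j x ^ n) * q x" for x
  define H where "H x = indicator ?T x * h x" for x
  define w where "w = i - j"
  define s where "s k = inverse (real (Suc k))" for k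
  have s: "0 < s k" "s k \<le> 1" for k by (auto simp: s_def field_simps)
  have s0: "s \<longlonglongrightarrow> 0" unfolding s_def by (rule LIMSEQ_inverse_real_of_nat)
  have intH: "integrable lborel H"
    unfolding H_def h_def by (intro integrable_hull continuous_on_bary_monomial)
  then have [measurable]: "H \<in> borel_measurable borel" by (simp add: integrable_iff_bounded)
  have bi: "bary C i (x + t *\<^sub>R w) = bary C i x + t" for x t
    using ij by (simp add: w_def bary_translate)
  have bj: "bary C j (x + t *\<^sub>R w) = bary C j x - t" for x t
    using ij by (simp add: w_def bary_translate)
  have bk: "bary C v (x + t *\<^sub>R w) = bary C v x" if "v \<in> C - {i, j}" for v x t
    using ij that by (simp add: w_def bary_translate)
  have qw: "q (x + t *\<^sub>R w) = q x" for x t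
    unfolding q_def using bk by (intro prod.cong) auto
  have hw: "h (x + t *\<^sub>R w) = (bary C i x + t) ^ Suc m * (bary C j x - t) ^ Suc n * q x" for x t
    by (simp add: h_def mono bi bj qw)
  have h_eq: "h x = bary C i x ^ Suc m * bary C j x ^ Suc n * q x" for x
    using hw[of x 0] by simp
  \<comment> \<open>Clamping the two moving coordinates to [0, 1] gives a function that is Lipschitz
    everywhere and, up to the constant factor \<open>q x\<close>, agrees with \<open>H\<close> along
    a line that meets the simplex. The exponents \<open>Suc m\<close> and \<open>Suc n\<close> are
    positive, so it vanishes where the line has left the simplex.\<close>
  define cl :: "real \<Rightarrow> real" where "cl t = max 0 (min 1 t)" for t
  have cl: "\<bar>cl t\<bar> \<le> 1" "\<bar>cl t - cl u\<bar> \<le> \<bar>t - u\<bar>" for t u by (auto simp: cl_def)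
  define G where "G a b = cl a ^ Suc m * cl b ^ Suc n" for a b
  have Glip: "\<bar>G (a + t) (b - t) - G a b\<bar> \<le> real (Suc m + Suc n) * t" if "0 \<le> t" for a b t
  proof -
    have pw: "\<bar>cl x ^ k - cl y ^ k\<bar> \<le> real k * \<bar>x - y\<bar>" for x y k
      using norm_power_diff[of "cl x" "cl y" k] cl(1)[of x] cl(1)[of y]
        mult_left_mono[OF cl(2)[of x y], of "real k"] by simp
    have bd: "\<bar>cl x ^ k\<bar> \<le> 1" for x k using cl(1)[of x] by (simp add: power_abs power_le_one)
    have "G (a + t) (b - t) - G a b = (cl (a + t) ^ Suc m - cl a ^ Suc m) * cl (b - t) ^ Suc n +
        cl a ^ Suc m * (cl (b - t) ^ Suc n - cl b ^ Suc n)"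
      by (simp add: G_def algebra_simps)
    also have "\<bar>\<dots>\<bar> \<le> \<bar>cl (a + t) ^ Suc m - cl a ^ Suc m\<bar> * \<bar>cl (b - t) ^ Suc n\<bar> +
        \<bar>cl a ^ Suc m\<bar> * \<bar>cl (b - t) ^ Suc n - cl b ^ Suc n\<bar>"
      by (rule order_trans[OF abs_triangle_ineq]) (simp only: abs_mult order_refl)
    also have "\<dots> \<le> (real (Suc m) * t) * 1 + 1 * (real (Suc n) * t)"
      using pw[of "a + t" "Suc m" a] pw[of "b - t" "Suc n" b] that
      by (intro add_mono mult_mono bd) auto
    finally show ?thesis by (simp add: algebra_simps)
  qed
  have Hlip: "\<bar>H (x + t *\<^sub>R w) - H x\<bar> \<le> real (Suc m + Suc n) * t" if t: "0 \<le> t" for x t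
  proof (cases "x \<in> ?T \<or> x + t *\<^sub>R w \<in> ?T")
    case False
    then show ?thesis using t by (simp add: H_def)
  next
    case True
    then have pos: "0 \<le> bary C v x" "bary C v x \<le> 1" if "v \<in> C - {i, j}" for v
      using bk[OF that, of x t] that bary_le_1[of x v] bary_le_1[of "x + t *\<^sub>R w" v]
      by (auto simp: convex_hull_bary)
    have "0 \<le> bary C v x ^ \<beta> v \<and> bary C v x ^ \<beta> v \<le> 1" if "v \<in> C - {i, j}" for v
      using pos[OF that] by (simp add: power_le_one)
    then have q01: "0 \<le> q x" "q x \<le> 1"
      unfolding q_def by (auto intro!: prod_nonneg prod_le_1 simp del: Diff_iff)
    have HG: "H (x + u *\<^sub>R w) = G (bary C i x + u) (bary C j x - u) * q x" for u
    proof (cases "x + u *\<^sub>R w \<in> ?T")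
      case True
      then have "0 \<le> bary C i x + u" "bary C i x + u \<le> 1" "0 \<le> bary C j x - u" "bary C j x - u \<le> 1"
        using ij bary_le_1[OF True, of i] bary_le_1[OF True, of j]
        by (auto simp: convex_hull_bary bi bj)
      then show ?thesis using True by (simp add: H_def hw G_def cl_def)
    next
      case False
      then obtain v where v: "v \<in> C" "bary C v (x + u *\<^sub>R w) < 0"
        by (auto simp: convex_hull_bary not_le)
      then have "v = i \<or> v = j" using pos(1)[of v] bk[of v x u] by force
      then have "bary C i x + u < 0 \<or> bary C j x - u < 0" using v by (auto simp: bi bj)
      then show ?thesis using False by (auto simp: H_def G_def cl_def)
    qed
    have "\<bar>H (x + t *\<^sub>R w) - H x\<bar> = \<bar>G (bary C i x + t) (bary C j x - t) - G (bary C i x) (bary C j x)\<bar> * q x"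
      using HG[of t] HG[of 0] q01 by (simp add: abs_mult flip: left_diff_distrib)
    also have "\<dots> \<le> (real (Suc m + Suc n) * t) * 1"
      using q01 t by (intro mult_mono Glip) auto
    finally show ?thesis by simp
  qed
  obtain R where R: "?T \<subseteq> cball 0 R"
    using compact_imp_bounded[OF compact_hull] unfolding bounded_iff by (auto simp: subset_iff)
  \<comment> \<open>All steps satisfy \<open>s k \<le> 1\<close>, so outside the ball enlarged by
    \<open>norm w\<close> neither \<open>x\<close> nor its translate lies in the simplex, and the
    difference quotient is 0.\<close>
  let ?B = "cball 0 (R + norm w) :: 'a set"
  define f where "f k x = (H (x + s k *\<^sub>R w) - H x) / s k" for k x
  have int_shift: "integral\<^sup>L lborel (\<lambda>x. H (x + c)) = integral\<^sup>L lborel H"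
    and itb_shift: "integrable lborel (\<lambda>x. H (x + c))" for c
  proof -
    have "integral\<^sup>L lborel H = integral\<^sup>L (distr lborel borel ((+) c)) H"
      by (simp add: lborel_distr_plus)
    also have "\<dots> = integral\<^sup>L lborel (\<lambda>x. H (x + c))"
      by (subst integral_distr) (auto simp: add.commute)
    finally show "integral\<^sup>L lborel (\<lambda>x. H (x + c)) = integral\<^sup>L lborel H" by simp
    have "integrable (distr lborel borel ((+) c)) H" using intH by (simp add: lborel_distr_plus)
    then show "integrable lborel (\<lambda>x. H (x + c))"
      by (subst (asm) integrable_distr_eq) (auto simp: add.commute)
  qed
  have f_int: "integral\<^sup>L lborel (f k) = 0" for k
    unfolding f_def using int_shift itb_shift intH by simp
  have f_bound: "norm (f k x) \<le> real (Suc m + Suc n) * indicator ?B x" for k x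
  proof (cases "x \<in> ?B")
    case True
    then show ?thesis using Hlip[of "s k" x] s[of k] by (simp add: f_def divide_simps mult.commute)
  next
    case False
    have "norm x \<le> norm (x + s k *\<^sub>R w) + norm (s k *\<^sub>R w)"
      using norm_triangle_ineq4[of "x + s k *\<^sub>R w" "s k *\<^sub>R w"] by simp
    also have "norm (s k *\<^sub>R w) \<le> norm w" using s[of k] by (simp add: mult_left_le_one_le)
    finally have "norm (x + s k *\<^sub>R w) > R" using False by auto
    moreover have "\<not> norm x \<le> R + norm w" using False by simp
    then have "norm x > R" using norm_ge_zero[of w] by linarith
    ultimately have "x \<notin> ?T" "x + s k *\<^sub>R w \<notin> ?T" using R by (force simp: subset_iff)+
    then show ?thesis using False by (simp add: f_def H_def)
  qed
  \<comment> \<open>Near an interior point \<open>H\<close> is the smooth function \<open>h\<close>,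
    near an exterior point it is 0. The excluded frontier of a convex set is null.\<close>
  have lim: "(\<lambda>k. f k x) \<longlonglongrightarrow> indicator ?T x * D x" if x: "x \<notin> frontier ?T" for x
  proof -
    have shift: "(\<lambda>k. x + s k *\<^sub>R w) \<longlonglongrightarrow> x"
      using tendsto_add[OF tendsto_const tendsto_scaleR[OF s0 tendsto_const], of x w] by simp
    consider "x \<in> interior ?T" | "x \<in> - ?T"
      using x closure_subset[of ?T] by (auto simp: frontier_def)
    then show ?thesis
    proof cases
      case 1
      then have xT: "x \<in> ?T" using interior_subset by blast
      have "\<forall>\<^sub>F k in sequentially. x + s k *\<^sub>R w \<in> interior ?T"
        using topological_tendstoD[OF shift open_interior 1] .
      then have ev: "\<forall>\<^sub>F k in sequentially. f k x = (h (x + s k *\<^sub>R w) - h (x + 0 *\<^sub>R w)) / s k"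
        by eventually_elim (use xT interior_subset in \<open>force simp: f_def H_def\<close>)
      have "((\<lambda>t. h (x + t *\<^sub>R w)) has_real_derivative D x) (at 0)"
        unfolding hw D_def
        by (rule derivative_eq_intros refl | simp add: algebra_simps)+
      then have "((\<lambda>t. (h (x + t *\<^sub>R w) - h (x + 0 *\<^sub>R w)) / t) \<longlongrightarrow> D x) (at 0)"
        by (simp add: has_field_derivative_iff)
      moreover have "filterlim s (at 0) sequentially"
        using s0 s by (auto simp: filterlim_at intro!: always_eventually less_imp_neq[symmetric])
      ultimately have "(\<lambda>k. (h (x + s k *\<^sub>R w) - h (x + 0 *\<^sub>R w)) / s k) \<longlonglongrightarrow> D x"
        by (rule filterlim_compose)
      then show ?thesis using tendsto_cong[OF ev] xT by simp
    next
      case 2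
      have "open (- ?T)" using compact_hull compact_imp_closed by blast
      from topological_tendstoD[OF shift this 2]
      have "\<forall>\<^sub>F k in sequentially. f k x = 0"
        by eventually_elim (use 2 in \<open>auto simp: f_def H_def\<close>)
      then show ?thesis using 2 by (simp add: tendsto_eventually)
    qed
  qed
  have cont: "continuous_on UNIV D"
    unfolding D_def q_def using ij by (intro continuous_intros continuous_on_bary) auto
  have null: "AE x in lborel. x \<notin> frontier ?T"
  proof -
    have "frontier ?T \<in> null_sets lebesgue"
      using negligible_convex_frontier[OF convex_convex_hull] negligible_iff_null_sets by blast
    then have "AE x in lebesgue. x \<notin> frontier ?T" by (rule AE_not_in)
    then show ?thesis by (simp add: AE_completion_iff)
  qed
  have "(\<lambda>k. integral\<^sup>L lborel (f k)) \<longlonglongrightarrow> (\<integral>x. indicator ?T x * D x \<partial>lborel)"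
  proof (rule integral_dominated_convergence[where w = "\<lambda>x. real (Suc m + Suc n) * indicator ?B x"])
    show "(\<lambda>x. indicator ?T x * D x) \<in> borel_measurable lborel"
      using integrable_hull[OF cont] by (simp add: integrable_iff_bounded)
    show "f k \<in> borel_measurable lborel" for k unfolding f_def by measurable
    show "integrable lborel (\<lambda>x. real (Suc m + Suc n) * indicator ?B x)"
      by (intro integrable_mult_right) (use emeasure_compact_finite[OF compact_cball] in
          \<open>auto simp: top.not_eq_extremum intro!: integrable_real_indicator\<close>)
    show "AE x in lborel. (\<lambda>k. f k x) \<longlonglongrightarrow> indicator ?T x * D x"
      using null by eventually_elim (rule lim)
    show "AE x in lborel. norm (f k x) \<le> real (Suc m + Suc n) * indicator ?B x" for k
      using f_bound by simp
  qed
  then have "(\<integral>x. indicator ?T x * D x \<partial>lborel) = 0"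
    unfolding f_int by (simp add: LIMSEQ_const_iff)
  moreover have "indicator ?T x * D x =
      real (Suc m) * (indicator ?T x * bary_monomial (\<beta>(j := Suc n)) x) -
      real (Suc n) * (indicator ?T x * bary_monomial (\<beta>(i := Suc m)) x)" for x
    using mono[of m "Suc n" x] mono[of "Suc m" n x] ij
    by (simp add: D_def m_def n_def algebra_simps fun_upd_twist)
  ultimately show ?thesis
    unfolding simplex_moment_def m_def n_def
    by (simp add: Bochner_Integration.integral_diff integrable_hull continuous_on_bary_monomial)
qed

text \<open>Summing the exchange identity over \<open>j\<close> collapses one side by
  \<open>sum_simplex_moment\<close>; on the other the factors \<open>Suc (\<beta> j)\<close> add up
  to \<open>sum \<beta> C + DIM('a) + 1\<close>, as there are \<open>DIM('a) + 1\<close>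
  vertices.\<close>

lemma simplex_moment_Suc:
  assumes "i \<in> C"
  shows "real (sum \<beta> C + DIM('a) + 1) * simplex_moment (\<beta>(i := Suc (\<beta> i))) =
    real (Suc (\<beta> i)) * simplex_moment \<beta>"
proof -
  have "real (Suc (\<beta> i)) * simplex_moment \<beta> =
      (\<Sum>j\<in>C. real (Suc (\<beta> i)) * simplex_moment (\<beta>(j := Suc (\<beta> j))))"
    by (simp add: sum_simplex_moment flip: sum_distrib_left)
  also have "\<dots> = (\<Sum>j\<in>C. real (Suc (\<beta> j)) * simplex_moment (\<beta>(i := Suc (\<beta> i))))"
  proof (rule sum.cong[OF refl])
    fix j assume "j \<in> C"
    then show "real (Suc (\<beta> i)) * simplex_moment (\<beta>(j := Suc (\<beta> j))) =
        real (Suc (\<beta> j)) * simplex_moment (\<beta>(i := Suc (\<beta> i)))"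
      using simplex_moment_exchange[OF assms] by (cases "i = j") auto
  qed
  also have "\<dots> = real (sum \<beta> C + DIM('a) + 1) * simplex_moment (\<beta>(i := Suc (\<beta> i)))"
    by (simp add: card_C sum.distrib flip: sum_distrib_right)
  finally show ?thesis by simp
qed

text \<open>Dirichlet's formula, by lowering one exponent at a time until only the volume is
  left.\<close>

lemma simplex_moment_eq:
  "simplex_moment \<beta> * fact (sum \<beta> C + DIM('a)) =
    measure lborel (convex hull C) * fact DIM('a) * (\<Prod>v\<in>C. fact (\<beta> v))"
proof (induction "sum \<beta> C" arbitrary: \<beta>)
  case 0
  then have z: "\<beta> v = 0" if "v \<in> C" for v using that finite_C by simp
  then have "bary_monomial \<beta> = (\<lambda>x. 1)" by (simp add: bary_monomial_def fun_eq_iff)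
  then show ?case using z 0 compact_hull by (simp add: simplex_moment_def borel_compact)
next
  case (Suc n)
  then obtain i where i: "i \<in> C" "0 < \<beta> i"
    by (metis neq0_conv nat.distinct(1) sum.neutral)
  define \<gamma> where "\<gamma> = \<beta>(i := \<beta> i - 1)"
  have \<beta>: "\<beta> = \<gamma>(i := Suc (\<gamma> i))" using i by (auto simp: \<gamma>_def)
  have sum_eq: "sum \<beta> C = Suc (sum \<gamma> C)"
    by (simp add: \<beta> sum.remove[OF finite_C i(1)])
  then have IH: "simplex_moment \<gamma> * fact (sum \<gamma> C + DIM('a)) =
      measure lborel (convex hull C) * fact DIM('a) * (\<Prod>v\<in>C. fact (\<gamma> v))"
    using Suc by simp
  have pr: "(\<Prod>v\<in>C. fact (\<beta> v)) = real (Suc (\<gamma> i)) * (\<Prod>v\<in>C. fact (\<gamma> v))"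
    by (simp add: \<beta> prod.remove[OF finite_C i(1)])
  have "simplex_moment \<beta> * fact (sum \<beta> C + DIM('a)) =
      (real (sum \<gamma> C + DIM('a) + 1) * simplex_moment \<beta>) * fact (sum \<gamma> C + DIM('a))"
    by (simp add: sum_eq algebra_simps)
  also have "\<dots> = real (Suc (\<gamma> i)) * (simplex_moment \<gamma> * fact (sum \<gamma> C + DIM('a)))"
    using simplex_moment_Suc[OF i(1), of \<gamma>] by (simp add: \<beta>[symmetric] del: of_nat_Suc)
  finally show ?case by (simp add: IH pr)
qed

end

section \<open>The local estimate\<close>

text \<open>Vandermonde's identity as a Parseval identity: up to sign,
  \<open>fact b * (b choose a)\<close> is the coefficient of \<open>t^b\<close> at the Laguerre
  polynomial of index \<open>a\<close>, and \<open>fact (b + c)\<close> is the integral of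
  \<open>t^b * t^c\<close> with weight \<open>exp (- t)\<close>.\<close>

lemma sum_choose_choose:
  assumes "b \<le> N"
  shows "(\<Sum>a\<le>N. fact b * real (b choose a) * (fact c * real (c choose a))) = fact (b + c)"
proof -
  have "(\<Sum>a\<le>N. (b choose a) * (c choose a)) = (\<Sum>a\<le>b. (c choose a) * (b choose (b - a)))"
    using assms by (intro sum.mono_neutral_cong_right) (auto simp: binomial_symmetric[symmetric])
  also have "\<dots> = (b + c) choose b"
    by (simp add: vandermonde add.commute)
  finally have "(\<Sum>a\<le>N. real (b choose a) * real (c choose a)) = real ((b + c) choose b)"
    by (simp flip: of_nat_mult of_nat_sum)
  moreover have "fact b * fact c * real ((b + c) choose b) = fact (b + c)"
    by (simp add: binomial_fact)
  moreover have "(\<Sum>a\<le>N. fact b * real (b choose a) * (fact c * real (c choose a))) =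
      fact b * fact c * (\<Sum>a\<le>N. real (b choose a) * real (c choose a))"
    by (simp add: sum_distrib_left algebra_simps)
  ultimately show ?thesis by simp
qed

text \<open>The factor \<open>a\<close> is the Laguerre eigenvalue, and for positive
  \<open>b\<close> and \<open>c\<close> the right side is the integral of
  \<open>t * (t^b)' * (t^c)'\<close> with weight \<open>exp (- t)\<close>. The proof absorbs
  \<open>a\<close> into \<open>b choose a\<close> and applies Vandermonde's identity to the lowered
  index. If \<open>b\<close> or \<open>c\<close> is 0 both sides vanish, so the truncated
  subtraction does no harm.\<close>

lemma sum_times_choose_choose:
  assumes "b \<le> N"
  shows "(\<Sum>a\<le>N. real a * (fact b * real (b choose a) * (fact c * real (c choose a)))) =
    real b * real c * fact (b + c - 1)"
proof (cases "b = 0 \<or> c = 0")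
  case True
  then show ?thesis by (auto intro!: sum.neutral simp: binomial_eq_0_iff)
next
  case False
  then obtain b' c' where bc: "b = Suc b'" "c = Suc c'" by (metis old.nat.exhaust)
  have "(\<Sum>a\<le>N. a * (b choose a) * (c choose a)) = (\<Sum>a\<in>{1..b}. a * (b choose a) * (c choose a))"
    using assms by (intro sum.mono_neutral_right) (auto simp: not_le)
  also have "\<dots> = (\<Sum>a\<le>b'. Suc a * (b choose Suc a) * (c choose Suc a))"
    unfolding bc by (rule sum.reindex_bij_witness[of _ Suc "\<lambda>a. a - 1"]) auto
  also have "\<dots> = (\<Sum>a\<le>b'. b * ((c choose Suc a) * (b' choose (b' - a))))"
  proof (rule sum.cong[OF refl])
    fix a assume "a \<in> {..b'}"
    then have "b' choose (b' - a) = b' choose a" by (auto simp: binomial_symmetric[symmetric])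
    moreover have "Suc a * (b choose Suc a) = b * (b' choose a)"
      using Suc_times_binomial_eq[of b' a] unfolding bc(1) by (simp only: mult.commute)
    ultimately show "Suc a * (b choose Suc a) * (c choose Suc a) = b * ((c choose Suc a) * (b' choose (b' - a)))"
      by (simp only: ac_simps)
  qed
  also have "\<dots> = b * (\<Sum>a\<le>b'. (c choose Suc a) * (b' choose (b' - a)))"
    by (simp add: sum_distrib_left)
  \<comment> \<open>Extending the sum by \<open>k = 0\<close> changes nothing, because
    \<open>b' choose b = 0\<close> for \<open>b = Suc b'\<close>.\<close>
  also have "(\<Sum>a\<le>b'. (c choose Suc a) * (b' choose (b' - a))) = (\<Sum>k\<le>b. (c choose k) * (b' choose (b - k)))"
    unfolding bc by (subst sum.atMost_Suc_shift) (simp add: binomial_eq_0)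
  also have "\<dots> = (c + b') choose b" by (rule vandermonde)
  finally have "(\<Sum>a\<le>N. a * (b choose a) * (c choose a)) = b * ((c + b') choose b)" .
  then have 1: "(\<Sum>a\<le>N. real a * real (b choose a) * real (c choose a)) = real b * real ((c + b') choose b)"
    by (simp flip: of_nat_mult of_nat_sum)
  have 2: "fact b * fact c' * real ((c + b') choose b) = fact (c + b')"
    by (subst binomial_fact) (auto simp: bc)
  have "(\<Sum>a\<le>N. real a * (fact b * real (b choose a) * (fact c * real (c choose a)))) =
      fact b * fact c * (\<Sum>a\<le>N. real a * real (b choose a) * real (c choose a))"
    by (simp add: sum_distrib_left algebra_simps)
  also have "\<dots> = real b * real c * (fact b * fact c' * real ((c + b') choose b))"
    unfolding 1 by (simp add: bc(2))
  also have "\<dots> = real b * real c * fact (b + c - 1)"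
    unfolding 2 by (simp add: bc add.commute)
  finally show ?thesis .
qed

text \<open>Read from right to left it diagonalizes: a Gram matrix with entries
  \<open>\<Sum>\<alpha>\<in>A. t \<alpha> * (g \<beta> \<alpha> * g \<gamma> \<alpha>)\<close> gives
  a weighted sum of squares.\<close>

lemma sum_quadratic:
  "(\<Sum>\<alpha>\<in>A. t \<alpha> * (\<Sum>\<beta>\<in>E. c \<beta> * g \<beta> \<alpha>)\<^sup>2) =
    (\<Sum>\<beta>\<in>E. \<Sum>\<gamma>\<in>E. c \<beta> * c \<gamma> * (\<Sum>\<alpha>\<in>A. t \<alpha> * (g \<beta> \<alpha> * (g \<gamma> \<alpha> :: real))))"
proof -
  have "(\<Sum>\<alpha>\<in>A. t \<alpha> * (\<Sum>\<beta>\<in>E. c \<beta> * g \<beta> \<alpha>)\<^sup>2) =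
      (\<Sum>\<alpha>\<in>A. \<Sum>\<beta>\<in>E. \<Sum>\<gamma>\<in>E. c \<beta> * c \<gamma> * (t \<alpha> * (g \<beta> \<alpha> * g \<gamma> \<alpha>)))"
    by (simp add: power2_eq_square sum_product sum_distrib_left algebra_simps)
  also have "\<dots> = (\<Sum>\<beta>\<in>E. \<Sum>\<alpha>\<in>A. \<Sum>\<gamma>\<in>E. c \<beta> * c \<gamma> * (t \<alpha> * (g \<beta> \<alpha> * g \<gamma> \<alpha>)))"
    by (rule sum.swap)
  also have "\<dots> = (\<Sum>\<beta>\<in>E. \<Sum>\<gamma>\<in>E. \<Sum>\<alpha>\<in>A. c \<beta> * c \<gamma> * (t \<alpha> * (g \<beta> \<alpha> * g \<gamma> \<alpha>)))"
    by (intro sum.cong refl sum.swap)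
  finally show ?thesis by (simp add: sum_distrib_left)
qed

context affine_basis
begin

text \<open>Up to sign, the coefficient of the monomial with exponents \<open>\<beta>\<close> at the
  product of the Laguerre polynomials with indices \<open>\<alpha>\<close>.\<close>

definition factorial_choose :: "('a \<Rightarrow> nat) \<Rightarrow> ('a \<Rightarrow> nat) \<Rightarrow> real" where
  "factorial_choose \<beta> \<alpha> = (\<Prod>v\<in>C. fact (\<beta> v) * real (\<beta> v choose \<alpha> v))"

text \<open>The box \<open>C \<rightarrow>\<^sub>E {..K}\<close> exceeds the set of indices of total
  degree at most \<open>K\<close>, but it has product form, so the one-variable identity can be
  multiplied over the vertices.\<close>

lemma sum_factorial_choose:
  assumes "\<And>v. v \<in> C \<Longrightarrow> \<beta> v \<le> K"
  shows "(\<Sum>\<alpha>\<in>C \<rightarrow>\<^sub>E {..K}. factorial_choose \<beta> \<alpha> * factorial_choose \<gamma> \<alpha>) =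
    (\<Prod>v\<in>C. fact (\<beta> v + \<gamma> v))"
proof -
  have "(\<Prod>v\<in>C. fact (\<beta> v + \<gamma> v)) =
      (\<Prod>v\<in>C. \<Sum>a\<le>K. fact (\<beta> v) * real (\<beta> v choose a) * (fact (\<gamma> v) * real (\<gamma> v choose a)))"
    using assms by (intro prod.cong refl) (simp add: sum_choose_choose)
  also have "\<dots> = (\<Sum>\<alpha>\<in>C \<rightarrow>\<^sub>E {..K}. \<Prod>v\<in>C. fact (\<beta> v) * real (\<beta> v choose \<alpha> v) * (fact (\<gamma> v) * real (\<gamma> v choose \<alpha> v)))"
    by (rule prod_sum_PiE) (auto simp: finite_C)
  finally show ?thesis by (simp add: factorial_choose_def prod.distrib)
qed

lemma sum_times_factorial_choose:
  assumes "\<And>v. v \<in> C \<Longrightarrow> \<beta> v \<le> K" and i: "i \<in> C"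
  shows "(\<Sum>\<alpha>\<in>C \<rightarrow>\<^sub>E {..K}. real (\<alpha> i) * (factorial_choose \<beta> \<alpha> * factorial_choose \<gamma> \<alpha>)) =
    real (\<beta> i) * real (\<gamma> i) * (fact (\<beta> i + \<gamma> i - 1) * (\<Prod>v\<in>C - {i}. fact (\<beta> v + \<gamma> v)))"
proof -
  let ?g = "\<lambda>v a. fact (\<beta> v) * real (\<beta> v choose a) * (fact (\<gamma> v) * real (\<gamma> v choose a))"
  \<comment> \<open>The weight \<open>\<alpha> i\<close> is a product over all vertices with trivial
    factors away from \<open>i\<close>; the sum therefore still factorizes, and only the factor of
    \<open>i\<close> needs the weighted identity.\<close>
  let ?f = "\<lambda>v a. (if v = i then real a else 1) * ?g v a"
  have "(\<Prod>v\<in>C. \<Sum>a\<le>K. ?f v a) = (\<Sum>a\<le>K. ?f i a) * (\<Prod>v\<in>C - {i}. \<Sum>a\<le>K. ?f v a)"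
    by (rule prod.remove[OF finite_C i])
  also have "(\<Sum>a\<le>K. ?f i a) = real (\<beta> i) * real (\<gamma> i) * fact (\<beta> i + \<gamma> i - 1)"
    using sum_times_choose_choose[of "\<beta> i" K "\<gamma> i"] assms by simp
  also have "(\<Prod>v\<in>C - {i}. \<Sum>a\<le>K. ?f v a) = (\<Prod>v\<in>C - {i}. fact (\<beta> v + \<gamma> v))"
    using assms by (intro prod.cong refl) (simp add: sum_choose_choose)
  finally have "(\<Prod>v\<in>C. \<Sum>a\<le>K. ?f v a) =
      real (\<beta> i) * real (\<gamma> i) * (fact (\<beta> i + \<gamma> i - 1) * (\<Prod>v\<in>C - {i}. fact (\<beta> v + \<gamma> v)))"
    by simp
  moreover have "(\<Prod>v\<in>C. \<Sum>a\<le>K. ?f v a) = (\<Sum>\<alpha>\<in>C \<rightarrow>\<^sub>E {..K}. \<Prod>v\<in>C. ?f v (\<alpha> v))"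
    by (rule prod_sum_PiE) (auto simp: finite_C)
  moreover have "(\<Prod>v\<in>C. ?f v (\<alpha> v)) = real (\<alpha> i) * (factorial_choose \<beta> \<alpha> * factorial_choose \<gamma> \<alpha>)" for \<alpha>
  proof -
    have "(\<Prod>v\<in>C. ?f v (\<alpha> v)) = (\<Prod>v\<in>C. if v = i then real (\<alpha> v) else 1) * (\<Prod>v\<in>C. ?g v (\<alpha> v))"
      by (rule prod.distrib)
    then show ?thesis using i finite_C by (simp add: factorial_choose_def prod.distrib)
  qed
  ultimately show ?thesis by simp
qed

text \<open>Here the degree enters: on forms of degree \<open>K\<close> only indices of total degree
  at most \<open>K\<close> survive, so no eigenvalue exceeds \<open>K\<close>.\<close>

lemma factorial_choose_eq_0:
  assumes "sum \<beta> C < sum \<alpha> C"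
  shows "factorial_choose \<beta> \<alpha> = 0"
proof -
  obtain v where "v \<in> C" "\<beta> v < \<alpha> v"
    using assms sum_mono[of C \<alpha> \<beta>] by (meson leD not_le)
  then show ?thesis using finite_C by (auto simp: factorial_choose_def binomial_eq_0)
qed

text \<open>Used with \<open>k = 0\<close> for the norm of a form and with \<open>k = 1\<close> for
  the weighted norm of its derivatives.\<close>

lemma integral_bary_combination_mult:
  fixes E :: "('a \<Rightarrow> nat) set" and h :: "('a \<Rightarrow> nat) \<Rightarrow> 'a \<Rightarrow> nat"
  assumes "i \<in> C"
  shows "(\<integral>x. indicator (convex hull C) x * (bary C i x ^ k * (\<Sum>\<beta>\<in>E. c \<beta> * bary_monomial (h \<beta>) x)\<^sup>2) \<partial>lborel) =
    (\<Sum>\<beta>\<in>E. \<Sum>\<gamma>\<in>E. c \<beta> * c \<gamma> * simplex_moment (\<lambda>v. h \<beta> v + h \<gamma> v + (if v = i then k else 0)))"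
proof -
  have e: "bary C i x ^ k = bary_monomial (\<lambda>v. if v = i then k else 0) x" for x
    using assms finite_C by (simp add: bary_monomial_def if_distrib[of "\<lambda>t. _ ^ t"] cong: if_cong)
  have "indicator (convex hull C) x * (bary C i x ^ k * (\<Sum>\<beta>\<in>E. c \<beta> * bary_monomial (h \<beta>) x)\<^sup>2) =
      (\<Sum>\<beta>\<in>E. \<Sum>\<gamma>\<in>E. c \<beta> * c \<gamma> * (indicator (convex hull C) x *
        bary_monomial (\<lambda>v. h \<beta> v + h \<gamma> v + (if v = i then k else 0)) x))" for x
    unfolding e
    by (simp add: power2_eq_square sum_product sum_distrib_left bary_monomial_mult[symmetric] algebra_simps)
  then show ?thesis
    by (simp add: simplex_moment_def Bochner_Integration.integral_sum integrable_hull
        continuous_on_bary_monomial integrable_mult_right Bochner_Integration.integrable_sum)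
qed

text \<open>After clearing factorials both sides are diagonal in the quantities
  \<open>\<Sum>\<beta>. c \<beta> * factorial_choose \<beta> \<alpha>\<close> (the Laguerre coefficients of the homogeneous
  polynomial), with weights \<open>\<bar>\<alpha>\<bar> \<le> K\<close> and \<open>1\<close>.\<close>

lemma bernstein_derivative_estimate:
  fixes c :: "('a \<Rightarrow> nat) \<Rightarrow> real"
  assumes K: "1 \<le> K"
  shows "(\<Sum>i\<in>C. \<integral>x. indicator (convex hull C) x * (bary C i x *
      ((\<Sum>\<beta>\<in>exponents C K. c \<beta> * real (\<beta> i) * bary_monomial (\<beta>(i := \<beta> i - 1)) x) / real K)\<^sup>2) \<partial>lborel)
    \<le> (2 * real K + real DIM('a)) / real K *
      (\<integral>x. indicator (convex hull C) x * (\<Sum>\<beta>\<in>exponents C K. c \<beta> * bary_monomial \<beta> x)\<^sup>2 \<partial>lborel)"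
    (is "?lhs \<le> _ * ?rhs")
proof -
  let ?E = "exponents C K" and ?A = "C \<rightarrow>\<^sub>E {..K}" and ?d = "DIM('a)"
  define \<kappa> where "\<kappa> = measure lborel (convex hull C) * fact ?d"
  define Q where "Q \<alpha> = (\<Sum>\<beta>\<in>?E. c \<beta> * factorial_choose \<beta> \<alpha>)\<^sup>2" for \<alpha>
  have le: "\<beta> v \<le> K" if "\<beta> \<in> ?E" "v \<in> C" for \<beta> v
    using exponents_le[OF finite_C that] .
  have sumE: "sum \<beta> C = K" if "\<beta> \<in> ?E" for \<beta> using that by (simp add: exponents_def)
  obtain i0 where i0: "i0 \<in> C" using C_nonempty by blast
  have "?rhs * fact (2 * K + ?d) =
      (\<Sum>\<beta>\<in>?E. \<Sum>\<gamma>\<in>?E. c \<beta> * c \<gamma> * (simplex_moment (\<lambda>v. \<beta> v + \<gamma> v) * fact (2 * K + ?d)))"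
    using integral_bary_combination_mult[OF i0, of 0 c "\<lambda>\<beta>. \<beta>" ?E]
    by (simp add: sum_distrib_right mult.assoc if_distrib cong: if_cong)
  also have "\<dots> = (\<Sum>\<beta>\<in>?E. \<Sum>\<gamma>\<in>?E. c \<beta> * c \<gamma> * (\<kappa> * (\<Sum>\<alpha>\<in>?A. factorial_choose \<beta> \<alpha> * factorial_choose \<gamma> \<alpha>)))"
  proof (intro sum.cong refl)
    fix \<beta> \<gamma> assume "\<beta> \<in> ?E" "\<gamma> \<in> ?E"
    then have "simplex_moment (\<lambda>v. \<beta> v + \<gamma> v) * fact (2 * K + ?d) =
        \<kappa> * (\<Sum>\<alpha>\<in>?A. factorial_choose \<beta> \<alpha> * factorial_choose \<gamma> \<alpha>)"
      using simplex_moment_eq[of "\<lambda>v. \<beta> v + \<gamma> v"] le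
      by (simp add: sum.distrib sumE sum_factorial_choose \<kappa>_def mult_2)
    then show "c \<beta> * c \<gamma> * (simplex_moment (\<lambda>v. \<beta> v + \<gamma> v) * fact (2 * K + ?d)) =
        c \<beta> * c \<gamma> * (\<kappa> * (\<Sum>\<alpha>\<in>?A. factorial_choose \<beta> \<alpha> * factorial_choose \<gamma> \<alpha>))" by simp
  qed
  also have "\<dots> = \<kappa> * (\<Sum>\<alpha>\<in>?A. Q \<alpha>)"
    using sum_quadratic[of "\<lambda>_. 1" c factorial_choose ?E ?A]
    by (simp add: Q_def sum_distrib_left algebra_simps)
  finally have rhs: "?rhs * fact (2 * K + ?d) = \<kappa> * (\<Sum>\<alpha>\<in>?A. Q \<alpha>)" .
  \<comment> \<open>\<open>real K ^ 2\<close> clears the normalization of the derivative; the degree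
    in the factorial is \<open>2 * (K - 1) + 1\<close>.\<close>
  have part: "(\<integral>x. indicator (convex hull C) x * (bary C i x *
      ((\<Sum>\<beta>\<in>?E. c \<beta> * real (\<beta> i) * bary_monomial (\<beta>(i := \<beta> i - 1)) x) / real K)\<^sup>2) \<partial>lborel) *
      (real K ^ 2 * fact (2 * K - 1 + ?d)) = \<kappa> * (\<Sum>\<alpha>\<in>?A. real (\<alpha> i) * Q \<alpha>)"
    if i: "i \<in> C" for i
  proof -
    let ?m = "\<lambda>\<beta> \<gamma>. simplex_moment (\<lambda>v. (\<beta>(i := \<beta> i - 1)) v + (\<gamma>(i := \<gamma> i - 1)) v + (if v = i then 1 else 0))"
    have "(\<integral>x. indicator (convex hull C) x * (bary C i x *
        ((\<Sum>\<beta>\<in>?E. c \<beta> * real (\<beta> i) * bary_monomial (\<beta>(i := \<beta> i - 1)) x) / real K)\<^sup>2) \<partial>lborel) =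
        (\<integral>x. inverse (real K ^ 2) * (indicator (convex hull C) x * (bary C i x ^ 1 *
        (\<Sum>\<beta>\<in>?E. c \<beta> * real (\<beta> i) * bary_monomial (\<beta>(i := \<beta> i - 1)) x)\<^sup>2)) \<partial>lborel)"
      by (simp add: power_divide divide_inverse power_inverse algebra_simps)
    also have "\<dots> = inverse (real K ^ 2) * (\<integral>x. indicator (convex hull C) x * (bary C i x ^ 1 *
        (\<Sum>\<beta>\<in>?E. c \<beta> * real (\<beta> i) * bary_monomial (\<beta>(i := \<beta> i - 1)) x)\<^sup>2) \<partial>lborel)"
      by (rule integral_mult_right_zero)
    also have "\<dots> = inverse (real K ^ 2) * (\<Sum>\<beta>\<in>?E. \<Sum>\<gamma>\<in>?E. (c \<beta> * real (\<beta> i)) * (c \<gamma> * real (\<gamma> i)) * ?m \<beta> \<gamma>)"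
      using integral_bary_combination_mult[OF i, of 1 "\<lambda>\<beta>. c \<beta> * real (\<beta> i)" "\<lambda>\<beta>. \<beta>(i := \<beta> i - 1)" ?E]
      by simp
    finally have 1: "(\<integral>x. indicator (convex hull C) x * (bary C i x *
        ((\<Sum>\<beta>\<in>?E. c \<beta> * real (\<beta> i) * bary_monomial (\<beta>(i := \<beta> i - 1)) x) / real K)\<^sup>2) \<partial>lborel) *
        (real K ^ 2 * fact (2 * K - 1 + ?d)) =
        (\<Sum>\<beta>\<in>?E. \<Sum>\<gamma>\<in>?E. (c \<beta> * real (\<beta> i)) * (c \<gamma> * real (\<gamma> i)) * ?m \<beta> \<gamma>) * fact (2 * K - 1 + ?d)"
      using K by simp
    also have "\<dots> = (\<Sum>\<beta>\<in>?E. \<Sum>\<gamma>\<in>?E. c \<beta> * c \<gamma> *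
        (real (\<beta> i) * real (\<gamma> i) * (?m \<beta> \<gamma> * fact (2 * K - 1 + ?d))))"
      unfolding sum_distrib_right by (intro sum.cong refl) (simp only: mult_ac)
    also have "\<dots> = (\<Sum>\<beta>\<in>?E. \<Sum>\<gamma>\<in>?E. c \<beta> * c \<gamma> *
        (\<kappa> * (\<Sum>\<alpha>\<in>?A. real (\<alpha> i) * (factorial_choose \<beta> \<alpha> * factorial_choose \<gamma> \<alpha>))))"
    proof (intro sum.cong refl)
      fix \<beta> \<gamma> assume E: "\<beta> \<in> ?E" "\<gamma> \<in> ?E"
      have "real (\<beta> i) * real (\<gamma> i) * (?m \<beta> \<gamma> * fact (2 * K - 1 + ?d)) =
        \<kappa> * (\<Sum>\<alpha>\<in>?A. real (\<alpha> i) * (factorial_choose \<beta> \<alpha> * factorial_choose \<gamma> \<alpha>))"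
      \<comment> \<open>If one of the exponents at \<open>i\<close> is 0, lowering it is only a
        truncation, but then its factor makes both sides 0.\<close>
      proof (cases "\<beta> i = 0 \<or> \<gamma> i = 0")
        case True
        then show ?thesis
          using le E i by (auto simp: sum_times_factorial_choose)
      next
        case False
        let ?s = "\<lambda>v. (\<beta>(i := \<beta> i - 1)) v + (\<gamma>(i := \<gamma> i - 1)) v + (if v = i then 1 else 0)"
        have "sum ?s C = (\<beta> i + \<gamma> i - 1) + (\<Sum>v\<in>C - {i}. \<beta> v + \<gamma> v)"
          using False by (subst sum.remove[OF finite_C i]) auto
        moreover have "sum \<beta> C + sum \<gamma> C = (\<beta> i + \<gamma> i) + (\<Sum>v\<in>C - {i}. \<beta> v + \<gamma> v)"
          by (simp add: sum.remove[OF finite_C i] sum.distrib)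
        ultimately have s: "sum ?s C = 2 * K - 1"
          using False sumE E by simp
        have p: "(\<Prod>v\<in>C. fact (?s v)) = fact (\<beta> i + \<gamma> i - 1) * (\<Prod>v\<in>C - {i}. fact (\<beta> v + \<gamma> v) :: real)"
        proof -
          have "?s i = \<beta> i + \<gamma> i - 1" using False by (simp, arith)
          moreover have "(\<Prod>v\<in>C - {i}. fact (?s v)) = (\<Prod>v\<in>C - {i}. fact (\<beta> v + \<gamma> v) :: real)"
            by (intro prod.cong) auto
          ultimately show ?thesis by (simp only: prod.remove[OF finite_C i])
        qed
        have "?m \<beta> \<gamma> * fact (2 * K - 1 + ?d) =
            \<kappa> * (fact (\<beta> i + \<gamma> i - 1) * (\<Prod>v\<in>C - {i}. fact (\<beta> v + \<gamma> v)))"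
          using simplex_moment_eq[of ?s] unfolding s p \<kappa>_def by simp
        then show ?thesis
          using le E i by (simp add: sum_times_factorial_choose)
      qed
      then show "c \<beta> * c \<gamma> * (real (\<beta> i) * real (\<gamma> i) * (?m \<beta> \<gamma> * fact (2 * K - 1 + ?d))) =
        c \<beta> * c \<gamma> * (\<kappa> * (\<Sum>\<alpha>\<in>?A. real (\<alpha> i) * (factorial_choose \<beta> \<alpha> * factorial_choose \<gamma> \<alpha>)))"
        by simp
    qed
    also have "\<dots> = \<kappa> * (\<Sum>\<alpha>\<in>?A. real (\<alpha> i) * Q \<alpha>)"
      unfolding Q_def sum_quadratic by (simp add: sum_distrib_left algebra_simps)
    finally show ?thesis .
  qed
  have "?lhs * (real K ^ 2 * fact (2 * K - 1 + ?d)) = (\<Sum>i\<in>C. \<kappa> * (\<Sum>\<alpha>\<in>?A. real (\<alpha> i) * Q \<alpha>))"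
    unfolding sum_distrib_right by (intro sum.cong refl part)
  also have "\<dots> = \<kappa> * (\<Sum>\<alpha>\<in>?A. real (sum \<alpha> C) * Q \<alpha>)"
    by (simp add: sum.swap[of _ ?A C] flip: sum_distrib_left sum_distrib_right)
  also have "\<dots> \<le> \<kappa> * (\<Sum>\<alpha>\<in>?A. real K * Q \<alpha>)"
  proof (intro mult_left_mono sum_mono)
    fix \<alpha>
    show "real (sum \<alpha> C) * Q \<alpha> \<le> real K * Q \<alpha>"
    proof (cases "sum \<alpha> C \<le> K")
      case True
      then show ?thesis by (intro mult_right_mono) (auto simp: Q_def simp del: of_nat_sum)
    next
      case False
      then have "Q \<alpha> = 0" by (auto simp: Q_def sumE intro!: sum.neutral factorial_choose_eq_0)
      then show ?thesis by simp
    qed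
  qed (simp add: \<kappa>_def)
  also have "\<dots> = real K * (?rhs * fact (2 * K + ?d))"
    by (simp add: rhs flip: sum_distrib_left)
  \<comment> \<open>The quotient of the two factorials is the numerator of the final
    constant.\<close>
  also have "(fact (2 * K + ?d) :: real) = (2 * real K + real ?d) * fact (2 * K - 1 + ?d)"
    using K fact_reduce[of "2 * K + ?d", where ?'a = real] by simp
  finally have "?lhs * real K ^ 2 * fact (2 * K - 1 + ?d) \<le>
      real K * ?rhs * (2 * real K + real ?d) * fact (2 * K - 1 + ?d)"
    by (simp only: mult_ac)
  then have "?lhs * real K ^ 2 \<le> real K * ?rhs * (2 * real K + real ?d)"
    by (rule mult_right_le_imp_le) simp
  then have "real K * (?lhs * real K) \<le> real K * (?rhs * (2 * real K + real ?d))"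
    by (simp only: power2_eq_square mult_ac)
  then have "?lhs * real K \<le> ?rhs * (2 * real K + real ?d)"
    using K by simp
  then show ?thesis using K by (simp add: field_simps)
qed

end

section \<open>Triangulations and hat functions\<close>

context affine_basis
begin

lemma bary_face:
  assumes "D \<subseteq> C" "x \<in> convex hull D"
  obtains u where "sum u D = 1" "(\<Sum>w\<in>D. u w *\<^sub>R w) = x" "\<And>w. w \<in> D \<Longrightarrow> 0 \<le> u w"
    "\<And>v. v \<in> C \<Longrightarrow> bary C v x = (if v \<in> D then u v else 0)"
proof -
  have fin: "finite D" using assms(1) finite_C finite_subset by blast
  then obtain u where u: "\<forall>w\<in>D. 0 \<le> u w" "sum u D = 1" "(\<Sum>w\<in>D. u w *\<^sub>R w) = x"
    using assms(2) unfolding convex_hull_finite[OF fin] by auto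
  have "bary C v x = (if v \<in> D then u v else 0)" if v: "v \<in> C" for v
  proof -
    have "bary C v x = (\<Sum>w\<in>D. u w * bary C v w)"
      using bary_combination[OF v fin u(2), of "\<lambda>w. w"] by (simp add: u(3))
    also have "\<dots> = (\<Sum>w\<in>D. if w = v then u w else 0)"
      using assms(1) v by (intro sum.cong refl) (auto simp: bary_vertex)
    finally show ?thesis using fin by simp
  qed
  then show thesis using u that by blast
qed

text \<open>Vertex interpolation reproduces forms of degree one, whose monomials are the barycentric
  coordinates themselves, and these exhaust \<open>polynomials 1\<close>.\<close>

lemma polynomial_1_eq:
  assumes "p \<in> polynomials 1"
  shows "p x = (\<Sum>v\<in>C. p v * bary C v x)"
proof -
  define L where "L f = (\<lambda>x. \<Sum>v\<in>C. f v * bary C v x)" for f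
  let ?W = "{f. L f = f}"
  have "fun_subspace ?W"
  proof (rule fun_subspaceI; simp)
    show "L (\<lambda>x. 0) = (\<lambda>x. 0)" by (simp add: L_def)
  next
    fix f g assume fg: "L f = f" "L g = g"
    have "L (\<lambda>x. f x + g x) = (\<lambda>x. L f x + L g x)"
      by (simp add: L_def fun_eq_iff algebra_simps sum.distrib)
    then show "L (\<lambda>x. f x + g x) = (\<lambda>x. f x + g x)" by (simp add: fg)
  next
    fix c f assume f: "L f = f"
    have "L (\<lambda>x. c * f x) = (\<lambda>x. c * L f x)"
      by (simp add: L_def fun_eq_iff algebra_simps sum_distrib_left)
    then show "L (\<lambda>x. c * f x) = (\<lambda>x. c * f x)" by (simp add: f)
  qed
  moreover have "(\<lambda>\<beta> x. \<Prod>v\<in>C. bary C v x ^ \<beta> v) ` exponents C 1 \<subseteq> ?W"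
  proof (rule image_subsetI)
    fix \<beta> assume "\<beta> \<in> exponents C 1"
    then obtain w where w: "w \<in> C" "\<beta> w = 1" "\<forall>b\<in>C. w \<noteq> b \<longrightarrow> \<beta> b = 0"
      unfolding exponents_def using sum_eq_1_iff[OF finite_C, of \<beta>] by auto
    have "(\<Prod>v\<in>C. bary C v x ^ \<beta> v) = (\<Prod>v\<in>C. if v = w then bary C v x else 1)" for x
      using w by (intro prod.cong refl) auto
    then have "(\<lambda>x. \<Prod>v\<in>C. bary C v x ^ \<beta> v) = bary C w" using w finite_C by (simp add: fun_eq_iff)
    moreover have "L (bary C w) = bary C w"
      using w(1) finite_C
      by (simp add: L_def fun_eq_iff bary_vertex if_distrib[of "\<lambda>t. t * _"] cong: if_cong)
    ultimately show "(\<lambda>x. \<Prod>v\<in>C. bary C v x ^ \<beta> v) \<in> ?W" by simp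
  qed
  ultimately have "bernstein 1 \<subseteq> ?W"
    unfolding bernstein_def by (intro fun_vs.span_minimal)
  then have "L p = p" using assms polynomials_bernstein[of 1] by blast
  then have "p x = L p x" by simp
  then show ?thesis by (simp only: L_def)
qed

lemma interior_nonempty: "interior (convex hull C) \<noteq> {}"
proof -
  let ?x = "\<Sum>v\<in>C. (1 / real (card C)) *\<^sub>R v"
  have "sum (\<lambda>v. 1 / real (card C)) C = 1" using card_C by simp
  then have "bary C v ?x = 1 / real (card C)" if "v \<in> C" for v
    using bary_unique[of "\<lambda>v. 1 / real (card C)" v] that by simp
  then have "?x \<in> interior (convex hull C)"
    unfolding interior_convex_hull_bary using card_C by simp
  then show ?thesis by blast
qed

end

section \<open>Piecewise polynomial spaces\<close>

lemma pw_polynomialsD: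
  assumes "v \<in> pw_polynomials k \<S>" "T \<in> \<S>"
  obtains p where "p \<in> polynomials k" "\<And>x. x \<in> T \<Longrightarrow> v x = p x"
  using assms unfolding pw_polynomials_def by blast

lemma pw_polynomials_mono: "j \<le> k \<Longrightarrow> pw_polynomials j \<S> \<subseteq> pw_polynomials k \<S>"
  using polynomials_mono unfolding pw_polynomials_def by blast

lemma subspace_pw_polynomials: "fun_subspace (pw_polynomials k \<S>)"
proof (rule fun_subspaceI)
  note P = fun_subspaceD[OF subspace_polynomials]
  show "(\<lambda>x. 0) \<in> pw_polynomials k \<S>"
    using P(1) by (force simp: pw_polynomials_def)
  show "(\<lambda>x. f x + g x) \<in> pw_polynomials k \<S>"
    if f: "f \<in> pw_polynomials k \<S>" and g: "g \<in> pw_polynomials k \<S>" for f g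
  proof -
    have "\<exists>p\<in>polynomials k. \<forall>x\<in>T. f x + g x = p x" if T: "T \<in> \<S>" for T
    proof -
      obtain p where "p \<in> polynomials k" "\<And>x. x \<in> T \<Longrightarrow> f x = p x" using pw_polynomialsD[OF f T] by blast
      moreover obtain q where "q \<in> polynomials k" "\<And>x. x \<in> T \<Longrightarrow> g x = q x" using pw_polynomialsD[OF g T] by blast
      ultimately show ?thesis using P(2)[of p k q] by (intro bexI[of _ "\<lambda>x. p x + q x"]) auto
    qed
    then show ?thesis using f g by (simp add: pw_polynomials_def continuous_on_add)
  qed
  show "(\<lambda>x. c * f x) \<in> pw_polynomials k \<S>" if f: "f \<in> pw_polynomials k \<S>" for c f
  proof -
    have "\<exists>p\<in>polynomials k. \<forall>x\<in>T. c * f x = p x" if T: "T \<in> \<S>" for T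
    proof -
      obtain p where "p \<in> polynomials k" "\<And>x. x \<in> T \<Longrightarrow> f x = p x" using pw_polynomialsD[OF f T] by blast
      then show ?thesis using P(3)[of p k c] by (intro bexI[of _ "\<lambda>x. c * p x"]) auto
    qed
    then show ?thesis using f by (simp add: pw_polynomials_def continuous_on_mult_left)
  qed
qed

text \<open>Choosing for every point one simplex containing it writes a piecewise polynomial as a
  combination of monomials cut off to the resulting disjoint pieces.\<close>

lemma pw_polynomials_finite_dim:
  fixes \<S> :: "'a::euclidean_space set set"
  assumes "finite \<S>"
  shows "\<exists>B. finite B \<and> pw_polynomials k \<S> \<subseteq> fun_span B"
proof -
  define piece where "piece x = (SOME T. T \<in> \<S> \<and> x \<in> T)" for x :: 'a
  define g where "g = (\<lambda>(T, \<alpha>) x. if x \<in> \<Union>\<S> \<and> piece x = T then \<Prod>b\<in>Basis. (x \<bullet> b) ^ \<alpha> b else (0::real))"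
  define I where "I = \<S> \<times> (multi_indices k :: ('a \<Rightarrow> nat) set)"
  have fin: "finite I" unfolding I_def using assms finite_multi_indices by blast
  have piece: "piece x \<in> \<S> \<and> x \<in> piece x" if "x \<in> \<Union>\<S>" for x
    unfolding piece_def using that someI_ex[of "\<lambda>T. T \<in> \<S> \<and> x \<in> T"] by auto
  have "pw_polynomials k \<S> \<subseteq> fun_span (g ` I)"
  proof
    fix v assume v: "v \<in> pw_polynomials k \<S>"
    then have "\<forall>T\<in>\<S>. \<exists>c. \<forall>x\<in>T. v x = (\<Sum>\<alpha>\<in>multi_indices k. c \<alpha> * (\<Prod>b\<in>Basis. (x \<bullet> b) ^ \<alpha> b))"
      unfolding pw_polynomials_def polynomials_def by blast
    then obtain c where c: "\<And>T x. T \<in> \<S> \<Longrightarrow> x \<in> T \<Longrightarrow>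
        v x = (\<Sum>\<alpha>\<in>multi_indices k. c T \<alpha> * (\<Prod>b\<in>Basis. (x \<bullet> b) ^ \<alpha> b))" by metis
    have "v x = (\<Sum>i\<in>I. c (fst i) (snd i) * g i x)" for x
    proof (cases "x \<in> \<Union>\<S>")
      case True
      have "(\<Sum>i\<in>I. c (fst i) (snd i) * g i x) = (\<Sum>T\<in>\<S>. \<Sum>\<alpha>\<in>multi_indices k. c T \<alpha> * g (T, \<alpha>) x)"
        unfolding I_def by (simp add: sum.cartesian_product case_prod_unfold)
      also have "\<dots> = (\<Sum>T\<in>\<S>. if piece x = T then v x else 0)"
        using c[of "piece x" x] piece[OF True] True by (intro sum.cong refl) (auto simp: g_def)
      finally show ?thesis using assms piece[OF True] by simp
    next
      case False
      then show ?thesis using v by (auto simp: g_def pw_polynomials_def split_def)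
    qed
    then have "v = (\<lambda>x. \<Sum>i\<in>I. c (fst i) (snd i) * g i x)" by blast
    then show "v \<in> fun_span (g ` I)"
      unfolding range_sum_eq_fun_span[OF fin, of g, symmetric] by (intro CollectI exI[of _ "\<lambda>i. c (fst i) (snd i)"])
  qed
  then show ?thesis using fin by blast
qed

locale triangulated_domain =
  fixes \<Omega> :: "'a::euclidean_space set" and \<T> :: "'a set set"
  assumes domain: "bounded_polyhedral_domain \<Omega>" and regular: "regular_triangulation \<Omega> \<T>"
begin

lemma finite_T: "finite \<T>" and Union_T: "\<Union>\<T> = closure \<Omega>"
  and face_T: "\<And>S T. S \<in> \<T> \<Longrightarrow> T \<in> \<T> \<Longrightarrow> (S \<inter> T) face_of S"
  using regular unfolding regular_triangulation_def triangulation_def by auto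

text \<open>The extreme points of a simplex recover its affinely independent generators, so
  \<open>vertices\<close> may serve as index set of the barycentric coordinates.\<close>

lemma
  assumes "T \<in> \<T>"
  shows basis_T: "affine_basis (vertices T)" and hull_T: "T = convex hull (vertices T)"
proof -
  have "int DIM('a) simplex T" using assms regular by (auto simp: regular_triangulation_def)
  then obtain C where C: "\<not> affine_dependent C" "int (card C) = int DIM('a) + 1" "T = convex hull C"
    unfolding simplex_def by blast
  have "vertices T = C"
    unfolding vertices_def C(3) using extreme_point_of_convex_hull_affine_independent[OF C(1)] by auto
  moreover have "card C = DIM('a) + 1" using C(2) by linarith
  ultimately show "affine_basis (vertices T)" "T = convex hull (vertices T)"
    using C by (auto simp: affine_basis_def)
qed

lemma
  assumes "T \<in> \<T>"
  shows finite_vertices: "finite (vertices T)"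
    and vertices_subset: "vertices T \<subseteq> T" and compact_T: "compact T" and convex_T: "convex T"
    and closed_T: "closed T" and int_T_nonempty: "interior T \<noteq> {}"
proof -
  interpret affine_basis "vertices T" using basis_T[OF assms] .
  show "finite (vertices T)" by (rule finite_C)
  show "vertices T \<subseteq> T" by (auto simp: vertices_def extreme_point_of_def)
  show "compact T" "convex T" "interior T \<noteq> {}"
    using compact_hull convex_convex_hull interior_nonempty hull_T[OF assms] by metis+
  then show "closed T" by (simp add: compact_imp_closed)
qed

text \<open>Being a face of both simplices, the intersection is the hull of some vertices of
  \<open>S\<close> and of some vertices of \<open>T\<close>. Both sets are its extreme points, hence
  they coincide and contain every common vertex.\<close>

lemma Int_T:
  assumes "S \<in> \<T>" "T \<in> \<T>"
  shows "S \<inter> T = convex hull (vertices S \<inter> vertices T)"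
proof -
  have S: "\<not> affine_dependent (vertices S)" and T: "\<not> affine_dependent (vertices T)"
    using basis_T assms by (auto simp: affine_basis_def)
  have "(S \<inter> T) face_of convex hull (vertices S)"
    using face_T[OF assms] hull_T[OF assms(1)] by simp
  then obtain c where c: "c \<subseteq> vertices S" "S \<inter> T = convex hull c"
    unfolding face_of_convex_hull_affine_independent[OF S] by blast
  have "(T \<inter> S) face_of convex hull (vertices T)"
    using face_T[OF assms(2,1)] hull_T[OF assms(2)] by simp
  then obtain c' where c': "c' \<subseteq> vertices T" "T \<inter> S = convex hull c'"
    unfolding face_of_convex_hull_affine_independent[OF T] by blast
  have "{x. x extreme_point_of (S \<inter> T)} = c"
    unfolding c(2) using affine_independent_subset[OF S c(1)]
    by (simp add: extreme_point_of_convex_hull_affine_independent)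
  moreover have "{x. x extreme_point_of (T \<inter> S)} = c'"
    unfolding c'(2) using affine_independent_subset[OF T c'(1)]
    by (simp add: extreme_point_of_convex_hull_affine_independent)
  ultimately have "c \<subseteq> vertices S \<inter> vertices T" "vertices S \<inter> vertices T \<subseteq> c"
    using c(1) c'(1) extreme_point_of_Int by (auto simp: Int_commute vertices_def)
  then have "c = vertices S \<inter> vertices T" by blast
  then show ?thesis using c(2) by simp
qed

text \<open>There are no hanging nodes: a vertex of \<open>S\<close> lying in \<open>T\<close> is
  extreme in the face \<open>S \<inter> T\<close> of \<open>T\<close>, and extreme points of a face
  are extreme.\<close>

lemma node_in_simplex:
  assumes "i \<in> nodes \<T>" "T \<in> \<T>" "i \<in> T"
  shows "i \<in> vertices T"
proof -
  obtain S where S: "S \<in> \<T>" "i \<in> vertices S" using assms(1) by (auto simp: nodes_def)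
  then have "i \<in> S" using vertices_subset by blast
  then have "i extreme_point_of (S \<inter> T)"
    using S(2) assms(3) by (auto simp: vertices_def extreme_point_of_def)
  moreover have "(S \<inter> T) face_of T" using face_T[OF assms(2) S(1)] by (simp add: Int_commute)
  ultimately show ?thesis using extreme_point_of_face by (auto simp: vertices_def)
qed

lemma finite_nodes: "finite (nodes \<T>)"
  unfolding nodes_def using finite_T finite_vertices by auto

lemma vertices_nodes: "T \<in> \<T> \<Longrightarrow> vertices T \<subseteq> nodes \<T>"
  unfolding nodes_def by blast

lemma patch_iff:
  assumes "i \<in> nodes \<T>"
  shows "T \<in> patch \<T> i \<longleftrightarrow> T \<in> \<T> \<and> i \<in> vertices T"
  using node_in_simplex[OF assms] vertices_subset unfolding patch_def by auto

definition nodal_coord :: "'a set \<Rightarrow> 'a \<Rightarrow> 'a \<Rightarrow> real" where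
  "nodal_coord T i x = (if i \<in> vertices T then bary (vertices T) i x else 0)"

text \<open>Common points lie in the hull of the common vertices, where both coordinate systems see
  only these vertices, with the same weights.\<close>

lemma nodal_coord_agree:
  assumes "S \<in> \<T>" "T \<in> \<T>" "x \<in> S" "x \<in> T"
  shows "nodal_coord S i x = nodal_coord T i x"
proof -
  let ?D = "vertices S \<inter> vertices T"
  interpret S: affine_basis "vertices S" using basis_T assms by auto
  interpret T: affine_basis "vertices T" using basis_T assms by auto
  have x: "x \<in> convex hull ?D" using Int_T[OF assms(1,2)] assms by auto
  obtain u where u: "sum u ?D = 1" "(\<Sum>w\<in>?D. u w *\<^sub>R w) = x"
      "\<And>v. v \<in> vertices S \<Longrightarrow> bary (vertices S) v x = (if v \<in> ?D then u v else 0)"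
    using S.bary_face[OF _ x] by auto
  obtain u' where u': "\<And>v. v \<in> vertices T \<Longrightarrow> bary (vertices T) v x = (if v \<in> ?D then u' v else 0)"
    using T.bary_face[OF _ x] by auto
  have "bary (vertices T) v x = u v" if "v \<in> ?D" for v
  proof -
    have "bary (vertices T) v x = (\<Sum>w\<in>?D. u w * bary (vertices T) v w)"
      using T.bary_combination[of v ?D u "\<lambda>w. w"] u(1,2) that S.finite_C by auto
    also have "\<dots> = (\<Sum>w\<in>?D. if w = v then u w else 0)"
      using that by (intro sum.cong refl) (auto simp: T.bary_vertex)
    finally show ?thesis using that S.finite_C by simp
  qed
  then show ?thesis using u(3)[of i] u'[of i] by (auto simp: nodal_coord_def)
qed

lemma nodal_coord_polynomials:
  assumes "T \<in> \<T>"
  shows "nodal_coord T i \<in> polynomials 1"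
proof (cases "i \<in> vertices T")
  case True
  then have "nodal_coord T i = bary (vertices T) i" by (simp add: nodal_coord_def fun_eq_iff)
  then show ?thesis using affine_basis.bary_polynomials[OF basis_T[OF assms] True] by simp
next
  case False
  then have "nodal_coord T i = (\<lambda>x. 0)" by (simp add: nodal_coord_def fun_eq_iff)
  then show ?thesis using const_polynomials by simp
qed

lemma continuous_on_pieces:
  assumes "\<S> \<subseteq> \<T>" "\<And>T. T \<in> \<S> \<Longrightarrow> continuous_on T f"
  shows "continuous_on (\<Union>\<S>) f"
  using continuous_on_closed_Union[of \<S> "\<lambda>T. T" f] assms closed_T finite_T finite_subset[of \<S> \<T>]
  by auto

text \<open>Continuity is automatic: \<open>v\<close> is a single function, continuous on each of
  finitely many closed pieces.\<close>

lemma pw_polynomialsI: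
  assumes "\<S> \<subseteq> \<T>" "\<And>x. x \<notin> \<Union>\<S> \<Longrightarrow> v x = 0"
    and "\<And>T. T \<in> \<S> \<Longrightarrow> \<exists>p\<in>polynomials k. \<forall>x\<in>T. v x = p x"
  shows "v \<in> pw_polynomials k \<S>"
proof -
  have "continuous_on T v" if "T \<in> \<S>" for T
    using assms(3)[OF that] continuous_on_polynomials continuous_on_cong by metis
  then show ?thesis
    unfolding pw_polynomials_def using assms continuous_on_pieces[OF assms(1)] by blast
qed

text \<open>Candidate for the definite description \<open>hat\<close>; by
  \<open>nodal_coord_agree\<close> the chosen simplex does not matter.\<close>

definition hat_fun :: "'a \<Rightarrow> 'a \<Rightarrow> real" where
  "hat_fun i x = (if \<exists>T\<in>\<T>. x \<in> T then nodal_coord (SOME T. T \<in> \<T> \<and> x \<in> T) i x else 0)"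

lemma
  shows hat_fun_eq: "T \<in> \<T> \<Longrightarrow> x \<in> T \<Longrightarrow> hat_fun i x = nodal_coord T i x"
    and hat_fun_pw_polynomial: "hat_fun i \<in> pw_polynomials 1 \<T>"
    and hat_fun_node: "j \<in> nodes \<T> \<Longrightarrow> hat_fun i j = (if i = j then 1 else 0)"
proof -
  have eq: "hat_fun i x = nodal_coord T i x" if "T \<in> \<T>" "x \<in> T" for T x
  proof -
    have "(SOME T. T \<in> \<T> \<and> x \<in> T) \<in> \<T> \<and> x \<in> (SOME T. T \<in> \<T> \<and> x \<in> T)"
      using that someI_ex[of "\<lambda>T. T \<in> \<T> \<and> x \<in> T"] by auto
    then show ?thesis
      using nodal_coord_agree[of "SOME T. T \<in> \<T> \<and> x \<in> T" T x] that by (auto simp: hat_fun_def)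
  qed
  then show "T \<in> \<T> \<Longrightarrow> x \<in> T \<Longrightarrow> hat_fun i x = nodal_coord T i x" .
  have "hat_fun i \<in> pw_polynomials 1 \<T>"
  proof (rule pw_polynomialsI)
    show "hat_fun i x = 0" if "x \<notin> \<Union>\<T>" for x using that by (auto simp: hat_fun_def)
    show "\<exists>p\<in>polynomials 1. \<forall>x\<in>T. hat_fun i x = p x" if "T \<in> \<T>" for T
      using eq nodal_coord_polynomials that by blast
  qed simp
  then show "hat_fun i \<in> pw_polynomials 1 \<T>" .
  show "hat_fun i j = (if i = j then 1 else 0)" if j: "j \<in> nodes \<T>"
  proof -
    obtain T where T: "T \<in> \<T>" "j \<in> vertices T" using j by (auto simp: nodes_def)
    interpret affine_basis "vertices T" using basis_T[OF T(1)] .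
    have "hat_fun i j = nodal_coord T i j" using eq T vertices_subset by blast
    then show ?thesis using T(2) by (auto simp: nodal_coord_def bary_vertex)
  qed
qed

text \<open>An affine function on a simplex is determined by its vertex values, and off the
  triangulation both functions are 0 by the encoding.\<close>

lemma pw_polynomial_1_unique:
  assumes "f \<in> pw_polynomials 1 \<T>" "g \<in> pw_polynomials 1 \<T>" "\<And>j. j \<in> nodes \<T> \<Longrightarrow> f j = g j"
  shows "f = g"
proof
  fix x
  show "f x = g x"
  proof (cases "x \<in> \<Union>\<T>")
    case True
    then obtain T where T: "T \<in> \<T>" "x \<in> T" by blast
    interpret affine_basis "vertices T" using basis_T[OF T(1)] .
    obtain p where p: "p \<in> polynomials 1" "\<And>x. x \<in> T \<Longrightarrow> f x = p x"
      using pw_polynomialsD[OF assms(1) T(1)] by blast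
    obtain q where q: "q \<in> polynomials 1" "\<And>x. x \<in> T \<Longrightarrow> g x = q x"
      using pw_polynomialsD[OF assms(2) T(1)] by blast
    have eq: "p v = q v" if "v \<in> vertices T" for v
    proof -
      have "v \<in> T" "v \<in> nodes \<T>" using that vertices_subset vertices_nodes T(1) by blast+
      then show ?thesis using p(2)[of v] q(2)[of v] assms(3)[of v] by simp
    qed
    have "f x = (\<Sum>v\<in>vertices T. p v * bary (vertices T) v x)"
      using p(2)[OF T(2)] polynomial_1_eq[OF p(1)] by metis
    also have "\<dots> = (\<Sum>v\<in>vertices T. q v * bary (vertices T) v x)"
      using eq by (intro sum.cong) auto
    also have "\<dots> = g x" using q(2)[OF T(2)] polynomial_1_eq[OF q(1)] by metis
    finally show ?thesis .
  next
    case False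
    then show ?thesis using assms(1,2) by (simp add: pw_polynomials_def)
  qed
qed

lemma
  shows hat_pw_polynomial: "hat \<T> i \<in> pw_polynomials 1 \<T>"
    and hat_eq: "\<And>T x. T \<in> \<T> \<Longrightarrow> x \<in> T \<Longrightarrow> hat \<T> i x = nodal_coord T i x"
    and hat_outside: "\<And>x. x \<notin> \<Union>\<T> \<Longrightarrow> hat \<T> i x = 0"
proof -
  have "hat \<T> i = hat_fun i"
    unfolding hat_def
  proof (rule the_equality)
    show "hat_fun i \<in> pw_polynomials 1 \<T> \<and> (\<forall>j\<in>nodes \<T>. hat_fun i j = (if i = j then 1 else 0))"
      using hat_fun_pw_polynomial hat_fun_node by blast
    then show "f = hat_fun i"
      if "f \<in> pw_polynomials 1 \<T> \<and> (\<forall>j\<in>nodes \<T>. f j = (if i = j then 1 else 0))" for f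
      using that by (intro pw_polynomial_1_unique) auto
  qed
  then show "hat \<T> i \<in> pw_polynomials 1 \<T>"
    and "\<And>T x. T \<in> \<T> \<Longrightarrow> x \<in> T \<Longrightarrow> hat \<T> i x = nodal_coord T i x"
    and "\<And>x. x \<notin> \<Union>\<T> \<Longrightarrow> hat \<T> i x = 0"
    using hat_fun_pw_polynomial[of i] hat_fun_eq by (auto simp: pw_polynomials_def)
qed

lemma hat_nonneg: "0 \<le> hat \<T> i x"
proof (cases "x \<in> \<Union>\<T>")
  case True
  then obtain T where T: "T \<in> \<T>" "x \<in> T" by blast
  interpret affine_basis "vertices T" using basis_T[OF T(1)] .
  show ?thesis using hat_eq[OF T] T(2) hull_T[OF T(1)] convex_hull_bary
    by (auto simp: nodal_coord_def)
qed (simp add: hat_outside)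

lemma hat_pos:
  assumes "i \<in> nodes \<T>" "T \<in> patch \<T> i" "x \<in> interior T"
  shows "0 < hat \<T> i x"
proof -
  have T: "T \<in> \<T>" "i \<in> vertices T" using assms(1,2) patch_iff by auto
  interpret affine_basis "vertices T" using basis_T[OF T(1)] .
  have "x \<in> T" using assms(3) interior_subset by blast
  then show ?thesis using hat_eq[OF T(1)] T(2) hull_T[OF T(1)] interior_convex_hull_bary assms(3)
    by (auto simp: nodal_coord_def)
qed

lemma hat_eq_0:
  assumes "i \<in> nodes \<T>" "x \<notin> \<Union>(patch \<T> i)"
  shows "hat \<T> i x = 0"
proof (cases "x \<in> \<Union>\<T>")
  case True
  then obtain T where T: "T \<in> \<T>" "x \<in> T" by blast
  then have "i \<notin> vertices T" using assms patch_iff by blast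
  then show ?thesis using hat_eq[OF T] by (simp add: nodal_coord_def)
qed (simp add: hat_outside)

text \<open>Reduces global sums to one simplex: the hat function of a node that is not a vertex of
  \<open>T\<close> vanishes on \<open>T\<close>.\<close>

lemma sum_hat_mult:
  assumes "T \<in> \<T>" "x \<in> T"
  shows "(\<Sum>i\<in>nodes \<T>. hat \<T> i x * f i) = (\<Sum>i\<in>vertices T. bary (vertices T) i x * f i)"
proof -
  have "(\<Sum>i\<in>nodes \<T>. hat \<T> i x * f i) = (\<Sum>i\<in>vertices T. hat \<T> i x * f i)"
    using vertices_nodes[OF assms(1)] finite_nodes hat_eq[OF assms]
    by (intro sum.mono_neutral_right) (auto simp: nodal_coord_def)
  also have "\<dots> = (\<Sum>i\<in>vertices T. bary (vertices T) i x * f i)"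
    using vertices_nodes[OF assms(1)] hat_eq[OF assms]
    by (intro sum.cong) (auto simp: nodal_coord_def)
  finally show ?thesis .
qed

lemma sum_hat:
  assumes "x \<in> \<Union>\<T>"
  shows "(\<Sum>i\<in>nodes \<T>. hat \<T> i x) = 1"
proof -
  obtain T where T: "T \<in> \<T>" "x \<in> T" using assms by blast
  interpret affine_basis "vertices T" using basis_T[OF T(1)] .
  show ?thesis using sum_hat_mult[OF T, of "\<lambda>_. 1"] sum_bary[of x] by simp
qed

text \<open>On simplices outside the patch the hat function vanishes, which hides the jump of the
  zero extension \<open>w\<close>.\<close>

lemma hat_mult_pw_polynomial:
  assumes i: "i \<in> nodes \<T>" and w: "w \<in> pw_polynomials k (patch \<T> i)"
  shows "(\<lambda>x. hat \<T> i x * w x) \<in> pw_polynomials (Suc k) \<T>"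
proof (rule pw_polynomialsI)
  show "hat \<T> i x * w x = 0" if "x \<notin> \<Union>\<T>" for x using hat_outside[OF that] by simp
  show "\<exists>p\<in>polynomials (Suc k). \<forall>x\<in>T. hat \<T> i x * w x = p x" if T: "T \<in> \<T>" for T
  proof (cases "T \<in> patch \<T> i")
    case True
    then obtain p where "p \<in> polynomials k" "\<forall>x\<in>T. w x = p x"
      using w by (auto simp: pw_polynomials_def)
    then show ?thesis
      using polynomials_mult[OF nodal_coord_polynomials[OF T, of i], of p k] hat_eq[OF T] by auto
  next
    case False
    then have "i \<notin> vertices T" using patch_iff i T by auto
    then have "\<forall>x\<in>T. hat \<T> i x * w x = 0" using hat_eq[OF T] by (simp add: nodal_coord_def)
    then show ?thesis by (intro bexI[OF _ const_polynomials[of 0]])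
  qed
qed simp

lemma pw_polynomials_restrict:
  assumes "v \<in> pw_polynomials k \<T>" "\<S> \<subseteq> \<T>"
  shows "(\<lambda>x. if x \<in> \<Union>\<S> then v x else 0) \<in> pw_polynomials k \<S>"
proof (rule pw_polynomialsI[OF assms(2)])
  show "\<exists>p\<in>polynomials k. \<forall>x\<in>T. (if x \<in> \<Union>\<S> then v x else 0) = p x" if T: "T \<in> \<S>" for T
  proof -
    obtain p where "p \<in> polynomials k" "\<And>x. x \<in> T \<Longrightarrow> v x = p x"
      using pw_polynomialsD[OF assms(1)] T assms(2) by blast
    then show ?thesis using T by (intro bexI[of _ p]) auto
  qed
qed simp

end

section \<open>Integration over the domain and the local projections\<close>

context triangulated_domain
begin

lemma open_domain: "open \<Omega>" and domain_nonempty: "\<Omega> \<noteq> {}" and connected_domain: "connected \<Omega>"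
  using domain by (auto simp: bounded_polyhedral_domain_def)

text \<open>The triangulation covers the closure of \<open>\<Omega>\<close>. That the interiors stay
  in \<open>\<Omega>\<close> itself uses that the domain has no slits: it is the interior of a
  closed set.\<close>

lemma interior_T_subset:
  assumes "T \<in> \<T>"
  shows "interior T \<subseteq> \<Omega>"
proof -
  obtain \<P> where P: "finite \<P>" "\<forall>P\<in>\<P>. polytope P" "\<Omega> = interior (\<Union>\<P>)"
    using domain by (auto simp: bounded_polyhedral_domain_def)
  then have "closed (\<Union>\<P>)" by (intro closed_Union) (auto intro: polytope_imp_closed)
  then have "closure \<Omega> \<subseteq> \<Union>\<P>" using P(3) interior_subset by (metis closure_minimal)
  then have "T \<subseteq> \<Union>\<P>" using assms Union_T by blast
  then show ?thesis using P(3) interior_mono by blast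
qed

lemma domain_subset: "\<Omega> \<subseteq> \<Union>\<T>"
  using closure_subset[of \<Omega>] Union_T by simp

lemma compact_Union: "compact (\<Union>\<T>)"
  using finite_T compact_T by (rule compact_Union)

lemma lmeasurable_domain: "\<Omega> \<in> lmeasurable"
  using bounded_subset[OF compact_imp_bounded[OF compact_Union] domain_subset] open_domain
  by (rule lmeasurable_open)

lemma domain_sets [simp]: "\<Omega> \<in> sets lebesgue" "\<Omega> \<inter> space lebesgue \<in> sets lebesgue"
  using lmeasurable_domain by (auto simp: fmeasurable_def)

lemma finite_measure_domain: "finite_measure (lebesgue_on \<Omega>)"
  using finite_measure_lebesgue_on[OF lmeasurable_domain] .

lemma AE_domain_iff: "(AE x in lebesgue_on \<Omega>. P x) \<longleftrightarrow> (AE x in lebesgue. x \<in> \<Omega> \<longrightarrow> P x)"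
  by (rule AE_restrict_space_iff) simp

lemma AE_not_frontier: "AE x in lebesgue. \<forall>T\<in>\<T>. x \<notin> frontier T"
proof (rule AE_finite_allI[OF finite_T])
  fix T assume "T \<in> \<T>"
  then have "frontier T \<in> null_sets lebesgue"
    using negligible_convex_frontier[OF convex_T] negligible_iff_null_sets by blast
  then show "AE x in lebesgue. x \<notin> frontier T" by (rule AE_not_in)
qed

lemma mem_T_interior: "T \<in> \<T> \<Longrightarrow> x \<notin> frontier T \<Longrightarrow> x \<in> T \<Longrightarrow> x \<in> interior T"
  using closure_subset[of T] by (auto simp: frontier_def)

text \<open>A face that meets the interior is the whole simplex; hence different simplices overlap
  in frontiers only.\<close>

lemma subset_if_meets_interior:
  assumes "S \<in> \<T>" "T \<in> \<T>" "x \<in> S" "x \<in> interior T"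
  shows "T \<subseteq> S"
proof -
  have "(T \<inter> S) face_of T" using face_T assms by simp
  moreover have "x \<in> (T \<inter> S) \<inter> interior T" using assms interior_subset by blast
  ultimately have "T \<inter> S = T" using face_of_disjoint_interior by blast
  then show ?thesis by blast
qed

text \<open>Off the null set of all frontiers, each point of \<open>\<Omega>\<close> lies in exactly
  one simplex and each point outside in none. The right side uses \<open>lborel\<close> because the
  moments of a simplex are computed there.\<close>

lemma
  fixes f :: "'a \<Rightarrow> real"
  assumes "\<And>T. T \<in> \<T> \<Longrightarrow> continuous_on T f"
  shows integrable_domain: "integrable (lebesgue_on \<Omega>) f"
    and integral_domain: "integral\<^sup>L (lebesgue_on \<Omega>) f = (\<Sum>T\<in>\<T>. \<integral>x. indicator T x * f x \<partial>lborel)"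
proof -
  have int: "integrable lborel (\<lambda>x. indicator T x * f x)" if "T \<in> \<T>" for T
    using borel_integrable_compact[OF compact_T[OF that], of f] assms[OF that] by simp
  then have sum_int: "integrable lborel (\<lambda>x. \<Sum>T\<in>\<T>. indicator T x * f x)"
    by (rule Bochner_Integration.integrable_sum)
  have sum_meas: "(\<lambda>x. \<Sum>T\<in>\<T>. indicator T x * f x) \<in> borel_measurable lborel"
    using sum_int by (rule borel_measurable_integrable)
  have "f \<in> borel_measurable (lebesgue_on \<Omega>)"
    using continuous_on_pieces[OF order_refl assms] domain_subset
    by (intro continuous_imp_measurable_on_sets_lebesgue) (auto intro: continuous_on_subset)
  then have meas: "(\<lambda>x. indicator \<Omega> x *\<^sub>R f x) \<in> borel_measurable lebesgue"
    by (subst (asm) borel_measurable_restrict_space_iff) auto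
  have ae: "AE x in lebesgue. (\<Sum>T\<in>\<T>. indicator T x * f x) = indicator \<Omega> x *\<^sub>R f x"
    using AE_not_frontier
  proof eventually_elim
    case (elim x)
    show ?case
    proof (cases "x \<in> \<Omega>")
      case True
      then obtain S where S: "S \<in> \<T>" "x \<in> S" using domain_subset by blast
      have uniq: "T = S" if T: "T \<in> \<T>" "x \<in> T" for T
      proof -
        have "x \<in> interior S" "x \<in> interior T" using mem_T_interior elim T S by auto
        then show ?thesis
          using subset_if_meets_interior[OF T(1) S(1) T(2)] subset_if_meets_interior[OF S(1) T(1) S(2)] by auto
      qed
      have "(\<Sum>T\<in>\<T>. indicator T x * f x) = (\<Sum>T\<in>\<T>. if T = S then f x else 0)"
      proof (rule sum.cong[OF refl])
        fix T assume "T \<in> \<T>"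
        then show "indicator T x * f x = (if T = S then f x else 0)"
          using uniq[of T] S(2) by (cases "x \<in> T") auto
      qed
      then show ?thesis using True S finite_T by simp
    next
      case False
      then have "x \<notin> T" if "T \<in> \<T>" for T
        using mem_T_interior[OF that] interior_T_subset[OF that] elim that by blast
      then show ?thesis using False by (simp add: indicator_def)
    qed
  qed
  have leb: "integrable lebesgue (\<lambda>x. \<Sum>T\<in>\<T>. indicator T x * f x)"
    using sum_int sum_meas by (simp add: integrable_completion)
  then show "integrable (lebesgue_on \<Omega>) f"
    unfolding integrable_restrict_space[OF domain_sets(2)]
    using integrable_cong_AE_imp[OF leb meas] ae by (auto elim: eventually_mono)
  have "integral\<^sup>L (lebesgue_on \<Omega>) f = (\<integral>x. indicator \<Omega> x *\<^sub>R f x \<partial>lebesgue)"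
    by (rule integral_restrict_space) simp
  also have "\<dots> = (\<integral>x. (\<Sum>T\<in>\<T>. indicator T x * f x) \<partial>lebesgue)"
    using ae leb meas by (intro integral_cong_AE) (auto elim: eventually_mono)
  also have "\<dots> = (\<integral>x. (\<Sum>T\<in>\<T>. indicator T x * f x) \<partial>lborel)"
    using sum_meas by (simp add: integral_completion)
  also have "\<dots> = (\<Sum>T\<in>\<T>. \<integral>x. indicator T x * f x \<partial>lborel)"
    using int by (rule Bochner_Integration.integral_sum)
  finally show "integral\<^sup>L (lebesgue_on \<Omega>) f = (\<Sum>T\<in>\<T>. \<integral>x. indicator T x * f x \<partial>lborel)" .
qed

text \<open>\<open>\<bar>u x\<bar> \<le> 1 + (u x)\<^sup>2\<close> provides an integrable bound on a
  domain of finite measure, as \<open>g\<close> is bounded on the compact set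
  \<open>\<Union>\<T>\<close>.\<close>

lemma integrable_L2_mult:
  assumes u: "u \<in> L2 \<Omega>" and g: "\<And>T. T \<in> \<T> \<Longrightarrow> continuous_on T g"
  shows "integrable (lebesgue_on \<Omega>) (\<lambda>x. u x * g x)"
proof -
  interpret finite_measure "lebesgue_on \<Omega>" by (rule finite_measure_domain)
  have cont: "continuous_on (\<Union>\<T>) g" using continuous_on_pieces[OF order_refl g] by blast
  then have "bounded (g ` \<Union>\<T>)" using compact_Union compact_continuous_image compact_imp_bounded by blast
  then obtain B where B: "\<And>x. x \<in> \<Union>\<T> \<Longrightarrow> norm (g x) \<le> B" unfolding bounded_iff by blast
  have [measurable]: "u \<in> borel_measurable (lebesgue_on \<Omega>)" using u by (simp add: L2_def)
  have [measurable]: "g \<in> borel_measurable (lebesgue_on \<Omega>)"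
    using cont domain_subset
    by (intro continuous_imp_measurable_on_sets_lebesgue) (auto intro: continuous_on_subset)
  have "integrable (lebesgue_on \<Omega>) (\<lambda>x. (1 + (u x)\<^sup>2) * B)"
    using u by (auto simp: L2_def)
  then show ?thesis
  proof (rule Bochner_Integration.integrable_bound)
    show "AE x in lebesgue_on \<Omega>. norm (u x * g x) \<le> norm ((1 + (u x)\<^sup>2) * B)"
    proof (rule AE_I2)
      fix x assume "x \<in> space (lebesgue_on \<Omega>)"
      then have "x \<in> \<Union>\<T>" using domain_subset by auto
      then have gB: "\<bar>g x\<bar> \<le> B" using B by fastforce
      have "\<bar>u x\<bar> \<le> 1 + (u x)\<^sup>2"
        using zero_le_power2[of "\<bar>u x\<bar> - 1"] abs_ge_zero[of "u x"]
        unfolding power2_diff power2_abs power_one mult_1_right by linarith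
      then have "\<bar>u x\<bar> * \<bar>g x\<bar> \<le> (1 + (u x)\<^sup>2) * B" using gB by (intro mult_mono) auto
      also have "\<dots> \<le> norm ((1 + (u x)\<^sup>2) * B)" by simp
      finally show "norm (u x * g x) \<le> norm ((1 + (u x)\<^sup>2) * B)" by (simp add: abs_mult)
    qed
  qed measurable
qed

lemma continuous_on_pw_polynomial:
  assumes "v \<in> pw_polynomials k \<S>" "T \<in> \<S>"
  shows "continuous_on T v"
  using assms by (auto simp: pw_polynomials_def intro: continuous_on_subset)

lemma pw_polynomial_L2:
  assumes "v \<in> pw_polynomials k \<T>"
  shows "v \<in> L2 \<Omega>"
proof -
  have "continuous_on (\<Union>\<T>) v" using assms by (simp add: pw_polynomials_def)
  then have "v \<in> borel_measurable (lebesgue_on \<Omega>)"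
    using domain_subset by (intro continuous_imp_measurable_on_sets_lebesgue) (auto intro: continuous_on_subset)
  moreover have "integrable (lebesgue_on \<Omega>) (\<lambda>x. (v x)\<^sup>2)"
    using continuous_on_pw_polynomial[OF assms] by (intro integrable_domain continuous_intros)
  ultimately show ?thesis by (simp add: L2_def)
qed

text \<open>The points of the interior with \<open>f x \<noteq> 0\<close> form an open null set,
  hence none exist, and the interior is dense in \<open>T\<close>. This turns statements about
  almost every point into equality of functions.\<close>

lemma AE_zero_imp_zero:
  assumes T: "T \<in> \<T>" and f: "continuous_on T f"
    and ae: "AE x in lebesgue_on \<Omega>. x \<in> interior T \<longrightarrow> f x = (0::real)" and x: "x \<in> T"
  shows "f x = 0"
proof -
  let ?S = "{x \<in> interior T. f x \<in> - {0}}"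
  have "AE x in lebesgue. x \<notin> ?S"
    using ae unfolding AE_domain_iff
    by eventually_elim (use interior_T_subset[OF T] in auto)
  moreover have op: "open ?S"
    using continuous_on_subset[OF f interior_subset]
    by (intro continuous_open_preimage[unfolded vimage_def Int_def mem_Collect_eq] open_interior) auto
  ultimately have "?S \<in> null_sets lebesgue"
    by (subst (asm) AE_iff_null_sets[symmetric]) auto
  then have "?S = {}"
    using open_not_negligible[OF op] negligible_iff_null_sets by blast
  moreover have "closure (interior T) = T"
    using convex_closure_interior[OF convex_T int_T_nonempty] T closed_T closure_closed by metis
  ultimately show ?thesis
    using continuous_constant_on_closure[of "interior T" f 0 x] f x by auto
qed

lemma continuous_on_hat_mult:
  assumes i: "i \<in> nodes \<T>" and g: "\<And>T. T \<in> patch \<T> i \<Longrightarrow> continuous_on T g" and T: "T \<in> \<T>"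
  shows "continuous_on T (\<lambda>x. hat \<T> i x * g x)"
proof (cases "T \<in> patch \<T> i")
  case True
  then show ?thesis
    using g continuous_on_pw_polynomial[OF hat_pw_polynomial T] by (intro continuous_intros) auto
next
  case False
  then have "i \<notin> vertices T" using patch_iff i T by auto
  then have "hat \<T> i x * g x = 0" if "x \<in> T" for x
    using hat_eq[OF T that] by (simp add: nodal_coord_def)
  then show ?thesis by (intro continuous_on_eq[OF continuous_on_const[of T 0]]) simp
qed

lemma weighted_inner_eq: "weighted_inner \<Omega> \<T> i u v = (\<integral>x. hat \<T> i x * u x * v x \<partial>lebesgue_on \<Omega>)"
  by (simp add: weighted_inner_def L2_inner_def)

lemma weighted_inner_commute: "weighted_inner \<Omega> \<T> i u v = weighted_inner \<Omega> \<T> i v u"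
  by (simp add: weighted_inner_eq mult.assoc mult.left_commute mult.commute)

lemma weighted_inner_scale: "weighted_inner \<Omega> \<T> i (\<lambda>x. c * u x) v = c * weighted_inner \<Omega> \<T> i u v"
proof -
  have "weighted_inner \<Omega> \<T> i (\<lambda>x. c * u x) v = (\<integral>x. c * (hat \<T> i x * u x * v x) \<partial>lebesgue_on \<Omega>)"
    by (simp add: weighted_inner_eq algebra_simps)
  then show ?thesis by (simp add: weighted_inner_eq)
qed

text \<open>Treats at once the data from \<open>L2 \<Omega>\<close> and the elements of the patch
  spaces, for which continuity is available only on the simplices of the patch.\<close>

definition weightable :: "'a \<Rightarrow> ('a \<Rightarrow> real) set" where
  "weightable i = L2 \<Omega> \<union> {u. \<forall>T\<in>patch \<T> i. continuous_on T u}"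

lemma weighted_integrable:
  assumes i: "i \<in> nodes \<T>" and "u \<in> weightable i" and v: "\<And>T. T \<in> patch \<T> i \<Longrightarrow> continuous_on T v"
  shows "integrable (lebesgue_on \<Omega>) (\<lambda>x. hat \<T> i x * u x * v x)"
proof -
  consider "u \<in> L2 \<Omega>" | "\<forall>T\<in>patch \<T> i. continuous_on T u"
    using assms(2) by (auto simp: weightable_def)
  then show ?thesis
  proof cases
    case 1
    then show ?thesis
      using integrable_L2_mult[OF 1 continuous_on_hat_mult[OF i v]] by (simp add: algebra_simps)
  next
    case 2
    have "integrable (lebesgue_on \<Omega>) (\<lambda>x. hat \<T> i x * (u x * v x))"
      using 2 v by (intro integrable_domain continuous_on_hat_mult[OF i] continuous_intros) auto
    then show ?thesis by (simp add: mult.assoc)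
  qed
qed

lemma weighted_inner_add:
  assumes i: "i \<in> nodes \<T>" and "u \<in> weightable i" "w \<in> weightable i"
    and v: "\<And>T. T \<in> patch \<T> i \<Longrightarrow> continuous_on T v"
  shows "weighted_inner \<Omega> \<T> i (\<lambda>x. u x + w x) v = weighted_inner \<Omega> \<T> i u v + weighted_inner \<Omega> \<T> i w v"
proof -
  have "weighted_inner \<Omega> \<T> i (\<lambda>x. u x + w x) v =
      (\<integral>x. hat \<T> i x * u x * v x + hat \<T> i x * w x * v x \<partial>lebesgue_on \<Omega>)"
    by (simp add: weighted_inner_eq algebra_simps)
  then show ?thesis
    using weighted_integrable[OF i _ v] assms(2,3)
    by (simp add: weighted_inner_eq Bochner_Integration.integral_add)
qed

lemma weightable_pw [simp]: "v \<in> pw_polynomials k (patch \<T> i) \<Longrightarrow> v \<in> weightable i"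
  using continuous_on_pw_polynomial by (auto simp: weightable_def)

lemma weightable_L2 [simp]: "v \<in> L2 \<Omega> \<Longrightarrow> v \<in> weightable i"
  by (auto simp: weightable_def)

lemma weighted_inner_nonneg: "0 \<le> weighted_inner \<Omega> \<T> i u u"
  unfolding weighted_inner_eq
  by (rule Bochner_Integration.integral_nonneg) (simp add: hat_nonneg mult.assoc)

text \<open>The weight vanishes on the faces opposite \<open>i\<close> but is positive in the
  interior of every simplex of the patch, which is enough for a continuous \<open>w\<close>.\<close>

lemma weighted_inner_definite:
  assumes i: "i \<in> nodes \<T>" and w: "w \<in> pw_polynomials k (patch \<T> i)"
    and 0: "weighted_inner \<Omega> \<T> i w w = 0"
  shows "w = (\<lambda>x. 0)"
proof
  fix x
  note cw = continuous_on_pw_polynomial[OF w]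
  have "AE x in lebesgue_on \<Omega>. hat \<T> i x * w x * w x = 0"
    using 0 weighted_integrable[OF i weightable_pw[OF w] cw] hat_nonneg
    unfolding weighted_inner_eq
    by (subst (asm) integral_nonneg_eq_0_iff_AE) (auto simp: mult.assoc)
  then have ae: "AE x in lebesgue_on \<Omega>. x \<in> interior T \<longrightarrow> w x = 0" if "T \<in> patch \<T> i" for T
    by eventually_elim (use hat_pos[OF i that] in force)
  show "w x = 0"
  proof (cases "x \<in> \<Union>(patch \<T> i)")
    case True
    then obtain T where T: "T \<in> patch \<T> i" "x \<in> T" by blast
    then show ?thesis using AE_zero_imp_zero[OF _ cw[OF T(1)] ae[OF T(1)]] patch_iff[OF i] by blast
  next
    case False
    then show ?thesis using w by (simp add: pw_polynomials_def)
  qed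
qed

lemma finite_patch: "finite (patch \<T> i)" and patch_subset: "patch \<T> i \<subseteq> \<T>"
  using finite_T by (auto simp: patch_def)

text \<open>Uniqueness of the projection, by definiteness applied to the difference of two
  candidates. It reduces later identities for \<open>local_projection\<close> to exhibiting a
  candidate.\<close>

lemma local_projection_eqI:
  assumes i: "i \<in> nodes \<T>" and w: "w \<in> pw_polynomials k (patch \<T> i)"
    and eq: "\<And>v. v \<in> pw_polynomials k (patch \<T> i) \<Longrightarrow> weighted_inner \<Omega> \<T> i w v = weighted_inner \<Omega> \<T> i u v"
  shows "local_projection \<Omega> \<T> k i u = w"
  unfolding local_projection_def
proof (rule the_equality)
  show "w \<in> pw_polynomials k (patch \<T> i) \<and>
      (\<forall>v\<in>pw_polynomials k (patch \<T> i). weighted_inner \<Omega> \<T> i w v = weighted_inner \<Omega> \<T> i u v)"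
    using w eq by blast
  fix w' assume w': "w' \<in> pw_polynomials k (patch \<T> i) \<and>
      (\<forall>v\<in>pw_polynomials k (patch \<T> i). weighted_inner \<Omega> \<T> i w' v = weighted_inner \<Omega> \<T> i u v)"
  let ?d = "\<lambda>x. w' x + (-1) * w x"
  note S = fun_subspaceD[OF subspace_pw_polynomials[of k "patch \<T> i"]]
  have mw: "(\<lambda>x. (-1) * w x) \<in> pw_polynomials k (patch \<T> i)" by (rule S(3)[OF w])
  then have d: "?d \<in> pw_polynomials k (patch \<T> i)" using w' S(2) by blast
  have "weighted_inner \<Omega> \<T> i ?d ?d = weighted_inner \<Omega> \<T> i w' ?d + weighted_inner \<Omega> \<T> i (\<lambda>x. (-1) * w x) ?d"
    using w' mw continuous_on_pw_polynomial[OF d] by (intro weighted_inner_add[OF i]) auto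
  also have "\<dots> = 0" using w' eq[OF d] d by (simp add: weighted_inner_scale[of i "-1", simplified])
  finally have "?d = (\<lambda>x. 0)" using weighted_inner_definite[OF i d] by blast
  then show "w' = w" by (simp add: fun_eq_iff)
qed

text \<open>Existence is the Riesz representation of the functional
  \<open>weighted_inner \<Omega> \<T> i u\<close> on the finite-dimensional patch space.\<close>

lemma
  assumes i: "i \<in> nodes \<T>" and u: "u \<in> weightable i"
  shows local_projection_in: "local_projection \<Omega> \<T> k i u \<in> pw_polynomials k (patch \<T> i)"
    and local_projection_inner: "\<And>v. v \<in> pw_polynomials k (patch \<T> i) \<Longrightarrow>
      weighted_inner \<Omega> \<T> i (local_projection \<Omega> \<T> k i u) v = weighted_inner \<Omega> \<T> i u v"
proof -
  let ?V = "pw_polynomials k (patch \<T> i)"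
  obtain B where B: "finite B" "?V \<subseteq> fun_span B"
    using pw_polynomials_finite_dim[OF finite_patch] by blast
  have "\<exists>w\<in>?V. \<forall>v\<in>?V. weighted_inner \<Omega> \<T> i w v = weighted_inner \<Omega> \<T> i u v"
  proof (rule finite_dim_riesz[where ip = "weighted_inner \<Omega> \<T> i" and l = "weighted_inner \<Omega> \<T> i u",
        OF subspace_pw_polynomials B(2,1)])
    fix v w z assume "v \<in> ?V" "w \<in> ?V" "z \<in> ?V"
    then show "weighted_inner \<Omega> \<T> i (\<lambda>x. v x + w x) z = weighted_inner \<Omega> \<T> i v z + weighted_inner \<Omega> \<T> i w z"
      using continuous_on_pw_polynomial by (intro weighted_inner_add[OF i]) auto
  next
    fix v w assume v: "v \<in> ?V" and w: "w \<in> ?V"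
    then have vw: "(\<lambda>x. v x + w x) \<in> ?V" by (rule fun_subspaceD(2)[OF subspace_pw_polynomials])
    have split: "hat \<T> i x * u x * (v x + w x) = hat \<T> i x * u x * v x + hat \<T> i x * u x * w x" for x
      by (simp add: algebra_simps)
    show "weighted_inner \<Omega> \<T> i u (\<lambda>x. v x + w x) = weighted_inner \<Omega> \<T> i u v + weighted_inner \<Omega> \<T> i u w"
      unfolding weighted_inner_eq split
      using weighted_integrable[OF i u] continuous_on_pw_polynomial[OF v] continuous_on_pw_polynomial[OF w]
      by (intro Bochner_Integration.integral_add) auto
  next
    fix v c
    show "weighted_inner \<Omega> \<T> i u (\<lambda>x. c * v x) = c * weighted_inner \<Omega> \<T> i u v"
      by (metis weighted_inner_commute weighted_inner_scale)
  qed (auto simp: weighted_inner_scale weighted_inner_definite[OF i] intro: weighted_inner_commute)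
  then obtain w where w: "w \<in> ?V" "\<And>v. v \<in> ?V \<Longrightarrow> weighted_inner \<Omega> \<T> i w v = weighted_inner \<Omega> \<T> i u v"
    by blast
  then have "local_projection \<Omega> \<T> k i u = w" by (rule local_projection_eqI[OF i])
  then show "local_projection \<Omega> \<T> k i u \<in> ?V"
    and "\<And>v. v \<in> ?V \<Longrightarrow> weighted_inner \<Omega> \<T> i (local_projection \<Omega> \<T> k i u) v = weighted_inner \<Omega> \<T> i u v"
    using w by auto
qed

end

section \<open>Spectral bounds\<close>

context affine_basis
begin

lemma bary_monomial_remove:
  assumes "i \<in> C"
  shows "bary_monomial (\<beta>(i := n)) x = bary C i x ^ n * (\<Prod>v\<in>C - {i}. bary C v x ^ \<beta> v)"
  unfolding bary_monomial_def by (subst prod.remove[OF finite_C assms]) (auto intro!: prod.cong)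

lemma bary_mult_monomial_pred:
  assumes "i \<in> C"
  shows "bary C i x * (real (\<beta> i) * bary_monomial (\<beta>(i := \<beta> i - 1)) x) = real (\<beta> i) * bary_monomial \<beta> x"
proof (cases "\<beta> i")
  case (Suc n)
  then have "bary_monomial \<beta> x = bary C i x * bary_monomial (\<beta>(i := \<beta> i - 1)) x"
    using bary_monomial_Suc[OF assms, of "\<beta>(i := n)" x] by (simp add: fun_upd_idem)
  then show ?thesis by simp
qed simp

text \<open>Moving from \<open>x\<close> towards \<open>i\<close> changes the coordinates at the
  rate \<open>e\<^sub>i - \<lambda>\<close>, so the derivative of a form is
  \<open>\<partial>\<^sub>i\<close> minus
  \<open>\<Sum>\<^sub>v \<lambda>\<^sub>v \<partial>\<^sub>v\<close>, and by Euler's identity the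
  latter multiplies by \<open>K\<close>.\<close>

lemma bary_monomial_ray_derivative:
  assumes i: "i \<in> C" and \<beta>: "\<beta> \<in> exponents C K"
  shows "((\<lambda>t. bary_monomial \<beta> (x + t *\<^sub>R (i - x))) has_real_derivative
      (real (\<beta> i) * bary_monomial (\<beta>(i := \<beta> i - 1)) x - real K * bary_monomial \<beta> x)) (at 0)"
proof -
  let ?q = "\<Prod>v\<in>C - {i}. bary C v x ^ \<beta> v"
  have "\<beta> i + (\<Sum>v\<in>C - {i}. \<beta> v) = K"
    using \<beta> sum.remove[OF finite_C i, of \<beta>] by (simp add: exponents_def)
  then obtain m where m: "(\<Sum>v\<in>C - {i}. \<beta> v) = m" "K = \<beta> i + m" by blast
  have "bary_monomial \<beta> (x + t *\<^sub>R (i - x)) = (bary C i x + t * (1 - bary C i x)) ^ \<beta> i * ((1 - t) ^ m * ?q)" for t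
  proof -
    have "bary C v (x + t *\<^sub>R (i - x)) = (1 - t) * bary C v x" if "v \<in> C - {i}" for v
      using that i by (auto simp: bary_segment bary_vertex)
    then have "(\<Prod>v\<in>C - {i}. bary C v (x + t *\<^sub>R (i - x)) ^ \<beta> v) = (\<Prod>v\<in>C - {i}. (1 - t) ^ \<beta> v * bary C v x ^ \<beta> v)"
      by (intro prod.cong refl) (simp add: power_mult_distrib)
    also have "\<dots> = (1 - t) ^ m * ?q" by (simp add: prod.distrib m(1) flip: power_sum)
    finally have 1: "(\<Prod>v\<in>C - {i}. bary C v (x + t *\<^sub>R (i - x)) ^ \<beta> v) = (1 - t) ^ m * ?q" .
    have 2: "bary C i (x + t *\<^sub>R (i - x)) = bary C i x + t * (1 - bary C i x)"
      using i by (simp add: bary_segment bary_vertex) (simp add: algebra_simps)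
    show ?thesis
      using bary_monomial_remove[OF i, of \<beta> "\<beta> i" "x + t *\<^sub>R (i - x)"] by (simp add: 1 2)
  qed
  then have eq: "(\<lambda>t. bary_monomial \<beta> (x + t *\<^sub>R (i - x))) =
      (\<lambda>t. (bary C i x + t * (1 - bary C i x)) ^ \<beta> i * ((1 - t) ^ m * ?q))" by blast
  have "((\<lambda>t. (bary C i x + t * (1 - bary C i x)) ^ \<beta> i * ((1 - t) ^ m * ?q)) has_real_derivative
      (real (\<beta> i) * bary C i x ^ (\<beta> i - 1) * (1 - bary C i x) * ?q - bary C i x ^ \<beta> i * (real m * ?q))) (at 0)"
    by (rule derivative_eq_intros refl | simp)+
  moreover have mono: "bary_monomial \<beta> x = bary C i x ^ \<beta> i * ?q"
    using bary_monomial_remove[OF i, of \<beta> "\<beta> i" x] by simp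
  moreover have "real (\<beta> i) * bary C i x ^ (\<beta> i - 1) * (1 - bary C i x) * ?q - bary C i x ^ \<beta> i * (real m * ?q) =
      real (\<beta> i) * bary_monomial (\<beta>(i := \<beta> i - 1)) x - real K * bary_monomial \<beta> x"
    using mono bary_monomial_remove[OF i, of \<beta> "\<beta> i - 1" x]
    by (cases "\<beta> i") (simp_all add: m(2) algebra_simps)
  ultimately show ?thesis unfolding eq by simp
qed

lemma bernstein_euler:
  assumes "1 \<le> K"
  shows "(\<Sum>i\<in>C. bary C i x * ((\<Sum>\<beta>\<in>exponents C K. c \<beta> * real (\<beta> i) * bary_monomial (\<beta>(i := \<beta> i - 1)) x) / real K)) =
    (\<Sum>\<beta>\<in>exponents C K. c \<beta> * bary_monomial \<beta> x)"
proof -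
  have "(\<Sum>i\<in>C. bary C i x * ((\<Sum>\<beta>\<in>exponents C K. c \<beta> * real (\<beta> i) * bary_monomial (\<beta>(i := \<beta> i - 1)) x) / real K)) =
      (\<Sum>i\<in>C. \<Sum>\<beta>\<in>exponents C K. (c \<beta> / real K) * (real (\<beta> i) * bary_monomial \<beta> x))"
    by (intro sum.cong refl) (simp add: bary_mult_monomial_pred[symmetric] sum_divide_distrib sum_distrib_left algebra_simps)
  also have "\<dots> = (\<Sum>\<beta>\<in>exponents C K. \<Sum>i\<in>C. (c \<beta> / real K) * (real (\<beta> i) * bary_monomial \<beta> x))"
    by (rule sum.swap)
  also have "\<dots> = (\<Sum>\<beta>\<in>exponents C K. c \<beta> * bary_monomial \<beta> x)"
  proof (intro sum.cong refl)
    fix \<beta> assume "\<beta> \<in> exponents C K"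
    then have "(\<Sum>i\<in>C. real (\<beta> i)) = real K" by (simp add: exponents_def flip: of_nat_sum)
    moreover have "(\<Sum>i\<in>C. (c \<beta> / real K) * (real (\<beta> i) * bary_monomial \<beta> x)) =
        (c \<beta> / real K) * ((\<Sum>i\<in>C. real (\<beta> i)) * bary_monomial \<beta> x)"
      by (simp only: sum_distrib_left sum_distrib_right)
    ultimately show "(\<Sum>i\<in>C. (c \<beta> / real K) * (real (\<beta> i) * bary_monomial \<beta> x)) = c \<beta> * bary_monomial \<beta> x"
      using assms by simp
  qed
  finally show ?thesis .
qed

lemma bernstein_derivative_polynomial:
  "(\<lambda>x. (\<Sum>\<beta>\<in>exponents C K. c \<beta> * real (\<beta> i) * bary_monomial (\<beta>(i := \<beta> i - 1)) x) / r) \<in> polynomials (K - 1)"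
  if i: "i \<in> C"
proof -
  have "(\<lambda>x. c \<beta> * real (\<beta> i) * bary_monomial (\<beta>(i := \<beta> i - 1)) x) \<in> polynomials (K - 1)"
    if \<beta>: "\<beta> \<in> exponents C K" for \<beta>
  \<comment> \<open>For \<open>\<beta> i = 0\<close> the truncated exponent still has degree
    \<open>K\<close>, but the coefficient vanishes.\<close>
  proof (cases "\<beta> i = 0")
    case True
    then show ?thesis using const_polynomials[of 0] by simp
  next
    case False
    have "sum (\<beta>(i := \<beta> i - 1)) C = K - 1"
      using False \<beta> by (simp add: exponents_def sum.remove[OF finite_C i])
    then show ?thesis
      using bary_monomial_polynomials[of "\<beta>(i := \<beta> i - 1)"]
      by (intro fun_subspaceD(3)[OF subspace_polynomials]) (simp add: bary_monomial_def)
  qed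
  then have "(\<lambda>x. \<Sum>\<beta>\<in>exponents C K. c \<beta> * real (\<beta> i) * bary_monomial (\<beta>(i := \<beta> i - 1)) x) \<in> polynomials (K - 1)"
    by (rule fun_subspace_sum[OF subspace_polynomials])
  from fun_subspaceD(3)[OF subspace_polynomials this, of "inverse r"]
  show ?thesis by (simp add: divide_inverse mult.commute)
qed

end

section \<open>Lifting a piecewise polynomial to the patches\<close>

context triangulated_domain
begin

text \<open>On a simplex, \<open>lift K u i\<close> is \<open>1 / K\<close> times the partial derivative with respect to the
  \<open>i\<close>-th barycentric coordinate of the homogeneous form of \<open>u\<close>. Written as a derivative
  in the direction of the vertex \<open>i\<close> it depends only on the values of \<open>u\<close>, so that the pieces
  fit together along faces containing \<open>i\<close>.\<close>

definition lift :: "nat \<Rightarrow> ('a \<Rightarrow> real) \<Rightarrow> 'a \<Rightarrow> 'a \<Rightarrow> real" where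
  "lift K u i x = (if x \<in> \<Union>(patch \<T> i)
     then u x + vector_derivative (\<lambda>t. u (x + t *\<^sub>R (i - x))) (at 0 within {0..1}) / real K else 0)"

text \<open>By convexity the segment from \<open>x\<close> to \<open>i\<close> stays in
  \<open>T\<close>, so the one-sided derivative sees only the polynomial of \<open>u\<close> on
  \<open>T\<close>. It equals \<open>\<partial>\<^sub>i u - K u\<close>; after division by
  \<open>K\<close>, adding \<open>u\<close> cancels the second term.\<close>

lemma lift_eq:
  assumes K: "1 \<le> K" and i: "i \<in> nodes \<T>" and T: "T \<in> patch \<T> i" "x \<in> T"
    and u: "\<And>x. x \<in> T \<Longrightarrow> u x = (\<Sum>\<beta>\<in>exponents (vertices T) K. c \<beta> * affine_basis.bary_monomial (vertices T) \<beta> x)"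
  shows "lift K u i x = (\<Sum>\<beta>\<in>exponents (vertices T) K.
    c \<beta> * real (\<beta> i) * affine_basis.bary_monomial (vertices T) (\<beta>(i := \<beta> i - 1)) x) / real K"
proof -
  have T': "T \<in> \<T>" "i \<in> vertices T" using T(1) patch_iff[OF i] by auto
  interpret affine_basis "vertices T" using basis_T[OF T'(1)] .
  let ?E = "exponents (vertices T) K"
  let ?D = "\<Sum>\<beta>\<in>?E. c \<beta> * (real (\<beta> i) * bary_monomial (\<beta>(i := \<beta> i - 1)) x - real K * bary_monomial \<beta> x)"
  have "((\<lambda>t. \<Sum>\<beta>\<in>?E. c \<beta> * bary_monomial \<beta> (x + t *\<^sub>R (i - x))) has_real_derivative ?D) (at 0 within {0..1})"
    using bary_monomial_ray_derivative[OF T'(2), THEN has_field_derivative_at_within]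
    by (intro DERIV_sum DERIV_cmult)
  then have "((\<lambda>t. \<Sum>\<beta>\<in>?E. c \<beta> * bary_monomial \<beta> (x + t *\<^sub>R (i - x))) has_vector_derivative ?D) (at 0 within {0..1})"
    by (simp add: has_real_derivative_iff_has_vector_derivative)
  moreover have ray: "u (x + t *\<^sub>R (i - x)) = (\<Sum>\<beta>\<in>?E. c \<beta> * bary_monomial \<beta> (x + t *\<^sub>R (i - x)))"
    if "t \<in> {0..1}" for t
  proof (rule u)
    have "(1 - t) *\<^sub>R x + t *\<^sub>R i \<in> T"
      using convex_T[OF T'(1)] T(2) T'(2) vertices_subset[OF T'(1)] that
      by (intro convexD) auto
    then show "x + t *\<^sub>R (i - x) \<in> T" by (simp add: algebra_simps)
  qed
  ultimately have "((\<lambda>t. u (x + t *\<^sub>R (i - x))) has_vector_derivative ?D) (at 0 within {0..1})"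
    by (intro has_vector_derivative_transform[of 0 "{0..1}" "\<lambda>t. u (x + t *\<^sub>R (i - x))"] ray) auto
  then have "vector_derivative (\<lambda>t. u (x + t *\<^sub>R (i - x))) (at 0 within {0..1}) = ?D"
    by (intro vector_derivative_within_closed_interval) auto
  then have "lift K u i x = (\<Sum>\<beta>\<in>?E. c \<beta> * bary_monomial \<beta> x) + ?D / real K"
    using T u[OF T(2)] by (auto simp: lift_def)
  also have "?D = (\<Sum>\<beta>\<in>?E. c \<beta> * real (\<beta> i) * bary_monomial (\<beta>(i := \<beta> i - 1)) x) -
      real K * (\<Sum>\<beta>\<in>?E. c \<beta> * bary_monomial \<beta> x)"
    by (simp add: sum_subtractf sum_distrib_left algebra_simps)
  finally show ?thesis using K by (simp add: diff_divide_distrib)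
qed

lemma pw_polynomial_coeffs:
  assumes u: "u \<in> pw_polynomials K \<T>" and T: "T \<in> \<T>"
  obtains c where "\<And>x. x \<in> T \<Longrightarrow>
    u x = (\<Sum>\<beta>\<in>exponents (vertices T) K. c \<beta> * affine_basis.bary_monomial (vertices T) \<beta> x)"
proof -
  interpret affine_basis "vertices T" using basis_T[OF T] .
  obtain p where p: "p \<in> polynomials K" "\<And>x. x \<in> T \<Longrightarrow> u x = p x"
    using pw_polynomialsD[OF u T] by blast
  from polynomial_bernstein_coeffs[OF p(1)] obtain c
    where "p = (\<lambda>x. \<Sum>\<beta>\<in>exponents (vertices T) K. c \<beta> * (\<Prod>v\<in>vertices T. bary (vertices T) v x ^ \<beta> v))" .
  then show thesis using p(2) by (intro that[of c]) (simp add: bary_monomial_def)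
qed

text \<open>\<open>lift\<close> is defined without choosing a simplex, so only its polynomial form
  on each simplex has to be checked. Membership in the patch space makes it an admissible test
  function for the local projection.\<close>

lemma lift_pw_polynomial:
  assumes K: "1 \<le> K" and i: "i \<in> nodes \<T>" and u: "u \<in> pw_polynomials K \<T>"
  shows "lift K u i \<in> pw_polynomials (K - 1) (patch \<T> i)"
proof (rule pw_polynomialsI[OF patch_subset])
  show "lift K u i x = 0" if "x \<notin> \<Union>(patch \<T> i)" for x using that by (simp add: lift_def)
  show "\<exists>p\<in>polynomials (K - 1). \<forall>x\<in>T. lift K u i x = p x" if T: "T \<in> patch \<T> i" for T
  proof -
    have T': "T \<in> \<T>" "i \<in> vertices T" using T patch_iff[OF i] by auto
    interpret affine_basis "vertices T" using basis_T[OF T'(1)] .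
    obtain c where "\<And>x. x \<in> T \<Longrightarrow> u x = (\<Sum>\<beta>\<in>exponents (vertices T) K. c \<beta> * bary_monomial \<beta> x)"
      using pw_polynomial_coeffs[OF u T'(1)] by blast
    from lift_eq[OF K i T _ this] show ?thesis
      by (intro bexI[OF _ bernstein_derivative_polynomial[OF T'(2), of c K "real K"]]) simp
  qed
qed

lemma sum_hat_lift:
  assumes K: "1 \<le> K" and u: "u \<in> pw_polynomials K \<T>" and x: "x \<in> \<Union>\<T>"
  shows "(\<Sum>i\<in>nodes \<T>. hat \<T> i x * lift K u i x) = u x"
proof -
  obtain T where T: "T \<in> \<T>" "x \<in> T" using x by blast
  interpret affine_basis "vertices T" using basis_T[OF T(1)] .
  obtain c where c: "\<And>x. x \<in> T \<Longrightarrow> u x = (\<Sum>\<beta>\<in>exponents (vertices T) K. c \<beta> * bary_monomial \<beta> x)"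
    using pw_polynomial_coeffs[OF u T(1)] by blast
  have "(\<Sum>i\<in>nodes \<T>. hat \<T> i x * lift K u i x) = (\<Sum>i\<in>vertices T. bary (vertices T) i x * lift K u i x)"
    by (rule sum_hat_mult[OF T])
  also have "\<dots> = (\<Sum>i\<in>vertices T. bary (vertices T) i x * ((\<Sum>\<beta>\<in>exponents (vertices T) K.
      c \<beta> * real (\<beta> i) * bary_monomial (\<beta>(i := \<beta> i - 1)) x) / real K))"
  proof (intro sum.cong refl arg_cong2[where f = "(*)"])
    fix i assume i: "i \<in> vertices T"
    then have n: "i \<in> nodes \<T>" using vertices_nodes[OF T(1)] by blast
    then show "lift K u i x = (\<Sum>\<beta>\<in>exponents (vertices T) K.
        c \<beta> * real (\<beta> i) * bary_monomial (\<beta>(i := \<beta> i - 1)) x) / real K"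
      using patch_iff[OF n] T i c by (intro lift_eq[OF K n]) auto
  qed
  finally show ?thesis using bernstein_euler[OF K] c[OF T(2)] by simp
qed

text \<open>The nodal energies are rearranged simplex by simplex, where
  \<open>bernstein_derivative_estimate\<close> applies with the same constant everywhere.\<close>

lemma lift_energy:
  assumes K: "1 \<le> K" and u: "u \<in> pw_polynomials K \<T>"
  shows "(\<Sum>i\<in>nodes \<T>. weighted_inner \<Omega> \<T> i (lift K u i) (lift K u i))
    \<le> (2 * real K + real DIM('a)) / real K * L2_inner \<Omega> u u"
proof -
  let ?M = "(2 * real K + real DIM('a)) / real K"
  have cont: "continuous_on T (\<lambda>x. hat \<T> i x * (lift K u i x)\<^sup>2)" if "i \<in> nodes \<T>" "T \<in> \<T>" for i T
    using continuous_on_pw_polynomial[OF lift_pw_polynomial[OF K that(1) u]] that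
    by (intro continuous_on_hat_mult continuous_intros) auto
  have local: "(\<Sum>i\<in>nodes \<T>. \<integral>x. indicator T x * (hat \<T> i x * (lift K u i x)\<^sup>2) \<partial>lborel)
      \<le> ?M * (\<integral>x. indicator T x * (u x)\<^sup>2 \<partial>lborel)" if T: "T \<in> \<T>" for T
  proof -
    interpret affine_basis "vertices T" using basis_T[OF T] .
    let ?E = "exponents (vertices T) K"
    obtain c where c: "\<And>x. x \<in> T \<Longrightarrow> u x = (\<Sum>\<beta>\<in>?E. c \<beta> * bary_monomial \<beta> x)"
      using pw_polynomial_coeffs[OF u T] by blast
    have "(\<Sum>i\<in>nodes \<T>. \<integral>x. indicator T x * (hat \<T> i x * (lift K u i x)\<^sup>2) \<partial>lborel) =
        (\<Sum>i\<in>vertices T. \<integral>x. indicator T x * (hat \<T> i x * (lift K u i x)\<^sup>2) \<partial>lborel)"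
    proof (rule sum.mono_neutral_right[OF finite_nodes vertices_nodes[OF T]], rule ballI)
      fix i assume "i \<in> nodes \<T> - vertices T"
      then have "indicator T x * (hat \<T> i x * (lift K u i x)\<^sup>2) = 0" for x
        using hat_eq[OF T, of x i] by (cases "x \<in> T") (auto simp: nodal_coord_def)
      then show "(\<integral>x. indicator T x * (hat \<T> i x * (lift K u i x)\<^sup>2) \<partial>lborel) = 0"
        by (simp only: Bochner_Integration.integral_zero)
    qed
    also have "\<dots> = (\<Sum>i\<in>vertices T. \<integral>x. indicator T x * (bary (vertices T) i x *
        ((\<Sum>\<beta>\<in>?E. c \<beta> * real (\<beta> i) * bary_monomial (\<beta>(i := \<beta> i - 1)) x) / real K)\<^sup>2) \<partial>lborel)"
    proof (intro sum.cong refl Bochner_Integration.integral_cong)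
      fix i x assume i: "i \<in> vertices T"
      then have n: "i \<in> nodes \<T>" using vertices_nodes[OF T] by blast
      have "lift K u i x = (\<Sum>\<beta>\<in>?E. c \<beta> * real (\<beta> i) * bary_monomial (\<beta>(i := \<beta> i - 1)) x) / real K"
        if "x \<in> T"
        using patch_iff[OF n] T i c that by (intro lift_eq[OF K n]) auto
      then show "indicator T x * (hat \<T> i x * (lift K u i x)\<^sup>2) = indicator T x * (bary (vertices T) i x *
          ((\<Sum>\<beta>\<in>?E. c \<beta> * real (\<beta> i) * bary_monomial (\<beta>(i := \<beta> i - 1)) x) / real K)\<^sup>2)"
        using hat_eq[OF T, of x i] i by (cases "x \<in> T") (auto simp: nodal_coord_def)
    qed
    also have "\<dots> \<le> ?M * (\<integral>x. indicator T x * (\<Sum>\<beta>\<in>?E. c \<beta> * bary_monomial \<beta> x)\<^sup>2 \<partial>lborel)"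
      using bernstein_derivative_estimate[OF K, of c] unfolding hull_T[OF T, symmetric] .
    also have "(\<integral>x. indicator T x * (\<Sum>\<beta>\<in>?E. c \<beta> * bary_monomial \<beta> x)\<^sup>2 \<partial>lborel) =
        (\<integral>x. indicator T x * (u x)\<^sup>2 \<partial>lborel)"
      using c by (intro Bochner_Integration.integral_cong refl) (auto simp: indicator_def)
    finally show ?thesis .
  qed
  have "(\<Sum>i\<in>nodes \<T>. weighted_inner \<Omega> \<T> i (lift K u i) (lift K u i)) =
      (\<Sum>i\<in>nodes \<T>. \<Sum>T\<in>\<T>. \<integral>x. indicator T x * (hat \<T> i x * (lift K u i x)\<^sup>2) \<partial>lborel)"
    using integral_domain[OF cont]
    by (intro sum.cong refl) (simp add: weighted_inner_eq power2_eq_square mult.assoc)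
  also have "\<dots> = (\<Sum>T\<in>\<T>. \<Sum>i\<in>nodes \<T>. \<integral>x. indicator T x * (hat \<T> i x * (lift K u i x)\<^sup>2) \<partial>lborel)"
    by (rule sum.swap)
  also have "\<dots> \<le> (\<Sum>T\<in>\<T>. ?M * (\<integral>x. indicator T x * (u x)\<^sup>2 \<partial>lborel))"
    by (rule sum_mono) (rule local)
  also have "\<dots> = ?M * L2_inner \<Omega> u u"
    using integral_domain[of "\<lambda>x. (u x)\<^sup>2"] continuous_on_pw_polynomial[OF u]
    by (simp add: L2_inner_def power2_eq_square continuous_on_mult sum_distrib_left)
  finally show ?thesis .
qed

end

section \<open>Self-adjointness, reproduction and eigenvalues of the operator\<close>

context triangulated_domain
begin

lemma local_projection_cong:
  assumes i: "i \<in> nodes \<T>" and u: "u \<in> L2 \<Omega>" and v: "v \<in> L2 \<Omega>" and ae: "AE x in lebesgue_on \<Omega>. u x = v x"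
  shows "local_projection \<Omega> \<T> k i u = local_projection \<Omega> \<T> k i v"
proof (rule local_projection_eqI[OF i local_projection_in[OF i weightable_L2[OF v]]])
  fix z assume z: "z \<in> pw_polynomials k (patch \<T> i)"
  note cz = continuous_on_pw_polynomial[OF z]
  have "weighted_inner \<Omega> \<T> i v z = weighted_inner \<Omega> \<T> i u z"
    unfolding weighted_inner_eq
  proof (rule integral_cong_AE)
    show "(\<lambda>x. hat \<T> i x * v x * z x) \<in> borel_measurable (lebesgue_on \<Omega>)"
      "(\<lambda>x. hat \<T> i x * u x * z x) \<in> borel_measurable (lebesgue_on \<Omega>)"
      using weighted_integrable[OF i _ cz] u v by (auto intro: borel_measurable_integrable)
    show "AE x in lebesgue_on \<Omega>. hat \<T> i x * v x * z x = hat \<T> i x * u x * z x"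
      using ae by eventually_elim simp
  qed
  then show "weighted_inner \<Omega> \<T> i (local_projection \<Omega> \<T> k i v) z = weighted_inner \<Omega> \<T> i u z"
    using local_projection_inner[OF i weightable_L2[OF v] z] by simp
qed

lemma local_projection_add:
  assumes i: "i \<in> nodes \<T>" and u: "u \<in> L2 \<Omega>" and v: "v \<in> L2 \<Omega>"
  shows "local_projection \<Omega> \<T> k i (\<lambda>x. u x + v x) =
    (\<lambda>x. local_projection \<Omega> \<T> k i u x + local_projection \<Omega> \<T> k i v x)"
proof (rule local_projection_eqI[OF i])
  note in_V = local_projection_in[OF i weightable_L2[OF u]] local_projection_in[OF i weightable_L2[OF v]]
  show "(\<lambda>x. local_projection \<Omega> \<T> k i u x + local_projection \<Omega> \<T> k i v x) \<in> pw_polynomials k (patch \<T> i)"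
    by (rule fun_subspaceD(2)[OF subspace_pw_polynomials in_V])
  fix z assume z: "z \<in> pw_polynomials k (patch \<T> i)"
  note cz = continuous_on_pw_polynomial[OF z]
  show "weighted_inner \<Omega> \<T> i (\<lambda>x. local_projection \<Omega> \<T> k i u x + local_projection \<Omega> \<T> k i v x) z =
      weighted_inner \<Omega> \<T> i (\<lambda>x. u x + v x) z"
    using weighted_inner_add[OF i weightable_pw[OF in_V(1)] weightable_pw[OF in_V(2)] cz]
      weighted_inner_add[OF i weightable_L2[OF u] weightable_L2[OF v] cz]
      local_projection_inner[OF i weightable_L2[OF u] z] local_projection_inner[OF i weightable_L2[OF v] z]
    by simp
qed

lemma local_projection_scale:
  assumes i: "i \<in> nodes \<T>" and u: "u \<in> L2 \<Omega>"
  shows "local_projection \<Omega> \<T> k i (\<lambda>x. a * u x) = (\<lambda>x. a * local_projection \<Omega> \<T> k i u x)"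
  by (rule local_projection_eqI[OF i fun_subspaceD(3)[OF subspace_pw_polynomials]])
    (use local_projection_in[OF i weightable_L2[OF u]] local_projection_inner[OF i weightable_L2[OF u]]
      in \<open>simp_all add: weighted_inner_scale\<close>)

lemma C_op_cong:
  assumes "u \<in> L2 \<Omega>" "v \<in> L2 \<Omega>" "AE x in lebesgue_on \<Omega>. u x = v x"
  shows "C_op \<Omega> \<T> K u = C_op \<Omega> \<T> K v"
  unfolding C_op_def using local_projection_cong[OF _ assms] by simp

lemma C_op_add:
  assumes "u \<in> L2 \<Omega>" "v \<in> L2 \<Omega>"
  shows "C_op \<Omega> \<T> K (\<lambda>x. u x + v x) = (\<lambda>x. C_op \<Omega> \<T> K u x + C_op \<Omega> \<T> K v x)"
  unfolding C_op_def using local_projection_add[OF _ assms]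
  by (simp add: fun_eq_iff distrib_left sum.distrib)

lemma C_op_scale:
  assumes "u \<in> L2 \<Omega>"
  shows "C_op \<Omega> \<T> K (\<lambda>x. a * u x) = (\<lambda>x. a * C_op \<Omega> \<T> K u x)"
  unfolding C_op_def using local_projection_scale[OF _ assms]
  by (simp add: fun_eq_iff sum_distrib_left mult.left_commute)

lemma C_op_pw_polynomial:
  assumes "1 \<le> K" "u \<in> L2 \<Omega>"
  shows "C_op \<Omega> \<T> K u \<in> pw_polynomials K \<T>"
  unfolding C_op_def
  using hat_mult_pw_polynomial[OF _ local_projection_in[OF _ weightable_L2[OF assms(2)]], of _ "K - 1"] assms(1)
  by (intro fun_subspace_sum[OF subspace_pw_polynomials]) simp

text \<open>Since \<open>C\<^sub>i u\<close> belongs to the patch space, \<open>v\<close> may be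
  replaced by its projection in \<open>\<langle>v, C\<^sub>i u\<rangle>\<^sub>i\<close>.\<close>

lemma L2_inner_C_op:
  assumes u: "u \<in> L2 \<Omega>" and v: "v \<in> L2 \<Omega>"
  shows "L2_inner \<Omega> (C_op \<Omega> \<T> K u) v = (\<Sum>i\<in>nodes \<T>.
    weighted_inner \<Omega> \<T> i (local_projection \<Omega> \<T> (K - 1) i u) (local_projection \<Omega> \<T> (K - 1) i v))"
proof -
  let ?P = "local_projection \<Omega> \<T> (K - 1)"
  note P = local_projection_in[OF _ weightable_L2]
  have "L2_inner \<Omega> (C_op \<Omega> \<T> K u) v = (\<integral>x. (\<Sum>i\<in>nodes \<T>. v x * (hat \<T> i x * ?P i u x)) \<partial>lebesgue_on \<Omega>)"
    by (simp add: L2_inner_def C_op_def sum_distrib_left mult.commute)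
  also have "\<dots> = (\<Sum>i\<in>nodes \<T>. \<integral>x. v x * (hat \<T> i x * ?P i u x) \<partial>lebesgue_on \<Omega>)"
    using continuous_on_pw_polynomial[OF hat_mult_pw_polynomial[OF _ P[OF _ u]]]
    by (intro Bochner_Integration.integral_sum integrable_L2_mult[OF v]) blast
  also have "\<dots> = (\<Sum>i\<in>nodes \<T>. weighted_inner \<Omega> \<T> i (?P i u) (?P i v))"
  proof (rule sum.cong[OF refl])
    fix i assume i: "i \<in> nodes \<T>"
    have "(\<integral>x. v x * (hat \<T> i x * ?P i u x) \<partial>lebesgue_on \<Omega>) = weighted_inner \<Omega> \<T> i v (?P i u)"
      by (simp add: weighted_inner_eq ac_simps)
    also have "\<dots> = weighted_inner \<Omega> \<T> i (?P i v) (?P i u)"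
      using local_projection_inner[OF i weightable_L2[OF v] P[OF i u]] by simp
    also have "\<dots> = weighted_inner \<Omega> \<T> i (?P i u) (?P i v)" by (rule weighted_inner_commute)
    finally show "(\<integral>x. v x * (hat \<T> i x * ?P i u x) \<partial>lebesgue_on \<Omega>) = \<dots>" .
  qed
  finally show ?thesis .
qed

lemma L2_inner_commute: "L2_inner S u v = L2_inner S v u"
  by (simp add: L2_inner_def mult.commute)

lemma C_op_self_adjoint:
  assumes "u \<in> L2 \<Omega>" "v \<in> L2 \<Omega>"
  shows "L2_inner \<Omega> (C_op \<Omega> \<T> K u) v = L2_inner \<Omega> u (C_op \<Omega> \<T> K v)"
  using L2_inner_C_op[OF assms] L2_inner_C_op[OF assms(2,1)] weighted_inner_commute
  by (simp add: L2_inner_commute[of \<Omega> u])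

text \<open>Cut off to a patch, \<open>v\<close> already lies in the patch space and is its own
  projection; the hat functions then sum to 1.\<close>

lemma C_op_identity:
  assumes v: "v \<in> pw_polynomials (K - 1) \<T>"
  shows "C_op \<Omega> \<T> K v = v"
proof
  fix x
  have P: "local_projection \<Omega> \<T> (K - 1) i v = (\<lambda>x. if x \<in> \<Union>(patch \<T> i) then v x else 0)"
    if i: "i \<in> nodes \<T>" for i
  proof (rule local_projection_eqI[OF i pw_polynomials_restrict[OF v patch_subset]])
    fix z
    have "hat \<T> i x * (if x \<in> \<Union>(patch \<T> i) then v x else 0) * z x = hat \<T> i x * v x * z x" for x
      using hat_eq_0[OF i, of x] by simp
    then show "weighted_inner \<Omega> \<T> i (\<lambda>x. if x \<in> \<Union>(patch \<T> i) then v x else 0) z = weighted_inner \<Omega> \<T> i v z"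
      by (simp only: weighted_inner_eq)
  qed
  have "C_op \<Omega> \<T> K v x = (\<Sum>i\<in>nodes \<T>. hat \<T> i x * v x)"
    unfolding C_op_def
  proof (rule sum.cong[OF refl])
    fix i assume i: "i \<in> nodes \<T>"
    show "hat \<T> i x * local_projection \<Omega> \<T> (K - 1) i v x = hat \<T> i x * v x"
      unfolding P[OF i] using hat_eq_0[OF i, of x] by simp
  qed
  also have "\<dots> = (\<Sum>i\<in>nodes \<T>. hat \<T> i x) * v x" by (simp add: sum_distrib_right)
  also have "\<dots> = v x"
    using sum_hat[of x] v by (cases "x \<in> \<Union>\<T>") (auto simp: pw_polynomials_def)
  finally show "C_op \<Omega> \<T> K v x = v x" .
qed

lemma L2_inner_nonneg: "0 \<le> L2_inner S u u"
  unfolding L2_inner_def by (rule Bochner_Integration.integral_nonneg) simp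

lemma L2_inner_definite:
  assumes u: "u \<in> pw_polynomials k \<T>" and 0: "L2_inner \<Omega> u u = 0"
  shows "u = (\<lambda>x. 0)"
proof
  fix x
  have "integrable (lebesgue_on \<Omega>) (\<lambda>x. u x * u x)"
    using continuous_on_pw_polynomial[OF u] by (intro integrable_domain continuous_intros)
  then have "AE x in lebesgue_on \<Omega>. u x * u x = 0"
    using 0 unfolding L2_inner_def by (subst (asm) integral_nonneg_eq_0_iff_AE) auto
  then have ae: "AE x in lebesgue_on \<Omega>. x \<in> interior T \<longrightarrow> u x = 0" for T by eventually_elim simp
  show "u x = 0"
  proof (cases "x \<in> \<Union>\<T>")
    case True
    then show ?thesis using AE_zero_imp_zero[OF _ continuous_on_pw_polynomial[OF u] ae] by blast
  next
    case False
    then show ?thesis using u by (simp add: pw_polynomials_def)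
  qed
qed

lemma L2_inner_add:
  assumes "u \<in> pw_polynomials k \<T>" "v \<in> pw_polynomials k \<T>" "w \<in> pw_polynomials k \<T>"
  shows "L2_inner \<Omega> (\<lambda>x. u x + v x) w = L2_inner \<Omega> u w + L2_inner \<Omega> v w"
proof -
  have "integrable (lebesgue_on \<Omega>) (\<lambda>x. z x * w x)" if "z \<in> pw_polynomials k \<T>" for z
    using continuous_on_pw_polynomial[OF that] continuous_on_pw_polynomial[OF assms(3)]
    by (intro integrable_domain continuous_intros)
  then show ?thesis using assms by (simp add: L2_inner_def distrib_right)
qed

lemma L2_inner_scale: "L2_inner S (\<lambda>x. c * u x) v = c * L2_inner S u v"
  by (simp add: L2_inner_def mult.assoc)

lemma weighted_inner_diff:
  assumes i: "i \<in> nodes \<T>" and u: "u \<in> weightable i" "\<And>T. T \<in> patch \<T> i \<Longrightarrow> continuous_on T u"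
    and v: "\<And>T. T \<in> patch \<T> i \<Longrightarrow> continuous_on T v"
  shows "weighted_inner \<Omega> \<T> i (\<lambda>x. u x - s * v x) (\<lambda>x. u x - s * v x) =
    weighted_inner \<Omega> \<T> i u u - 2 * s * weighted_inner \<Omega> \<T> i u v + s\<^sup>2 * weighted_inner \<Omega> \<T> i v v"
proof -
  have v': "v \<in> weightable i" using v by (auto simp: weightable_def)
  have "hat \<T> i x * (u x - s * v x) * (u x - s * v x) =
      hat \<T> i x * u x * u x - 2 * s * (hat \<T> i x * u x * v x) + s\<^sup>2 * (hat \<T> i x * v x * v x)" for x
    by (simp add: power2_eq_square algebra_simps)
  then show ?thesis
    using weighted_integrable[OF i u(1) u(2)] weighted_integrable[OF i u(1) v] weighted_integrable[OF i v' v]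
    by (simp add: weighted_inner_eq)
qed

text \<open>Used with the restrictions of \<open>u\<close> to the patches and with its lifts, two
  decompositions of the same function by the hat functions.\<close>

lemma L2_inner_partition:
  assumes u: "u \<in> pw_polynomials k \<T>" and w: "\<And>i. i \<in> nodes \<T> \<Longrightarrow> w i \<in> pw_polynomials m (patch \<T> i)"
    and eq: "\<And>x. x \<in> \<Union>\<T> \<Longrightarrow> (\<Sum>i\<in>nodes \<T>. hat \<T> i x * w i x) = z x"
  shows "(\<Sum>i\<in>nodes \<T>. weighted_inner \<Omega> \<T> i u (w i)) = L2_inner \<Omega> u z"
proof -
  have "L2_inner \<Omega> u z = (\<integral>x. (\<Sum>i\<in>nodes \<T>. hat \<T> i x * u x * w i x) \<partial>lebesgue_on \<Omega>)"
    unfolding L2_inner_def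
  proof (rule Bochner_Integration.integral_cong[OF refl])
    fix x assume "x \<in> space (lebesgue_on \<Omega>)"
    then have "x \<in> \<Union>\<T>" using domain_subset by auto
    from eq[OF this, symmetric] show "u x * z x = (\<Sum>i\<in>nodes \<T>. hat \<T> i x * u x * w i x)"
      by (simp add: sum_distrib_left algebra_simps)
  qed
  also have "\<dots> = (\<Sum>i\<in>nodes \<T>. \<integral>x. hat \<T> i x * u x * w i x \<partial>lebesgue_on \<Omega>)"
    using weighted_integrable[OF _ weightable_L2[OF pw_polynomial_L2[OF u]]] continuous_on_pw_polynomial[OF w]
    by (intro Bochner_Integration.integral_sum) blast
  finally show ?thesis by (simp add: weighted_inner_eq)
qed

lemma L2_inner_eq_sum_weighted:
  assumes u: "u \<in> pw_polynomials k \<T>"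
  shows "(\<Sum>i\<in>nodes \<T>. weighted_inner \<Omega> \<T> i u u) = L2_inner \<Omega> u u"
proof -
  let ?w = "\<lambda>i x. if x \<in> \<Union>(patch \<T> i) then u x else 0"
  have hw: "hat \<T> i x * ?w i x = hat \<T> i x * u x" if "i \<in> nodes \<T>" for i x
    using hat_eq_0[OF that, of x] by simp
  have "(\<Sum>i\<in>nodes \<T>. weighted_inner \<Omega> \<T> i u (?w i)) = L2_inner \<Omega> u u"
  proof (rule L2_inner_partition[OF u pw_polynomials_restrict[OF u patch_subset]])
    fix x assume "x \<in> \<Union>\<T>"
    have "(\<Sum>i\<in>nodes \<T>. hat \<T> i x * ?w i x) = (\<Sum>i\<in>nodes \<T>. hat \<T> i x * u x)"
      by (rule sum.cong[OF refl hw])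
    also have "\<dots> = u x"
      using sum_hat[OF \<open>x \<in> \<Union>\<T>\<close>] by (simp flip: sum_distrib_right)
    finally show "(\<Sum>i\<in>nodes \<T>. hat \<T> i x * ?w i x) = u x" .
  qed
  moreover have "weighted_inner \<Omega> \<T> i u (?w i) = weighted_inner \<Omega> \<T> i u u" if "i \<in> nodes \<T>" for i
    unfolding weighted_inner_eq using hw[OF that]
    by (intro Bochner_Integration.integral_cong refl) (metis mult.assoc mult.commute)
  ultimately show ?thesis by simp
qed

lemma C_op_le:
  assumes u: "u \<in> pw_polynomials K \<T>"
  shows "L2_inner \<Omega> (C_op \<Omega> \<T> K u) u \<le> L2_inner \<Omega> u u"
proof -
  let ?P = "\<lambda>i. local_projection \<Omega> \<T> (K - 1) i u"
  note L2 = pw_polynomial_L2[OF u]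
  have "weighted_inner \<Omega> \<T> i (?P i) (?P i) \<le> weighted_inner \<Omega> \<T> i u u" if i: "i \<in> nodes \<T>" for i
  proof -
    note P = local_projection_in[OF i weightable_L2[OF L2]]
    have "0 \<le> weighted_inner \<Omega> \<T> i (\<lambda>x. u x - 1 * ?P i x) (\<lambda>x. u x - 1 * ?P i x)"
      by (rule weighted_inner_nonneg)
    also have "\<dots> = weighted_inner \<Omega> \<T> i u u - 2 * 1 * weighted_inner \<Omega> \<T> i u (?P i) +
        1\<^sup>2 * weighted_inner \<Omega> \<T> i (?P i) (?P i)"
      using continuous_on_pw_polynomial[OF u] patch_subset[of i]
      by (intro weighted_inner_diff[OF i weightable_L2[OF L2]] continuous_on_pw_polynomial[OF P]) auto
    finally show ?thesis using local_projection_inner[OF i weightable_L2[OF L2] P] by simp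
  qed
  then have "(\<Sum>i\<in>nodes \<T>. weighted_inner \<Omega> \<T> i (?P i) (?P i)) \<le> (\<Sum>i\<in>nodes \<T>. weighted_inner \<Omega> \<T> i u u)"
    by (rule sum_mono)
  then show ?thesis by (simp add: L2_inner_C_op[OF L2 L2] L2_inner_eq_sum_weighted[OF u])
qed

text \<open>Expanding \<open>0 \<le> \<Sum>\<^sub>i \<parallel>C\<^sub>i u - s w\<^sub>i\<parallel>\<^sup>2\<close> with \<open>w\<^sub>i\<close> the lift of \<open>u\<close>, for which
  \<open>\<Sum>\<^sub>i \<langle>C\<^sub>i u, w\<^sub>i\<rangle> = \<parallel>u\<parallel>\<^sup>2\<close>, and choosing \<open>s = K / (2 K + d)\<close>.\<close>

lemma C_op_ge:
  assumes K: "1 \<le> K" and u: "u \<in> pw_polynomials K \<T>"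
  shows "real K / (2 * real K + real DIM('a)) * L2_inner \<Omega> u u \<le> L2_inner \<Omega> (C_op \<Omega> \<T> K u) u"
proof -
  let ?P = "\<lambda>i. local_projection \<Omega> \<T> (K - 1) i u"
  let ?N = "L2_inner \<Omega> u u" and ?Q = "L2_inner \<Omega> (C_op \<Omega> \<T> K u) u"
  define s where "s = real K / (2 * real K + real DIM('a))"
  note L2 = pw_polynomial_L2[OF u]
  note P = local_projection_in[OF _ weightable_L2[OF L2], of _ "K - 1"]
  note w = lift_pw_polynomial[OF K _ u]
  have inner: "weighted_inner \<Omega> \<T> i (?P i) (lift K u i) = weighted_inner \<Omega> \<T> i u (lift K u i)"
    if "i \<in> nodes \<T>" for i
    using local_projection_inner[OF that weightable_L2[OF L2] w[OF that]] .
  have "0 \<le> (\<Sum>i\<in>nodes \<T>. weighted_inner \<Omega> \<T> i (\<lambda>x. ?P i x - s * lift K u i x) (\<lambda>x. ?P i x - s * lift K u i x))"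
    by (intro sum_nonneg weighted_inner_nonneg)
  also have "\<dots> = (\<Sum>i\<in>nodes \<T>. weighted_inner \<Omega> \<T> i (?P i) (?P i) -
      2 * s * weighted_inner \<Omega> \<T> i u (lift K u i) + s\<^sup>2 * weighted_inner \<Omega> \<T> i (lift K u i) (lift K u i))"
  proof (rule sum.cong[OF refl])
    fix i assume i: "i \<in> nodes \<T>"
    show "weighted_inner \<Omega> \<T> i (\<lambda>x. ?P i x - s * lift K u i x) (\<lambda>x. ?P i x - s * lift K u i x) =
        weighted_inner \<Omega> \<T> i (?P i) (?P i) - 2 * s * weighted_inner \<Omega> \<T> i u (lift K u i) +
        s\<^sup>2 * weighted_inner \<Omega> \<T> i (lift K u i) (lift K u i)"
      using weighted_inner_diff[OF i weightable_pw[OF P[OF i]] continuous_on_pw_polynomial[OF P[OF i]]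
          continuous_on_pw_polynomial[OF w[OF i]], of s] inner[OF i] by simp
  qed
  also have "\<dots> = ?Q - 2 * s * ?N + s\<^sup>2 * (\<Sum>i\<in>nodes \<T>. weighted_inner \<Omega> \<T> i (lift K u i) (lift K u i))"
    using L2_inner_partition[OF u w sum_hat_lift[OF K u]]
    by (simp add: L2_inner_C_op[OF L2 L2] sum.distrib sum_subtractf flip: sum_distrib_left)
  also have "\<dots> \<le> ?Q - 2 * s * ?N + s\<^sup>2 * ((2 * real K + real DIM('a)) / real K * ?N)"
    using lift_energy[OF K u] by (intro add_left_mono mult_left_mono) auto
  \<comment> \<open>\<open>s\<close> is the reciprocal of the constant in
    \<open>lift_energy\<close>; it minimizes the quadratic polynomial in \<open>s\<close> reached
    above.\<close>
  also have "s\<^sup>2 * ((2 * real K + real DIM('a)) / real K * ?N) = s * ?N"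
  proof -
    have "s * ((2 * real K + real DIM('a)) / real K) = 1"
      using K by (simp add: s_def)
    then show ?thesis by (simp add: power2_eq_square mult.assoc[symmetric]) (simp add: mult.assoc)
  qed
  finally have "s * ?N \<le> ?Q" by simp
  then show ?thesis by (simp only: s_def)
qed

lemma eigenvalue_bounds:
  assumes K: "1 \<le> K" and l: "l \<in> eigenvalues_on (pw_polynomials K \<T>) (C_op \<Omega> \<T> K)"
  shows "real K / (2 * real K + real DIM('a)) \<le> l" "l \<le> 1"
proof -
  obtain v where v: "v \<in> pw_polynomials K \<T>" "v \<noteq> (\<lambda>x. 0)" "C_op \<Omega> \<T> K v = (\<lambda>x. l * v x)"
    using l by (auto simp: eigenvalues_on_def)
  have "0 < L2_inner \<Omega> v v"
    using L2_inner_definite[OF v(1)] v(2) L2_inner_nonneg[of \<Omega> v] by fastforce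
  moreover have "L2_inner \<Omega> (C_op \<Omega> \<T> K v) v = l * L2_inner \<Omega> v v"
    by (simp add: v(3) L2_inner_scale)
  then have "real K / (2 * real K + real DIM('a)) * L2_inner \<Omega> v v \<le> l * L2_inner \<Omega> v v"
    "l * L2_inner \<Omega> v v \<le> 1 * L2_inner \<Omega> v v"
    using C_op_ge[OF K v(1)] C_op_le[OF v(1)] by simp_all
  ultimately show "real K / (2 * real K + real DIM('a)) \<le> l" "l \<le> 1"
    using mult_right_le_imp_le by blast+
qed

text \<open>Constants have degree at most \<open>K - 1\<close>, hence are fixed. This keeps the set
  of eigenvalues nonempty, as \<open>Max\<close> and \<open>Min\<close> require.\<close>

lemma eigenvalue_1:
  "1 \<in> eigenvalues_on (pw_polynomials K \<T>) (C_op \<Omega> \<T> K)"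
proof -
  let ?o = "\<lambda>x. if x \<in> \<Union>\<T> then 1 else (0::real)"
  have "?o \<in> pw_polynomials (K - 1) \<T>"
  proof (rule pw_polynomialsI)
    show "\<exists>p\<in>polynomials (K - 1). \<forall>x\<in>T. ?o x = p x" if "T \<in> \<T>" for T
      using that by (intro bexI[OF _ const_polynomials[of 1]]) auto
  qed auto
  then have "?o \<in> pw_polynomials K \<T>" "C_op \<Omega> \<T> K ?o = (\<lambda>x. 1 * ?o x)"
    using pw_polynomials_mono[of "K - 1" K \<T>] C_op_identity by auto
  moreover have "?o \<noteq> (\<lambda>x. 0)"
  proof
    assume 0: "?o = (\<lambda>x. 0)"
    obtain x where "x \<in> \<Union>\<T>" using domain_nonempty domain_subset by blast
    then show False using fun_cong[OF 0, of x] by simp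
  qed
  ultimately show ?thesis unfolding eigenvalues_on_def by blast
qed

text \<open>Self-adjointness makes eigenvectors of different eigenvalues orthogonal, so the finite
  dimension of the space bounds the number of eigenvalues.\<close>

lemma finite_eigenvalues:
  "finite (eigenvalues_on (pw_polynomials K \<T>) (C_op \<Omega> \<T> K))"
proof -
  let ?E = "eigenvalues_on (pw_polynomials K \<T>) (C_op \<Omega> \<T> K)"
  obtain B where B: "finite B" "pw_polynomials K \<T> \<subseteq> fun_span B"
    using pw_polynomials_finite_dim[OF finite_T] by blast
  have "\<forall>l\<in>?E. \<exists>v. v \<in> pw_polynomials K \<T> \<and> v \<noteq> (\<lambda>x. 0) \<and> C_op \<Omega> \<T> K v = (\<lambda>x. l * v x)"
    by (auto simp: eigenvalues_on_def)
  from bchoice[OF this] obtain e where "\<forall>l\<in>?E. e l \<in> pw_polynomials K \<T> \<and> e l \<noteq> (\<lambda>x. 0) \<and>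
      C_op \<Omega> \<T> K (e l) = (\<lambda>x. l * e l x)" ..
  then have e: "\<And>l. l \<in> ?E \<Longrightarrow> e l \<in> pw_polynomials K \<T>" "\<And>l. l \<in> ?E \<Longrightarrow> e l \<noteq> (\<lambda>x. 0)"
    "\<And>l. l \<in> ?E \<Longrightarrow> C_op \<Omega> \<T> K (e l) = (\<lambda>x. l * e l x)"
    by blast+
  show ?thesis
  proof (rule finite_orthogonal_family[where e = e and ip = "L2_inner \<Omega>", OF subspace_pw_polynomials B(2,1) e(1)])
    show "L2_inner \<Omega> (e l) (e l) \<noteq> 0" if "l \<in> ?E" for l
      using L2_inner_definite e(1,2)[OF that] by blast
    show "L2_inner \<Omega> (e l) (e m) = 0" if "l \<in> ?E" "m \<in> ?E" "l \<noteq> m" for l m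
    proof -
      have "l * L2_inner \<Omega> (e l) (e m) = L2_inner \<Omega> (e l) (\<lambda>x. m * e m x)"
        using C_op_self_adjoint[OF pw_polynomial_L2[OF e(1)[OF that(1)]] pw_polynomial_L2[OF e(1)[OF that(2)]], of K]
        by (simp add: e(3)[OF that(1)] e(3)[OF that(2)] L2_inner_scale)
      also have "\<dots> = m * L2_inner \<Omega> (e l) (e m)"
        by (metis L2_inner_commute L2_inner_scale)
      finally show ?thesis using that(3) by simp
    qed
  qed (auto simp: L2_inner_add L2_inner_scale)
qed

end

section \<open>The nodal distance and supports\<close>

lemma nodal_path_0 [simp]: "nodal_path \<T> 0 T T' \<longleftrightarrow> T \<in> \<T> \<and> T = T'"
  by (auto simp: nodal_path_def)

lemma nodal_path_trans:
  assumes "nodal_path \<T> M S T" "nodal_path \<T> N T U"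
  shows "nodal_path \<T> (M + N) S U"
proof -
  obtain s where s: "s 0 = S" "s M = T" "\<And>j. j \<le> M \<Longrightarrow> s j \<in> \<T>" "\<And>j. j < M \<Longrightarrow> neighbors (s j) (s (Suc j))"
    using assms(1) unfolding nodal_path_def by blast
  obtain t where t: "t 0 = T" "t N = U" "\<And>j. j \<le> N \<Longrightarrow> t j \<in> \<T>" "\<And>j. j < N \<Longrightarrow> neighbors (t j) (t (Suc j))"
    using assms(2) unfolding nodal_path_def by blast
  define r where "r j = (if j \<le> M then s j else t (j - M))" for j
  have "r (M + N) = U" using s t by (cases "N = 0") (auto simp: r_def)
  moreover have "r j \<in> \<T>" if "j \<le> M + N" for j using that s(3) t(3) by (auto simp: r_def)
  moreover have "neighbors (r j) (r (Suc j))" if "j < M + N" for j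
  proof -
    consider "j < M" | "j = M" | "j > M" by linarith
    then show ?thesis
    proof cases
      case 2
      then show ?thesis using t(4)[of 0] t(1) s(2) that by (simp add: r_def)
    next
      case 3
      then show ?thesis using t(4)[of "j - M"] that by (simp add: r_def Suc_diff_le)
    qed (use s(4) in \<open>simp add: r_def\<close>)
  qed
  ultimately show ?thesis
    unfolding nodal_path_def by (intro exI[of _ r]) (auto simp: r_def s(1))
qed

lemma neighbors_commute: "neighbors S T \<longleftrightarrow> neighbors T S"
  by (auto simp: neighbors_def)

lemma nodal_path_1:
  assumes "S \<in> \<T>" "T \<in> \<T>" "neighbors S T"
  shows "nodal_path \<T> 1 S T"
  unfolding nodal_path_def using assms
  by (intro exI[of _ "\<lambda>j. if j = 0 then S else T"]) auto

lemma nodal_path_sym: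
  assumes "nodal_path \<T> N S T"
  shows "nodal_path \<T> N T S"
proof -
  obtain s where s: "s 0 = S" "s N = T" "\<And>j. j \<le> N \<Longrightarrow> s j \<in> \<T>" "\<And>j. j < N \<Longrightarrow> neighbors (s j) (s (Suc j))"
    using assms unfolding nodal_path_def by blast
  have "neighbors (s (N - j)) (s (N - Suc j))" if "j < N" for j
    using s(4)[of "N - Suc j"] that by (simp add: Suc_diff_Suc neighbors_commute)
  then show ?thesis
    unfolding nodal_path_def using s by (intro exI[of _ "\<lambda>j. s (N - j)"]) auto
qed

text \<open>The complement of the support is a union of possibly uncountably many open sets; by
  Lindelof's theorem countably many suffice, and their exceptional null sets can be united.\<close>

lemma AE_zero_off_L2_support: "AE x in lebesgue_on \<Omega>. x \<notin> L2_support \<Omega> v \<longrightarrow> v x = 0"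
proof -
  let ?F = "{U. open U \<and> (AE y in lebesgue_on \<Omega>. y \<in> U \<longrightarrow> v y = 0)}"
  obtain F where F: "F \<subseteq> ?F" "countable F" "\<Union>F = \<Union>?F"
    using Lindelof[of ?F] by auto
  have "AE y in lebesgue_on \<Omega>. \<forall>U\<in>F. y \<in> U \<longrightarrow> v y = 0"
    using F(1) by (subst AE_ball_countable[OF F(2)]) blast
  then show ?thesis
  proof eventually_elim
    case (elim x)
    have "x \<in> \<Union>F" if "x \<notin> L2_support \<Omega> v" using that unfolding L2_support_def F(3) by blast
    then show ?case using elim by blast
  qed
qed

context triangulated_domain
begin

text \<open>By \<open>Int_T\<close> the intersection is the hull of the common vertices, so it is
  empty without them.\<close>

lemma neighbors_if_meet:
  assumes "S \<in> \<T>" "T \<in> \<T>" "S \<noteq> T" "x \<in> S" "x \<in> T"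
  shows "neighbors S T"
proof -
  have "convex hull (vertices S \<inter> vertices T) \<noteq> {}" using Int_T[OF assms(1,2)] assms(4,5) by blast
  then show ?thesis using assms(3) by (auto simp: neighbors_def)
qed

text \<open>The union of the simplices reachable from \<open>S\<close> and that of the remaining
  ones are closed and, as meeting simplices are neighbors, disjoint. They cover the connected
  closure of \<open>\<Omega>\<close>, so both cannot be nonempty.\<close>

lemma nodal_path_exists:
  assumes S: "S \<in> \<T>" and T: "T \<in> \<T>"
  shows "\<exists>N. nodal_path \<T> N S T"
proof (rule ccontr)
  assume no: "\<not> ?thesis"
  define R where "R = {U \<in> \<T>. \<exists>N. nodal_path \<T> N S U}"
  have disj: "\<Union>R \<inter> \<Union>(\<T> - R) = {}"
  proof (rule ccontr)
    assume "\<Union>R \<inter> \<Union>(\<T> - R) \<noteq> {}"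
    then obtain x U W where x: "U \<in> R" "x \<in> U" "W \<in> \<T>" "W \<notin> R" "x \<in> W" by blast
    then obtain N where N: "U \<in> \<T>" "nodal_path \<T> N S U" by (auto simp: R_def)
    have "neighbors U W" using neighbors_if_meet[OF N(1) x(3) _ x(2,5)] x by blast
    from nodal_path_trans[OF N(2) nodal_path_1[OF N(1) x(3) this]] have "W \<in> R"
      using x(3) by (auto simp: R_def)
    then show False using x by blast
  qed
  have closed: "closed (\<Union>R)" "closed (\<Union>(\<T> - R))"
    using finite_T closed_T by (auto intro!: closed_Union simp: R_def)
  have "connected (\<Union>\<T>)"
    using connected_domain by (simp add: Union_T connected_imp_connected_closure)
  then have "\<Union>R \<inter> \<Union>\<T> = {} \<or> \<Union>(\<T> - R) \<inter> \<Union>\<T> = {}"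
    by (rule connected_closedD) (use disj closed in auto)
  moreover have "S \<in> R" using S nodal_path_0[of \<T> S S] unfolding R_def by blast
  moreover have "T \<in> \<T> - R" using T no by (auto simp: R_def)
  moreover obtain x y where "x \<in> S" "y \<in> T" using int_T_nonempty[OF S] int_T_nonempty[OF T] interior_subset by blast
  ultimately show False using S T by blast
qed

lemma nodal_path_nodal_dist:
  assumes "S \<in> \<T>" "T \<in> \<T>"
  shows "nodal_path \<T> (nodal_dist \<T> S T) S T"
  unfolding nodal_dist_def by (rule LeastI_ex[OF nodal_path_exists[OF assms]])

lemma nodal_dist_le: "nodal_path \<T> N S T \<Longrightarrow> nodal_dist \<T> S T \<le> N"
  unfolding nodal_dist_def by (rule Least_le)

lemma nodal_dist_metric: "Metric_space \<T> (\<lambda>S T. real (nodal_dist \<T> S T))"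
proof
  show "real (nodal_dist \<T> S T) = real (nodal_dist \<T> T S)" for S T
    unfolding nodal_dist_def using nodal_path_sym[of \<T> _ S T] nodal_path_sym[of \<T> _ T S]
    by (metis (full_types))
  show "real (nodal_dist \<T> S T) = 0 \<longleftrightarrow> S = T" if "S \<in> \<T>" "T \<in> \<T>" for S T
    using nodal_path_nodal_dist[OF that] nodal_dist_le[of 0 S T] that by auto
  show "real (nodal_dist \<T> S U) \<le> real (nodal_dist \<T> S T) + real (nodal_dist \<T> T U)"
    if "S \<in> \<T>" "T \<in> \<T>" "U \<in> \<T>" for S T U
    using nodal_dist_le[OF nodal_path_trans[OF nodal_path_nodal_dist nodal_path_nodal_dist]] that
    by (simp flip: of_nat_add)
qed simp

text \<open>On \<open>\<Union>L\<close> the hat function of \<open>i\<close> vanishes, and elsewhere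
  \<open>v\<close> is 0 almost everywhere, so every weighted product with \<open>v\<close> is
  0.\<close>

lemma local_projection_eq_0:
  assumes i: "i \<in> nodes \<T>" and L: "L \<subseteq> \<T>" "L2_support \<Omega> v \<subseteq> \<Union>L" and far: "\<And>T. T \<in> L \<Longrightarrow> i \<notin> vertices T"
  shows "local_projection \<Omega> \<T> k i v = (\<lambda>x. 0)"
proof (rule local_projection_eqI[OF i fun_subspaceD(1)[OF subspace_pw_polynomials]])
  fix z
  have "AE x in lebesgue_on \<Omega>. hat \<T> i x * v x * z x = 0"
  proof -
    have "AE x in lebesgue_on \<Omega>. \<forall>T\<in>\<T>. x \<notin> frontier T"
      using AE_not_frontier unfolding AE_domain_iff by (auto elim: eventually_mono)
    then show ?thesis
      using AE_zero_off_L2_support[of \<Omega> v]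
    proof eventually_elim
      case (elim x)
      show ?case
      proof (cases "x \<in> \<Union>L")
        case True
        then obtain S where S: "S \<in> L" "x \<in> S" by blast
        then have "hat \<T> i x = 0"
          using hat_eq[of S x i] far[OF S(1)] L(1) by (auto simp: nodal_coord_def)
        then show ?thesis by simp
      next
        case False
        then show ?thesis using elim(2) L(2) by auto
      qed
    qed
  qed
  then have "weighted_inner \<Omega> \<T> i v z = 0"
    unfolding weighted_inner_eq by (rule integral_eq_zero_AE)
  then show "weighted_inner \<Omega> \<T> i (\<lambda>x. 0) z = weighted_inner \<Omega> \<T> i v z"
    by (simp add: weighted_inner_eq)
qed

text \<open>If no vertex of \<open>T\<close> belonged to a simplex of \<open>L\<close>, all
  projections contributing on \<open>T\<close> would vanish. Then the image would be 0 on
  \<open>T\<close>, and the nonempty interior of \<open>T\<close> would lie outside the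
  support.\<close>

lemma L2_support_C_op:
  assumes L: "L \<subseteq> \<T>" "L2_support \<Omega> v \<subseteq> \<Union>L" and T: "T \<in> \<T>" "T \<subseteq> L2_support \<Omega> (C_op \<Omega> \<T> K v)"
  shows "\<exists>S\<in>L. nodal_dist \<T> T S \<le> 1"
proof -
  have "\<exists>i\<in>vertices T. \<exists>S\<in>L. i \<in> vertices S"
  proof (rule ccontr)
    assume far: "\<not> ?thesis"
    have "C_op \<Omega> \<T> K v x = 0" if x: "x \<in> T" for x
    proof -
      have "C_op \<Omega> \<T> K v x = (\<Sum>i\<in>vertices T. bary (vertices T) i x * local_projection \<Omega> \<T> (K - 1) i v x)"
        unfolding C_op_def by (rule sum_hat_mult[OF T(1) x])
      also have "\<dots> = 0"
        using far local_projection_eq_0[OF _ L, of _ "K - 1"] vertices_nodes[OF T(1)]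
        by (intro sum.neutral) auto
      finally show ?thesis .
    qed
    then have "interior T \<in> {U. open U \<and> (AE y in lebesgue_on \<Omega>. y \<in> U \<longrightarrow> C_op \<Omega> \<T> K v y = 0)}"
      using interior_subset[of T] by (auto intro!: AE_I2)
    then have "interior T \<inter> L2_support \<Omega> (C_op \<Omega> \<T> K v) = {}"
      unfolding L2_support_def by blast
    then show False using T int_T_nonempty interior_subset[of T] by blast
  qed
  then obtain i S where S: "i \<in> vertices T" "S \<in> L" "i \<in> vertices S" by blast
  then have "S \<in> \<T>" using L by blast
  have "nodal_dist \<T> T S \<le> 1"
  proof (cases "S = T")
    case True
    then show ?thesis using nodal_dist_le[of 0 T S] T by simp
  next
    case False
    then have "neighbors T S" using S by (auto simp: neighbors_def)
    then show ?thesis using nodal_dist_le[OF nodal_path_1] T \<open>S \<in> \<T>\<close> by blast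
  qed
  then show ?thesis using S by blast
qed

end

theorem theorem3p2:
  fixes \<Omega> :: "'a::euclidean_space set" and \<T> :: "'a set set" and K :: nat
  assumes "K \<ge> 1"
    and "bounded_polyhedral_domain \<Omega>"
    and "regular_triangulation \<Omega> \<T>"
  shows
    "let C = C_op \<Omega> \<T> K; \<delta> = nodal_dist \<T> in
     ((\<forall>u\<in>L2 \<Omega>. C u \<in> pw_polynomials K \<T>) \<and>
      (\<forall>u\<in>L2 \<Omega>. \<forall>v\<in>L2 \<Omega>. (AE x in lebesgue_on \<Omega>. u x = v x) \<longrightarrow> C u = C v) \<and>
      (\<forall>u\<in>L2 \<Omega>. \<forall>v\<in>L2 \<Omega>. C (\<lambda>x. u x + v x) = (\<lambda>x. C u x + C v x)) \<and>
      (\<forall>a. \<forall>u\<in>L2 \<Omega>. C (\<lambda>x. a * u x) = (\<lambda>x. a * C u x)) \<and>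
      (\<forall>u\<in>L2 \<Omega>. \<forall>v\<in>L2 \<Omega>. L2_inner \<Omega> (C u) v = L2_inner \<Omega> u (C v))) \<and>
     (L2_elliptic_on (pw_polynomials K \<T>) C \<and>
      cond2 (pw_polynomials K \<T>) C =
        lambda_max (pw_polynomials K \<T>) C / lambda_min (pw_polynomials K \<T>) C \<and>
      cond2 (pw_polynomials K \<T>) C \<le> (2 * real K + real DIM('a)) / real K) \<and>
     (Metric_space \<T> (\<lambda>T T'. real (\<delta> T T')) \<and>
      (\<forall>T\<in>\<T>. \<forall>T'\<in>\<T>. nodal_path \<T> (\<delta> T T') T T' \<and>
         (\<forall>N. nodal_path \<T> N T T' \<longrightarrow> \<delta> T T' \<le> N))) \<and>
     (\<forall>v\<in>L2 \<Omega>. \<forall>L\<subseteq>\<T>. L2_support \<Omega> v \<subseteq> \<Union>L \<longrightarrow>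
        (\<forall>T'\<in>\<T>. T' \<subseteq> L2_support \<Omega> (C v) \<longrightarrow> L \<noteq> {} \<and> (MIN T\<in>L. \<delta> T' T) \<le> 1)) \<and>
     (\<forall>v\<in>pw_polynomials (K - 1) \<T>. C v = v)"
proof -
  interpret triangulated_domain \<Omega> \<T>
    using assms by unfold_locales
  let ?V = "pw_polynomials K \<T>" and ?C = "C_op \<Omega> \<T> K"
  let ?E = "eigenvalues_on ?V ?C" and ?r = "real K / (2 * real K + real DIM('a))"
  have r: "0 < ?r" using assms(1) by simp
  have E: "finite ?E" "?E \<noteq> {}" using finite_eigenvalues eigenvalue_1 by auto
  have min: "?r \<le> Min ?E" using E eigenvalue_bounds(1)[OF assms(1)] by simp
  have max: "Max ?E \<le> 1" using E eigenvalue_bounds(2)[OF assms(1)] by simp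
  have "Max ?E / Min ?E \<le> 1 / ?r"
    using r min max by (intro frac_le) auto
  then have spectral: "L2_elliptic_on ?V ?C" "cond2 ?V ?C \<le> (2 * real K + real DIM('a)) / real K"
    using E r min by (auto simp: L2_elliptic_on_def cond2_def lambda_min_def lambda_max_def)
  \<comment> \<open>Nonemptiness is part of the claim because a minimum over an empty set carries no
    information.\<close>
  have support: "L \<noteq> {} \<and> (MIN T\<in>L. nodal_dist \<T> T' T) \<le> 1"
    if L: "L \<subseteq> \<T>" "L2_support \<Omega> v \<subseteq> \<Union>L" "T' \<in> \<T>" "T' \<subseteq> L2_support \<Omega> (?C v)" for v L T'
  proof -
    obtain S where S: "S \<in> L" "nodal_dist \<T> T' S \<le> 1" using L2_support_C_op[OF L] by blast
    moreover have "finite L" using L(1) finite_T finite_subset by blast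
    ultimately have "(MIN T\<in>L. nodal_dist \<T> T' T) \<le> nodal_dist \<T> T' S" by simp
    then show ?thesis using S by auto
  qed
  have "\<forall>u\<in>L2 \<Omega>. ?C u \<in> ?V"
    using C_op_pw_polynomial[OF assms(1)] by blast
  moreover have "\<forall>u\<in>L2 \<Omega>. \<forall>v\<in>L2 \<Omega>. (AE x in lebesgue_on \<Omega>. u x = v x) \<longrightarrow> ?C u = ?C v"
    by (intro ballI impI C_op_cong)
  moreover have "\<forall>u\<in>L2 \<Omega>. \<forall>v\<in>L2 \<Omega>. ?C (\<lambda>x. u x + v x) = (\<lambda>x. ?C u x + ?C v x)"
    by (intro ballI C_op_add)
  moreover have "\<forall>a. \<forall>u\<in>L2 \<Omega>. ?C (\<lambda>x. a * u x) = (\<lambda>x. a * ?C u x)"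
    by (intro allI ballI C_op_scale)
  moreover have "\<forall>u\<in>L2 \<Omega>. \<forall>v\<in>L2 \<Omega>. L2_inner \<Omega> (?C u) v = L2_inner \<Omega> u (?C v)"
    by (intro ballI C_op_self_adjoint)
  moreover have "cond2 ?V ?C = lambda_max ?V ?C / lambda_min ?V ?C"
    by (rule cond2_def)
  moreover have "\<forall>T\<in>\<T>. \<forall>T'\<in>\<T>. nodal_path \<T> (nodal_dist \<T> T T') T T' \<and>
      (\<forall>N. nodal_path \<T> N T T' \<longrightarrow> nodal_dist \<T> T T' \<le> N)"
    by (intro ballI conjI allI impI nodal_path_nodal_dist nodal_dist_le)
  moreover have "\<forall>v\<in>L2 \<Omega>. \<forall>L\<subseteq>\<T>. L2_support \<Omega> v \<subseteq> \<Union>L \<longrightarrow>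
      (\<forall>T'\<in>\<T>. T' \<subseteq> L2_support \<Omega> (?C v) \<longrightarrow> L \<noteq> {} \<and> (MIN T\<in>L. nodal_dist \<T> T' T) \<le> 1)"
    by (intro ballI allI impI support)
  moreover have "\<forall>v\<in>pw_polynomials (K - 1) \<T>. ?C v = v"
    by (intro ballI C_op_identity)
  ultimately show ?thesis
    unfolding Let_def using spectral nodal_dist_metric by (intro conjI)
qed

end
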